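(* Assume the QBD with transition matrix $P$ is not null recurrent. Let $\boldsymbol g=(\boldsymbol g_r)_{r\ge 0}$ with $\boldsymbol g_r\in\mathbb C^m$. The general solution $\boldsymbol u=(\boldsymbol u_r)_{r\ge0}$, $\boldsymbol u_r\in\mathbb C^m$, of the Poisson equation $(I-P)\boldsymbol u=\boldsymbol g$ is given by $$\boldsymbol u_r=G^r\boldsymbol x+LV_1^{-r}\boldsymbol y+\boldsymbol\sigma_r,\qquad r\ge 0,$$ where $$\boldsymbol\sigma_r=-\sum_{k=1}^{r}\left(G^{r-k}-LV_1^{k-r}E\right)W\boldsymbol g_k-\sum_{j=1}^{\nu-1}KV_0^jFW\boldsymbol g_{j+r},\qquad r\ge 0,$$ and $\boldsymbol x$ and $\boldsymbol y$ satisfy the following constraints. (a) If the QBD is transient, then $\boldsymbol y\in\mathbb C^p$ is arbitrary and $$\boldsymbol x=(I-P_* )^{-1}\left(\left((B-I)\widehat G+A_1\right)\left(\boldsymbol\sigma_1+LV_1^{-1}\boldsymbol y\right)+\boldsymbol g_0\right),$$ where $P_*=B+A_1G$ and $\boldsymbol\sigma_1=-\sum_{j=0}^{\nu-1}KV_0^jFW\boldsymbol g_{j+1}$. (b) If the QBD is positive recurrent and if the series $\sum_{k=0}^\infty R^k\boldsymbol g_k$ converges, then $$\boldsymbol y=\boldsymbol y^*+\boldsymbol y_\perp,$$ $$\boldsymbol x=(I-P_* )^{\#}\left(\left((B-I)\widehat G+A_1\right)\left(\boldsymbol\sigma_1+LV_1^{-1}\boldsymbol y\right)+\boldsymbol g_0\right)+\alpha\boldsymbol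 1,$$ where $P_*$ and $\boldsymbol\sigma_1$ are as in (a), $\boldsymbol y^*=-\sum_{k=1}^\infty V_1^kEW\boldsymbol g_k$, the vector $\boldsymbol y_\perp\in\mathbb C^p$ is any vector satisfying $\boldsymbol\pi_0^TW^{-1}L\boldsymbol y_\perp=\boldsymbol\pi^T\boldsymbol g$, and $\alpha$ is an arbitrary constant.
   Context: QBD process. Let $m\ge1$ be an integer and let $B,A_{-1},A_0,A_1$ be nonnegative $m\times m$ matrices such that the infinite block tridiagonal matrix $P=(P_{i,j})_{i,j\ge 0}$ with $m\times m$ blocks $P_{0,0}=B$, $P_{i,i}=A_0$ for $i\ge1$, $P_{i,i+1}=A_1$ for $i\ge 0$, $P_{i,i-1}=A_{-1}$ for $i\ge1$, and all other blocks zero, is row-stochastic ($P\boldsymbol 1=\boldsymbol 1$, where $\boldsymbol 1$ is the all-ones vector of the appropriate size). $P$ is the transition matrix of a discrete-time Markov chain (a QBD) on $\mathbb N\times\mathcal E$, $\mathcal E=\{1,\dots,m\}$; "positive recurrent", "null recurrent", "transient" refer to this chain. Infinite vectors are partitioned into blocks of length $m$ indexed by $\mathbb N=\{0,1,\dots\}$. Standing assumptions: $P$ is irreducible; $A_{-1}+A_0+A_1$ is irreducible; and the doubly infinite QBD on $\mathbb Z\times\mathcal E$ (with transition blocks $A_{-1},A_0,A_1$ for level changes $-1,0,+1$) has only one final class $\mathbb Z\times\mathcal E_*$, with $\emptyset\ne\mathcal E_*\subseteq\mathcal E$, and every other state is on a path to the final class. $G$, $\widehat G$, $R$ are the minimal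 nonnegative solutions of $A_{-1}+(A_0-I)X+A_1X^2=0$, $A_1+(A_0-I)X+A_{-1}X^2=0$ and $A_1+X(A_0-I)+X^2A_{-1}=0$, respectively. Put $U=A_0+RA_{-1}$ (equivalently $U=A_0+A_1G$). When the QBD is not null recurrent, $W=\sum_{j=0}^\infty G^j(U-I)^{-1}R^j$ converges and is nonsingular. $M$ is a nonsingular matrix such that $\widehat GM=MJ$ with $J=\mathrm{diag}(V_1,V_0)$, where $V_1$ is a nonsingular $p\times p$ matrix, $0\le p\le m$, and $V_0$ is an $(m-p)\times(m-p)$ matrix with spectral radius $0$ (for instance a suitably ordered Jordan form). Write $M=[\,L\mid K\,]$ with $L$ of size $m\times p$ and $K$ of size $m\times(m-p)$, and $M^{-1}=\begin{bmatrix}E\\ F\end{bmatrix}$ with $E$ of size $p\times m$ and $F$ of size $(m-p)\times m$. $\nu$ is the smallest positive integer with $V_0^\nu=0$. (Terms involving empty blocks are absent when $p=0$ or $p=m$.) In the positive recurrent case, $\boldsymbol\pi=(\boldsymbol\pi_i)_{i\ge0}$ is the stationary distribution of $P$, partitioned in blocks of length $m$; it satisfies $\boldsymbol\pi_i^T=\boldsymbol\pi_0^TR^i$, and $\boldsymbol\pi^T\boldsymbol g=\sum_{i\ge0}\boldsymbol\pi_i^T\boldsymbol g_i$. The group inverse $H^\#$ of a square matrix $H$, when it exists, is the matrix satisfying $HH^\#=H^\#H$, $HH^\#H=H$, $H^\#HH^\#=H^\#$; it exists for $H=I-P_*$ when $P_*$ is an irreducible finite stochastic matrix. *)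

theory Defs
  imports
    "HOL-Analysis.Infinite_Sum"
    "Jordan_Normal_Form.Gauss_Jordan_Elimination"
    "Jordan_Normal_Form.Spectral_Radius"
begin

section \<open>Markov chains given by a kernel on a set of states\<close>

definition stochastic_on :: "'s set \<Rightarrow> ('s \<Rightarrow> 's \<Rightarrow> real) \<Rightarrow> bool" where
  "stochastic_on S K \<longleftrightarrow>
     (\<forall>s\<in>S. \<forall>t\<in>S. 0 \<le> K s t) \<and> (\<forall>s\<in>S. ((\<lambda>t. K s t) has_sum 1) S)"

definition reachable_on :: "'s set \<Rightarrow> ('s \<Rightarrow> 's \<Rightarrow> real) \<Rightarrow> 's \<Rightarrow> 's \<Rightarrow> bool" where
  "reachable_on S K s t \<longleftrightarrow> (s, t) \<in> {(a, b). a \<in> S \<and> b \<in> S \<and> 0 < K a b}\<^sup>*"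

definition irreducible_on :: "'s set \<Rightarrow> ('s \<Rightarrow> 's \<Rightarrow> real) \<Rightarrow> bool" where
  "irreducible_on S K \<longleftrightarrow> (\<forall>s\<in>S. \<forall>t\<in>S. reachable_on S K s t)"

text \<open>A final class is a communicating class that cannot be left.\<close>

definition final_class_on :: "'s set \<Rightarrow> ('s \<Rightarrow> 's \<Rightarrow> real) \<Rightarrow> 's set \<Rightarrow> bool" where
  "final_class_on S K C \<longleftrightarrow>
     C \<noteq> {} \<and> C \<subseteq> S \<and> (\<forall>s\<in>C. \<forall>t\<in>S. reachable_on S K s t \<longleftrightarrow> t \<in> C)"

text \<open>\<open>first_passage S K n s t\<close> is the probability that the chain started in \<open>s\<close> is in \<open>t\<close> at
  time \<open>n\<close> and not at any of the times \<open>1, \<dots>, n - 1\<close>; it is \<open>0\<close> for \<open>n = 0\<close>.\<close>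

fun first_passage :: "'s set \<Rightarrow> ('s \<Rightarrow> 's \<Rightarrow> real) \<Rightarrow> nat \<Rightarrow> 's \<Rightarrow> 's \<Rightarrow> real" where
  "first_passage S K 0 s t = 0"
| "first_passage S K (Suc 0) s t = K s t"
| "first_passage S K (Suc (Suc n)) s t =
     infsum (\<lambda>k. K s k * first_passage S K (Suc n) k t) (S - {t})"

definition return_prob :: "'s set \<Rightarrow> ('s \<Rightarrow> 's \<Rightarrow> real) \<Rightarrow> 's \<Rightarrow> real" where
  "return_prob S K s = (\<Sum>n. first_passage S K n s s)"

definition transient_chain :: "'s set \<Rightarrow> ('s \<Rightarrow> 's \<Rightarrow> real) \<Rightarrow> bool" where
  "transient_chain S K \<longleftrightarrow> (\<forall>s\<in>S. return_prob S K s < 1)"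

definition recurrent_chain :: "'s set \<Rightarrow> ('s \<Rightarrow> 's \<Rightarrow> real) \<Rightarrow> bool" where
  "recurrent_chain S K \<longleftrightarrow> (\<forall>s\<in>S. return_prob S K s = 1)"

text \<open>Positive recurrence: the mean return time \<open>\<Sum>n. n * f\<^sub>n(s,s)\<close> is finite.\<close>

definition positive_recurrent_chain :: "'s set \<Rightarrow> ('s \<Rightarrow> 's \<Rightarrow> real) \<Rightarrow> bool" where
  "positive_recurrent_chain S K \<longleftrightarrow>
     recurrent_chain S K \<and> (\<forall>s\<in>S. summable (\<lambda>n. real n * first_passage S K n s s))"

definition null_recurrent_chain :: "'s set \<Rightarrow> ('s \<Rightarrow> 's \<Rightarrow> real) \<Rightarrow> bool" where
  "null_recurrent_chain S K \<longleftrightarrow> recurrent_chain S K \<and> \<not> positive_recurrent_chain S K"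

definition stationary_distribution_on ::
    "'s set \<Rightarrow> ('s \<Rightarrow> 's \<Rightarrow> real) \<Rightarrow> ('s \<Rightarrow> real) \<Rightarrow> bool" where
  "stationary_distribution_on S K \<mu> \<longleftrightarrow>
     (\<forall>s\<in>S. 0 \<le> \<mu> s) \<and> (\<mu> has_sum 1) S \<and>
     (\<forall>t\<in>S. ((\<lambda>s. \<mu> s * K s t) has_sum \<mu> t) S)"


section \<open>Quasi-birth-and-death processes\<close>

text \<open>States are pairs (level, phase), with phases \<open>0, \<dots>, m - 1\<close>. The blocks \<open>Am\<close>, \<open>A0\<close>, \<open>A1\<close>
  belong to level changes \<open>-1\<close>, \<open>0\<close>, \<open>+1\<close>.\<close>

definition qbd_states :: "nat \<Rightarrow> (nat \<times> nat) set" where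
  "qbd_states m = UNIV \<times> {..<m}"

definition qbd :: "real mat \<Rightarrow> real mat \<Rightarrow> real mat \<Rightarrow> real mat
    \<Rightarrow> nat \<times> nat \<Rightarrow> nat \<times> nat \<Rightarrow> real" where
  "qbd B Am A0 A1 = (\<lambda>(i, a) (j, b).
     if i = 0 \<and> j = 0 then B $$ (a, b)
     else if j = i then A0 $$ (a, b)
     else if j = Suc i then A1 $$ (a, b)
     else if i = Suc j then Am $$ (a, b)
     else 0)"

definition bi_qbd :: "real mat \<Rightarrow> real mat \<Rightarrow> real mat
    \<Rightarrow> int \<times> nat \<Rightarrow> int \<times> nat \<Rightarrow> real" where
  "bi_qbd Am A0 A1 = (\<lambda>(i, a) (j, b).
     if j = i then A0 $$ (a, b)
     else if j = i + 1 then A1 $$ (a, b)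
     else if j = i - 1 then Am $$ (a, b)
     else 0)"

definition unique_final_class :: "nat \<Rightarrow> real mat \<Rightarrow> real mat \<Rightarrow> real mat \<Rightarrow> bool" where
  "unique_final_class m Am A0 A1 \<longleftrightarrow>
     (\<exists>E. E \<noteq> {} \<and> E \<subseteq> {..<m} \<and>
        {C. final_class_on (UNIV \<times> {..<m}) (bi_qbd Am A0 A1) C} = {UNIV \<times> E} \<and>
        (\<forall>s \<in> UNIV \<times> {..<m}. \<exists>t \<in> UNIV \<times> E.
           reachable_on (UNIV \<times> {..<m}) (bi_qbd Am A0 A1) s t))"

text \<open>\<open>u\<close> solves \<open>(I - P) u = g\<close>. Each row of \<open>P\<close> has finite support, so the infinite sum is a
  finite one.\<close>

definition poisson_solution ::
    "nat \<Rightarrow> (nat \<times> nat \<Rightarrow> nat \<times> nat \<Rightarrow> real) \<Rightarrow> (nat \<Rightarrow> complex vec) \<Rightarrow> (nat \<Rightarrow> complex vec) \<Rightarrow> bool"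
  where
  "poisson_solution m P g u \<longleftrightarrow>
     (\<forall>r. u r \<in> carrier_vec m) \<and>
     (\<forall>r. \<forall>a<m.
        u r $ a - infsum (\<lambda>(j, b). complex_of_real (P (r, a) (j, b)) * u j $ b) (qbd_states m)
          = g r $ a)"


section \<open>Matrices\<close>

text \<open>The order on matrices is entrywise and only relates matrices of equal dimensions.\<close>

definition minimal_nonneg_solution ::
    "nat \<Rightarrow> (real mat \<Rightarrow> real mat) \<Rightarrow> real mat \<Rightarrow> bool" where
  "minimal_nonneg_solution m f X \<longleftrightarrow>
     X \<in> carrier_mat m m \<and> 0\<^sub>m m m \<le> X \<and> f X = 0\<^sub>m m m \<and>
     (\<forall>Y \<in> carrier_mat m m. 0\<^sub>m m m \<le> Y \<and> f Y = 0\<^sub>m m m \<longrightarrow> X \<le> Y)"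

text \<open>\<open>minv A\<close> is unspecified for singular \<open>A\<close>.\<close>

abbreviation minv :: "'a :: field mat \<Rightarrow> 'a mat" where
  "minv A \<equiv> the (mat_inverse A)"

abbreviation cmat :: "real mat \<Rightarrow> complex mat" where
  "cmat \<equiv> map_mat complex_of_real"

abbreviation cvec :: "real vec \<Rightarrow> complex vec" where
  "cvec \<equiv> map_vec complex_of_real"

abbreviation vsum :: "nat \<Rightarrow> (nat \<Rightarrow> complex vec) \<Rightarrow> nat set \<Rightarrow> complex vec" where
  "vsum \<equiv> finsum_vec TYPE(complex)"

definition is_group_inverse :: "'a :: comm_ring_1 mat \<Rightarrow> 'a mat \<Rightarrow> bool" where
  "is_group_inverse H X \<longleftrightarrow>
     X \<in> carrier_mat (dim_row H) (dim_col H) \<and>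
     H * X = X * H \<and> H * X * H = H \<and> X * H * X = X"

definition group_inverse :: "'a :: comm_ring_1 mat \<Rightarrow> 'a mat" where
  "group_inverse H = (THE X. is_group_inverse H X)"

definition W_term :: "real mat \<Rightarrow> real mat \<Rightarrow> real mat \<Rightarrow> nat \<Rightarrow> real mat" where
  "W_term G U R j = G ^\<^sub>m j * minv (U - 1\<^sub>m (dim_row U)) * R ^\<^sub>m j"

end

theory Submission
  imports Defs
begin

text \<open>
  Above level \<open>0\<close> the Poisson equation is the second-order difference equation
  \<open>u\<^sub>r - A\<^sub>-\<^sub>1 u\<^sub>r\<^sub>-\<^sub>1 - A\<^sub>0 u\<^sub>r - A\<^sub>1 u\<^sub>r\<^sub>+\<^sub>1 = g\<^sub>r\<close>. Its symbol factors through \<open>G\<close>, \<open>U\<close> and \<open>R\<close>, so the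
  vectors \<open>s\<^sub>r = (U - I)(u\<^sub>r - G u\<^sub>r\<^sub>-\<^sub>1)\<close> satisfy the backward recurrence \<open>s\<^sub>r = R s\<^sub>r\<^sub>+\<^sub>1 - g\<^sub>r\<close>. The
  matrix \<open>W\<close> plays two roles. It conjugates \<open>R\<close> into \<open>Gh\<close>, in the sense that \<open>Gh W = W R\<close>, and the
  Jordan form of \<open>Gh\<close> then tells which part of the backward recurrence can be inverted (the block
  \<open>V\<^sub>1\<close>, with one free vector \<open>y\<close>) and which part has a unique solution that looks ahead finitely
  many levels (the nilpotent block \<open>V\<^sub>0\<close>). It also solves \<open>W = (U - I)\<^sup>-\<^sup>1 + G W R\<close>, which decouples
  \<open>u\<close> from \<open>s\<close>: with \<open>e\<^sub>r = W R s\<^sub>r\<^sub>+\<^sub>1\<close>, the difference \<open>u - e\<close> satisfies a forward recurrence driven by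
  \<open>G\<close>, with one free vector \<open>x\<close>. This is \<open>interior_iff\<close>. The equation at level \<open>0\<close> becomes
  \<open>(I - P\<^sub>*) x = rhs y\<close> (\<open>boundary_iff\<close>).

  The probabilistic input is what makes \<open>W\<close> converge, conjugate and be invertible. The entries of
  \<open>-W\<close> are expected numbers of visits of the walk on all integer levels, and both \<open>green * R\<close> and
  \<open>Gh * green\<close> describe visits to the next higher level. Their difference satisfies a homogeneous
  equation, and the point is to show that it vanishes. If the chain is not recurrent, then \<open>G\<close>
  loses mass: otherwise the probability of hitting a given state, which is superharmonic, would
  attain its minimum on level \<open>0\<close> and be constant. When \<open>G\<close> loses mass, the phase process has
  positive drift, so the reversed walk has negative drift and \<open>Gh\<close> is stochastic, and a bounded
  harmonic sequence of the reversed walk that starts in \<open>0\<close> is zero. If the chain is positive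
  recurrent, then \<open>\<pi>\<^sub>i = \<pi>\<^sub>0 R\<^sup>i\<close> with \<open>\<pi>\<^sub>0 > 0\<close>, so the powers of \<open>R\<close> tend to \<open>0\<close>; the difference is
  reproduced by multiplication with powers of \<open>R\<close> on one side and bounded powers on the other.

  Once \<open>(I - P\<^sub>*) x = rhs y\<close> is reached, maximum principles finish the proof. In the transient case
  the powers of \<open>G\<close> tend to \<open>0\<close>, so a vector fixed by \<open>P\<^sub>*\<close> would extend to a harmonic function that
  vanishes at infinity, and \<open>I - P\<^sub>*\<close> is invertible. In the positive recurrent case the kernel
  of \<open>I - P\<^sub>*\<close> is spanned by \<open>1\<close> and its left kernel by \<open>\<pi>\<^sub>0\<close>; the solvability condition
  \<open>\<pi>\<^sub>0 rhs y = 0\<close> is computed from \<open>\<pi>\<^sub>0 ((B - I) Gh + A\<^sub>1) = - \<pi>\<^sub>0 W\<^sup>-\<^sup>1 Gh\<close> and turns into the condition on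
  \<open>y - y\<^sup>*\<close>.
\<close>

section \<open>Entries of products\<close>

lemma eq_mat_entriesI:
  assumes "A \<in> carrier_mat k l" "B \<in> carrier_mat k l"
    and "\<And>a b. a < k \<Longrightarrow> b < l \<Longrightarrow> A $$ (a, b) = B $$ (a, b)"
  shows "A = B"
  using assms by (intro eq_matI) auto

lemma eq_vec_entriesI:
  assumes "v \<in> carrier_vec k" "w \<in> carrier_vec k" and "\<And>a. a < k \<Longrightarrow> v $ a = w $ a"
  shows "v = w"
  using assms by (intro eq_vecI) auto

lemma mult_mat_entry:
  assumes "A \<in> carrier_mat k l" "B \<in> carrier_mat l q" "a < k" "b < q"
  shows "(A * B) $$ (a, b) = (\<Sum>i<l. A $$ (a, i) * B $$ (i, b))"
  using assms by (simp add: scalar_prod_def atLeast0LessThan)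

lemma mult_mat_vec_entry:
  assumes "A \<in> carrier_mat k l" "v \<in> carrier_vec l" "a < k"
  shows "(A *\<^sub>v v) $ a = (\<Sum>i<l. A $$ (a, i) * v $ i)"
  using assms by (simp add: scalar_prod_def atLeast0LessThan)

lemma scalar_prod_entries:
  assumes "w \<in> carrier_vec k"
  shows "v \<bullet> w = (\<Sum>i<k. v $ i * w $ i)"
  using assms by (simp add: scalar_prod_def atLeast0LessThan)

lemma square_mult_carrier [simp]:
  "A \<in> carrier_mat k k \<Longrightarrow> B \<in> carrier_mat k k \<Longrightarrow> A * B \<in> carrier_mat k k"
  by auto

declare minus_carrier_mat [simp]

lemma mult_mat_vec_in_carrier [simp]: "dim_row A = k \<Longrightarrow> A *\<^sub>v v \<in> carrier_vec k"
  by (rule carrier_vecI) simp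

lemma zero_mult_mat_vec [simp]:
  "v \<in> carrier_vec l \<Longrightarrow> 0\<^sub>m k l *\<^sub>v v = (0\<^sub>v k :: 'a :: semiring_0 vec)"
  by (intro eq_vec_entriesI[of _ k]) (auto simp: scalar_prod_def)

lemma smult_zero_vecs [simp]:
  "c \<cdot>\<^sub>v 0\<^sub>v k = (0\<^sub>v k :: 'a :: semiring_0 vec)"
  "dim_vec v = k \<Longrightarrow> 0 \<cdot>\<^sub>v v = (0\<^sub>v k :: 'a :: semiring_0 vec)"
  by auto

section \<open>Inverses of matrices\<close>

lemma minv_inverse:
  fixes A :: "'a :: field mat"
  assumes A: "A \<in> carrier_mat k k" and inv: "invertible_mat A"
  shows "minv A \<in> carrier_mat k k" "A * minv A = 1\<^sub>m k" "minv A * A = 1\<^sub>m k"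
proof -
  obtain B where B: "A * B = 1\<^sub>m (dim_row A)" "B * A = 1\<^sub>m (dim_row B)"
    using inv unfolding invertible_mat_def inverts_mat_def by auto
  have "dim_col (A * B) = k" using A B(1) by simp
  then have cB: "dim_col B = k" by simp
  have "dim_col (B * A) = dim_row B" using B(2) by simp
  then have "dim_row B = k" using A by simp
  with cB have "B \<in> carrier_mat k k" by blast
  then have "A \<in> Units (ring_mat TYPE('a) k ())"
    using A B unfolding Units_def by (auto simp: ring_mat_def intro!: bexI[of _ B])
  then obtain C where "mat_inverse A = Some C"
    using mat_inverse(1)[OF A, of "()"] by (cases "mat_inverse A") auto
  with mat_inverse(2)[OF A this]
  show "minv A \<in> carrier_mat k k" "A * minv A = 1\<^sub>m k" "minv A * A = 1\<^sub>m k" by auto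
qed

lemma left_inverse_invertible:
  fixes A :: "'a :: field mat"
  assumes A: "A \<in> carrier_mat k k" and B: "B \<in> carrier_mat k k" and BA: "B * A = 1\<^sub>m k"
  shows "invertible_mat A" "minv A = B"
proof -
  have AB: "A * B = 1\<^sub>m k" by (rule mat_mult_left_right_inverse[OF B A BA])
  show inv: "invertible_mat A"
    using A B AB BA unfolding invertible_mat_def inverts_mat_def
    by (auto intro!: exI[of _ B])
  note m = minv_inverse[OF A inv]
  have "minv A = (B * A) * minv A" using BA m(1) by simp
  also have "\<dots> = B * (A * minv A)" using A B m(1) by simp
  finally show "minv A = B" using B m(2) by simp
qed

lemma invertible_if_injective:
  fixes A :: "'a :: field mat"
  assumes A: "A \<in> carrier_mat k k"
    and inj: "\<And>v. v \<in> carrier_vec k \<Longrightarrow> A *\<^sub>v v = 0\<^sub>v k \<Longrightarrow> v = 0\<^sub>v k"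
  shows "invertible_mat A"
proof -
  have "det A \<noteq> 0" using det_0_iff_vec_prod_zero_field[OF A] inj by blast
  from det_non_zero_imp_unit[OF A this, of "()"]
  obtain B where "B \<in> carrier_mat k k" "B * A = 1\<^sub>m k"
    unfolding Units_def by (auto simp: ring_mat_def)
  then show ?thesis using left_inverse_invertible(1)[OF A] by blast
qed

section \<open>Entrywise limits of matrices\<close>

definition mat_limit :: "nat \<Rightarrow> (nat \<Rightarrow> real mat) \<Rightarrow> real mat \<Rightarrow> bool" where
  "mat_limit k X L \<longleftrightarrow> (\<forall>a<k. \<forall>b<k. (\<lambda>i. X i $$ (a, b)) \<longlonglongrightarrow> L $$ (a, b))"

lemma mat_limit_const: "mat_limit k (\<lambda>_. A) A"
  by (simp add: mat_limit_def)

lemma mat_limit_mult: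
  assumes "mat_limit k X L" "mat_limit k Y H"
    and "\<And>i. X i \<in> carrier_mat k k" "L \<in> carrier_mat k k"
    and "\<And>i. Y i \<in> carrier_mat k k" "H \<in> carrier_mat k k"
  shows "mat_limit k (\<lambda>i. X i * Y i) (L * H)"
  unfolding mat_limit_def
proof (intro allI impI)
  fix a b assume ab: "a < k" "b < k"
  have "(\<lambda>i. \<Sum>j<k. X i $$ (a, j) * Y i $$ (j, b)) \<longlonglongrightarrow> (\<Sum>j<k. L $$ (a, j) * H $$ (j, b))"
    using assms(1,2) ab unfolding mat_limit_def by (intro tendsto_sum tendsto_mult) auto
  then show "(\<lambda>i. (X i * Y i) $$ (a, b)) \<longlonglongrightarrow> (L * H) $$ (a, b)"
    using assms(3-) ab by (simp add: mult_mat_entry[of _ k k _ k] del: index_mult_mat)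
qed

lemma mat_limit_add:
  assumes "mat_limit k X L" "mat_limit k Y H"
    and "\<And>i. Y i \<in> carrier_mat k k" "H \<in> carrier_mat k k"
  shows "mat_limit k (\<lambda>i. X i + Y i) (L + H)"
  unfolding mat_limit_def
proof (intro allI impI)
  fix a b assume ab: "a < k" "b < k"
  have "(\<lambda>i. X i $$ (a, b) + Y i $$ (a, b)) \<longlonglongrightarrow> L $$ (a, b) + H $$ (a, b)"
    using assms(1,2) ab unfolding mat_limit_def by (intro tendsto_add) auto
  moreover have "(X i + Y i) $$ (a, b) = X i $$ (a, b) + Y i $$ (a, b)" for i
    using ab assms(3)[of i] by auto
  ultimately show "(\<lambda>i. (X i + Y i) $$ (a, b)) \<longlonglongrightarrow> (L + H) $$ (a, b)"
    using ab assms(4) by simp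
qed

lemma mat_limit_unique:
  assumes "mat_limit k X L" "mat_limit k X H" "L \<in> carrier_mat k k" "H \<in> carrier_mat k k"
  shows "L = H"
  using assms(3,4)
proof (rule eq_mat_entriesI)
  fix a b assume "a < k" "b < k"
  then show "L $$ (a, b) = H $$ (a, b)"
    using assms(1,2) unfolding mat_limit_def by (blast intro: LIMSEQ_unique)
qed

lemma mat_limit_Suc: "mat_limit k X L \<Longrightarrow> mat_limit k (\<lambda>i. X (Suc i)) L"
  unfolding mat_limit_def by (auto intro: LIMSEQ_Suc)

lemma mult_mat_vec_limit:
  assumes "mat_limit k X L" "\<And>i. X i \<in> carrier_mat k k" "L \<in> carrier_mat k k"
    and "v \<in> carrier_vec k" "a < k"
  shows "(\<lambda>i. (X i *\<^sub>v v) $ a) \<longlonglongrightarrow> (L *\<^sub>v v) $ a"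
proof -
  have "(\<lambda>i. \<Sum>j<k. X i $$ (a, j) * v $ j) \<longlonglongrightarrow> (\<Sum>j<k. L $$ (a, j) * v $ j)"
    using assms unfolding mat_limit_def by (intro tendsto_sum tendsto_mult) auto
  then show ?thesis
    using assms by (simp add: mult_mat_vec_entry[of _ k k] del: index_mult_mat_vec)
qed

lemma const_mult_mat_vec_limit:
  assumes "A \<in> carrier_mat k k" "\<And>i. v i \<in> carrier_vec k" "w \<in> carrier_vec k"
    and "\<And>a. a < k \<Longrightarrow> (\<lambda>i. v i $ a) \<longlonglongrightarrow> w $ a" "a < k"
  shows "(\<lambda>i. (A *\<^sub>v v i) $ a) \<longlonglongrightarrow> ((A *\<^sub>v w) $ a :: real)"
proof -
  have "(\<lambda>i. \<Sum>j<k. A $$ (a, j) * v i $ j) \<longlonglongrightarrow> (\<Sum>j<k. A $$ (a, j) * w $ j)"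
    using assms by (intro tendsto_sum tendsto_mult) auto
  then show ?thesis
    using assms by (simp add: mult_mat_vec_entry[of _ k k] del: index_mult_mat_vec)
qed

section \<open>Nonnegative and substochastic matrices\<close>

definition nonneg_square :: "nat \<Rightarrow> real mat \<Rightarrow> bool" where
  "nonneg_square k A \<longleftrightarrow> A \<in> carrier_mat k k \<and> (\<forall>a<k. \<forall>b<k. 0 \<le> A $$ (a, b))"

lemma nonneg_squareD: "nonneg_square k A \<Longrightarrow> A \<in> carrier_mat k k"
  by (simp add: nonneg_square_def)

lemma nonneg_square_iff_le:
  "A \<in> carrier_mat k k \<Longrightarrow> nonneg_square k A \<longleftrightarrow> 0\<^sub>m k k \<le> A"
  by (auto simp: nonneg_square_def less_eq_mat_def)

lemma nonneg_square_mult: "nonneg_square k A \<Longrightarrow> nonneg_square k B \<Longrightarrow> nonneg_square k (A * B)"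
  by (auto simp: nonneg_square_def mult_mat_entry[of _ k k _ k] simp del: index_mult_mat(1)
      intro!: sum_nonneg)

lemma nonneg_square_add: "nonneg_square k A \<Longrightarrow> nonneg_square k B \<Longrightarrow> nonneg_square k (A + B)"
  by (auto simp: nonneg_square_def)

lemma nonneg_square_one: "nonneg_square k (1\<^sub>m k)"
  by (auto simp: nonneg_square_def)

lemma nonneg_square_pow: "nonneg_square k A \<Longrightarrow> nonneg_square k (A ^\<^sub>m j)"
proof (induction j)
  case 0
  then have "dim_row A = k" using nonneg_squareD by blast
  then show ?case using nonneg_square_one[of k] by simp
qed (simp add: nonneg_square_mult)

lemma nonneg_square_limit:
  assumes "mat_limit k X L" "\<And>i. nonneg_square k (X i)" "L \<in> carrier_mat k k"
  shows "nonneg_square k L"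
  unfolding nonneg_square_def
proof (intro conjI allI impI)
  fix a b assume "a < k" "b < k"
  then have "(\<lambda>i. X i $$ (a, b)) \<longlonglongrightarrow> L $$ (a, b)" "\<And>i. 0 \<le> X i $$ (a, b)"
    using assms(1,2) unfolding nonneg_square_def mat_limit_def by auto
  then show "0 \<le> L $$ (a, b)" by (intro LIMSEQ_le_const) auto
qed (rule assms(3))

lemma mult_mat_vec_mono:
  assumes "nonneg_square k A" "v \<in> carrier_vec k" "w \<in> carrier_vec k"
    and "\<And>b. b < k \<Longrightarrow> v $ b \<le> w $ b" "a < k"
  shows "(A *\<^sub>v v) $ a \<le> (A *\<^sub>v w) $ a"
  using assms
  by (auto simp: nonneg_square_def mult_mat_vec_entry[of _ k k] simp del: index_mult_mat_vec
      intro!: sum_mono mult_left_mono)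

lemma mult_mat_vec_nonneg:
  assumes "nonneg_square k A" "v \<in> carrier_vec k" "\<And>b. b < k \<Longrightarrow> 0 \<le> v $ b" "a < k"
  shows "0 \<le> (A *\<^sub>v v) $ a"
  using assms
  by (auto simp: nonneg_square_def mult_mat_vec_entry[of _ k k] simp del: index_mult_mat_vec
      intro!: sum_nonneg)

lemma mult_mat_mono:
  assumes "nonneg_square k A" "nonneg_square k B" "nonneg_square k A'" "nonneg_square k B'"
    and "A \<le> A'" "B \<le> B'"
  shows "A * B \<le> A' * B'"
proof -
  have c: "A \<in> carrier_mat k k" "B \<in> carrier_mat k k" "A' \<in> carrier_mat k k" "B' \<in> carrier_mat k k"
    using assms nonneg_squareD by blast+
  have "(A * B) $$ (a, b) \<le> (A' * B') $$ (a, b)" if "a < k" "b < k" for a b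
    unfolding mult_mat_entry[OF c(1,2) that] mult_mat_entry[OF c(3,4) that]
    using assms that c by (intro sum_mono mult_mono) (auto simp: nonneg_square_def less_eq_mat_def)
  then show ?thesis using c by (auto simp: less_eq_mat_def simp del: index_mult_mat(1))
qed

lemma add_mat_mono:
  assumes "A \<in> carrier_mat k k" "B \<in> carrier_mat k k" "A' \<in> carrier_mat k k" "B' \<in> carrier_mat k k"
    and "A \<le> A'" "B \<le> B'"
  shows "A + B \<le> A' + (B' :: real mat)"
  using assms by (auto simp: less_eq_mat_def intro!: add_mono)

abbreviation (input) ones :: "nat \<Rightarrow> 'a :: one vec" where
  "ones k \<equiv> vec k (\<lambda>_. 1)"

abbreviation substochastic :: "nat \<Rightarrow> real mat \<Rightarrow> bool" where
  "substochastic k A \<equiv> nonneg_square k A \<and> (\<forall>a<k. (A *\<^sub>v ones k) $ a \<le> 1)"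

lemma pow_mat_Suc_left:
  "A \<in> carrier_mat k k \<Longrightarrow> A ^\<^sub>m Suc j = A * A ^\<^sub>m j"
proof (induction j)
  case (Suc j)
  have "A ^\<^sub>m Suc (Suc j) = A ^\<^sub>m Suc j * A" by simp
  also have "\<dots> = (A * A ^\<^sub>m j) * A" using Suc by (simp del: pow_mat.simps)
  also have "\<dots> = A * (A ^\<^sub>m j * A)" using Suc.prems by (intro assoc_mult_mat[of _ k k _ k _ k]) auto
  finally show ?case by simp
qed auto

text \<open>Since \<open>A 1 \<le> 1\<close>, the vectors \<open>A\<^sup>j 1\<close> decrease. Their limit is the mass that \<open>A\<close> never loses: either
  it vanishes, and then so do the powers of \<open>A\<close> in the limit, or it is a nonzero vector fixed by \<open>A\<close>.\<close>

lemma substochastic_pow_ones_limit: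
  assumes "substochastic k A"
  obtains v where "v \<in> carrier_vec k" "A *\<^sub>v v = v"
    "\<And>a. a < k \<Longrightarrow> 0 \<le> v $ a \<and> v $ a \<le> 1"
    "\<And>a. a < k \<Longrightarrow> (\<lambda>j. (A ^\<^sub>m j *\<^sub>v ones k) $ a) \<longlonglongrightarrow> v $ a"
proof -
  define x where "x j = A ^\<^sub>m j *\<^sub>v ones k" for j
  have A: "A \<in> carrier_mat k k" and nn: "nonneg_square k A" using assms nonneg_squareD by auto
  have xc: "x j \<in> carrier_vec k" for j unfolding x_def using A by auto
  have xS: "x (Suc j) = A *\<^sub>v x j" for j
    unfolding x_def pow_mat_Suc_left[OF A]
    using A by (intro assoc_mult_mat_vec[of _ k k _ k]) auto
  have x0: "x 0 = ones k" unfolding x_def using A by simp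
  have nonneg: "0 \<le> x j $ a" if "a < k" for j a
    using that unfolding x_def by (intro mult_mat_vec_nonneg[of k] nonneg_square_pow nn) auto
  have dec: "\<forall>a<k. x (Suc j) $ a \<le> x j $ a" for j
  proof (induction j)
    case 0 then show ?case using assms unfolding xS x0 by simp
  next
    case (Suc j)
    then show ?case
      using mult_mat_vec_mono[OF nn xc xc] unfolding xS[symmetric] by blast
  qed
  have decs: "decseq (\<lambda>j. x j $ a)" if "a < k" for a
    using dec that by (intro decseq_SucI) auto
  have ex: "\<exists>l. (\<lambda>j. x j $ a) \<longlonglongrightarrow> l" if a: "a < k" for a
    using decseq_convergent[OF decs[OF a], of 0] nonneg[OF a] by blast
  define v where "v = vec k (\<lambda>a. lim (\<lambda>j. x j $ a))"
  have lim: "(\<lambda>j. x j $ a) \<longlonglongrightarrow> v $ a" if "a < k" for a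
    using ex[OF that] that unfolding v_def by (simp add: convergent_LIMSEQ_iff[symmetric] convergent_def)
  have vc: "v \<in> carrier_vec k" unfolding v_def by simp
  have "(\<lambda>j. x (Suc j) $ a) \<longlonglongrightarrow> (A *\<^sub>v v) $ a" if "a < k" for a
    unfolding xS by (rule const_mult_mat_vec_limit[OF A xc vc lim that])
  then have "(A *\<^sub>v v) $ a = v $ a" if "a < k" for a
    using that LIMSEQ_Suc[OF lim[OF that]] LIMSEQ_unique by blast
  then have "A *\<^sub>v v = v" using vc A by (intro eq_vec_entriesI[of _ k]) auto
  moreover have "0 \<le> v $ a \<and> v $ a \<le> 1" if a: "a < k" for a
  proof
    show "0 \<le> v $ a" using LIMSEQ_le_const[OF lim[OF a]] nonneg[OF a] by blast
    show "v $ a \<le> 1" using decseq_ge[OF decs[OF a] lim[OF a], of 0] a x0 by simp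
  qed
  ultimately show ?thesis using that[of v] vc lim unfolding x_def by blast
qed

lemma pow_limit_zero_if_ones:
  assumes nn: "nonneg_square k A"
    and lim: "\<And>a. a < k \<Longrightarrow> (\<lambda>j. (A ^\<^sub>m j *\<^sub>v ones k) $ a) \<longlonglongrightarrow> 0"
  shows "mat_limit k (\<lambda>j. A ^\<^sub>m j) (0\<^sub>m k k)"
  unfolding mat_limit_def
proof (intro allI impI)
  fix a b assume ab: "a < k" "b < k"
  have nnj: "nonneg_square k (A ^\<^sub>m j)" for j by (rule nonneg_square_pow[OF nn])
  have le: "(A ^\<^sub>m j) $$ (a, b) \<le> (A ^\<^sub>m j *\<^sub>v ones k) $ a" for j
  proof -
    have "(A ^\<^sub>m j) $$ (a, b) \<le> (\<Sum>i<k. (A ^\<^sub>m j) $$ (a, i))"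
      using ab nnj[of j] unfolding nonneg_square_def by (intro member_le_sum) auto
    also have "\<dots> = (A ^\<^sub>m j *\<^sub>v ones k) $ a"
      using ab nonneg_squareD[OF nnj] by (subst mult_mat_vec_entry[of _ k k]) auto
    finally show ?thesis .
  qed
  have "(\<lambda>j. (A ^\<^sub>m j) $$ (a, b)) \<longlonglongrightarrow> 0"
    by (rule tendsto_sandwich[OF _ _ tendsto_const lim[OF ab(1)]])
      (use nnj ab le in \<open>auto simp: nonneg_square_def\<close>)
  then show "(\<lambda>j. (A ^\<^sub>m j) $$ (a, b)) \<longlonglongrightarrow> 0\<^sub>m k k $$ (a, b)" using ab by simp
qed

lemma pow_fixed_vec:
  fixes v :: "'a :: comm_ring_1 vec"
  assumes "A \<in> carrier_mat k k" "v \<in> carrier_vec k" "A *\<^sub>v v = v"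
  shows "A ^\<^sub>m j *\<^sub>v v = v"
  using assms by (induction j) (auto simp: assoc_mult_mat_vec[of _ k k _ k])

lemma pow_limit_zero_no_fixed_vec:
  assumes A: "A \<in> carrier_mat k k" and lim: "mat_limit k (\<lambda>j. A ^\<^sub>m j) (0\<^sub>m k k)"
    and v: "v \<in> carrier_vec k" "A *\<^sub>v v = v"
  shows "v = 0\<^sub>v k"
proof (rule eq_vec_entriesI[of _ k])
  fix a assume a: "a < k"
  have "(\<lambda>j. (A ^\<^sub>m j *\<^sub>v v) $ a) \<longlonglongrightarrow> (0\<^sub>m k k *\<^sub>v v) $ a"
    using A v a by (intro mult_mat_vec_limit[OF lim]) auto
  then show "v $ a = 0\<^sub>v k $ a"
    using a v pow_fixed_vec[OF A v] by (simp add: LIMSEQ_const_iff)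
qed (use v in auto)

lemma one_minus_invertible_if_no_fixed_vec:
  fixes A :: "'a :: field mat"
  assumes A: "A \<in> carrier_mat k k"
    and "\<And>v. v \<in> carrier_vec k \<Longrightarrow> A *\<^sub>v v = v \<Longrightarrow> v = 0\<^sub>v k"
  shows "invertible_mat (1\<^sub>m k - A)"
proof (rule invertible_if_injective[of _ k])
  show "1\<^sub>m k - A \<in> carrier_mat k k" using A by auto
  fix v :: "'a vec" assume v: "v \<in> carrier_vec k" and 0: "(1\<^sub>m k - A) *\<^sub>v v = 0\<^sub>v k"
  then have eq: "v - A *\<^sub>v v = 0\<^sub>v k"
    using A by (simp add: minus_mult_distrib_mat_vec[of _ k k])
  have "(A *\<^sub>v v) $ a = v $ a" if "a < k" for a
    using arg_cong[OF eq, of "\<lambda>w. w $ a"] that v A by (simp del: index_mult_mat_vec)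
  then have "A *\<^sub>v v = v" using v A by (intro eq_vec_entriesI[of _ k]) auto
  then show "v = 0\<^sub>v k" using assms(2) v by blast
qed

fun geo_sum :: "nat \<Rightarrow> 'a :: comm_ring_1 mat \<Rightarrow> nat \<Rightarrow> 'a mat" where
  "geo_sum k A 0 = 0\<^sub>m k k"
| "geo_sum k A (Suc j) = geo_sum k A j + A ^\<^sub>m j"

lemma geo_sum_carrier [simp]: "A \<in> carrier_mat k k \<Longrightarrow> geo_sum k A j \<in> carrier_mat k k"
  by (induction j) auto

lemma geo_sum_entry:
  "A \<in> carrier_mat k k \<Longrightarrow> a < k \<Longrightarrow> b < k \<Longrightarrow> geo_sum k A j $$ (a, b) = (\<Sum>i<j. (A ^\<^sub>m i) $$ (a, b))"
  by (induction j) (auto simp: add.commute)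

lemma geo_sum_mult:
  fixes A :: "'a :: comm_ring_1 mat"
  assumes A: "A \<in> carrier_mat k k"
  shows "geo_sum k A j * (1\<^sub>m k - A) = 1\<^sub>m k - A ^\<^sub>m j"
proof (induction j)
  case (Suc j)
  have "geo_sum k A (Suc j) * (1\<^sub>m k - A) = geo_sum k A j * (1\<^sub>m k - A) + A ^\<^sub>m j * (1\<^sub>m k - A)"
    using A by (simp add: add_mult_distrib_mat[of _ k k _ _ k])
  also have "A ^\<^sub>m j * (1\<^sub>m k - A) = A ^\<^sub>m j - A ^\<^sub>m Suc j"
    using A by (simp add: mult_minus_distrib_mat[of _ k k _ k])
  finally show ?case using A unfolding Suc
    by (intro eq_mat_entriesI[of _ k k]) (auto simp del: index_mult_mat(1))
qed (use A in auto)

text \<open>A vector fixed by \<open>A\<close> is fixed by all powers, which tend to \<open>0\<close>, so \<open>I - A\<close> is injective. The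
  partial sums of the Neumann series telescope against \<open>I - A\<close>; this gives their limit and with it
  the sign of the inverse.\<close>

lemma neumann_series:
  assumes nn: "nonneg_square k A" and lim: "mat_limit k (\<lambda>j. A ^\<^sub>m j) (0\<^sub>m k k)"
  shows "invertible_mat (1\<^sub>m k - A)"
    and "mat_limit k (geo_sum k A) (minv (1\<^sub>m k - A))"
    and "nonneg_square k (minv (1\<^sub>m k - A))"
proof -
  have A: "A \<in> carrier_mat k k" using nn nonneg_squareD by blast
  then have IA: "1\<^sub>m k - A \<in> carrier_mat k k" by auto
  show inv: "invertible_mat (1\<^sub>m k - A)"
    using one_minus_invertible_if_no_fixed_vec[OF A] pow_limit_zero_no_fixed_vec[OF A lim] by blast
  note m = minv_inverse[OF IA inv]
  have eq: "geo_sum k A j = (1\<^sub>m k - A ^\<^sub>m j) * minv (1\<^sub>m k - A)" for j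
  proof -
    have "geo_sum k A j = geo_sum k A j * ((1\<^sub>m k - A) * minv (1\<^sub>m k - A))"
      using m right_mult_one_mat[OF geo_sum_carrier[OF A]] by simp
    also have "\<dots> = geo_sum k A j * (1\<^sub>m k - A) * minv (1\<^sub>m k - A)"
      using m A IA by (intro assoc_mult_mat[symmetric, of _ k k _ k _ k]) auto
    finally show ?thesis by (simp add: geo_sum_mult[OF A])
  qed
  have "mat_limit k (\<lambda>j. 1\<^sub>m k - A ^\<^sub>m j) (1\<^sub>m k)"
    using lim A unfolding mat_limit_def by (auto intro!: tendsto_eq_intros)
  then have "mat_limit k (\<lambda>j. (1\<^sub>m k - A ^\<^sub>m j) * minv (1\<^sub>m k - A)) (1\<^sub>m k * minv (1\<^sub>m k - A))"
    using m A by (intro mat_limit_mult mat_limit_const) auto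
  then show l: "mat_limit k (geo_sum k A) (minv (1\<^sub>m k - A))"
    using m eq by (simp add: mat_limit_def del: index_mult_mat)
  have "nonneg_square k (geo_sum k A j)" for j
  proof (induction j)
    case (Suc j) then show ?case by (auto intro!: nonneg_square_add nonneg_square_pow nn)
  qed (auto simp: nonneg_square_def)
  then show "nonneg_square k (minv (1\<^sub>m k - A))"
    using nonneg_square_limit[OF l] m by blast
qed

section \<open>Walks on levels and the minimal solution \<open>G\<close>\<close>

text \<open>A maximal value that is at most the average of the values at the neighbours is shared by every
  neighbour that carries weight, and so it propagates along paths.\<close>

lemma maximum_principle:
  fixes K :: "'s \<Rightarrow> 's \<Rightarrow> real"
  assumes nbhd: "\<And>s. s \<in> S \<Longrightarrow> finite (T s) \<and> T s \<subseteq> S \<and> (\<forall>t\<in>S - T s. K s t = 0)"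
    and K: "\<And>s t. s \<in> S \<Longrightarrow> t \<in> T s \<Longrightarrow> 0 \<le> K s t" "\<And>s. s \<in> S \<Longrightarrow> (\<Sum>t\<in>T s. K s t) = 1"
    and sub: "\<And>s. s \<in> S \<Longrightarrow> f s \<le> (\<Sum>t\<in>T s. K s t * f t)"
    and bound: "\<And>s. s \<in> S \<Longrightarrow> f s \<le> c"
    and reach: "reachable_on S K s t" and s: "f s = c"
  shows "f t = c"
  using reach unfolding reachable_on_def
proof (induction rule: rtrancl_induct)
  case (step y z)
  then have y: "y \<in> S" and z: "z \<in> S" and pos: "0 < K y z" and fy: "f y = c" by auto
  have zT: "z \<in> T y" using nbhd[OF y] z pos by force
  have nonneg: "0 \<le> K y t * (c - f t)" if "t \<in> T y" for t
    using that nbhd[OF y] K(1)[OF y] bound by (auto intro!: mult_nonneg_nonneg)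
  have "(\<Sum>t\<in>T y. K y t * (c - f t)) = (\<Sum>t\<in>T y. K y t) * c - (\<Sum>t\<in>T y. K y t * f t)"
    by (simp add: right_diff_distrib sum_subtractf sum_distrib_right)
  also have "\<dots> \<le> 0" using K(2)[OF y] sub[OF y] fy by simp
  finally have "(\<Sum>t\<in>T y. K y t * (c - f t)) \<le> 0" .
  moreover have "K y z * (c - f z) \<le> (\<Sum>t\<in>T y. K y t * (c - f t))"
    using nbhd[OF y] zT nonneg by (intro member_le_sum) auto
  ultimately have "K y z * (c - f z) \<le> 0" by simp
  then have "c - f z \<le> 0" using pos by (simp add: mult_le_0_iff)
  then show ?case using bound[OF z] by simp
qed (rule s)

text \<open>\<open>D\<close>, \<open>Z\<close> and \<open>T\<close> are the blocks for a step down, within a level and up. Irreducibility of the phase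
  process \<open>D + Z + T\<close> and the structure of the walk on all integer levels enter only as maximum
  principles. In this form they visibly survive the exchange of \<open>D\<close> and \<open>T\<close>, so the locale also
  covers the walk with reversed levels.\<close>

locale level_walk =
  fixes m :: nat and D Z T G :: "real mat"
  assumes m: "1 \<le> m"
    and D: "nonneg_square m D" and Z: "nonneg_square m Z" and T: "nonneg_square m T"
    and total: "\<And>a. a < m \<Longrightarrow> (D *\<^sub>v ones m) $ a + (Z *\<^sub>v ones m) $ a + (T *\<^sub>v ones m) $ a = 1"
    and phase_maximum: "\<And>v c a b. v \<in> carrier_vec m \<Longrightarrow> (\<And>a. a < m \<Longrightarrow> v $ a \<le> c) \<Longrightarrow>
      (\<And>a. a < m \<Longrightarrow> v $ a \<le> (D *\<^sub>v v) $ a + (Z *\<^sub>v v) $ a + (T *\<^sub>v v) $ a) \<Longrightarrow>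
      a < m \<Longrightarrow> v $ a = c \<Longrightarrow> b < m \<Longrightarrow> v $ b = c"
    and two_sided_maximum: "\<And>F c i a. (\<And>i. F i \<in> carrier_vec m) \<Longrightarrow>
      (\<And>i a. a < m \<Longrightarrow> F i $ a \<le> c) \<Longrightarrow>
      (\<And>i a. a < m \<Longrightarrow>
        F i $ a \<le> (D *\<^sub>v F (i - 1)) $ a + (Z *\<^sub>v F i) $ a + (T *\<^sub>v F (i + 1)) $ a) \<Longrightarrow>
      a < m \<Longrightarrow> F (i :: int) $ a = c \<Longrightarrow> \<exists>b<m. \<forall>k. F k $ b = c"
    and G: "minimal_nonneg_solution m (\<lambda>X. D + (Z - 1\<^sub>m m) * X + T * (X * X)) G"
begin

text \<open>The probabilities of being in a given phase at the first return to the current level, without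
  a visit to lower levels before.\<close>

definition U :: "real mat" where "U = Z + T * G"

lemma carriers [simp]:
  "D \<in> carrier_mat m m" "Z \<in> carrier_mat m m" "T \<in> carrier_mat m m" "G \<in> carrier_mat m m"
  "U \<in> carrier_mat m m"
  using D Z T G unfolding U_def minimal_nonneg_solution_def by (auto simp: nonneg_square_def)

lemma dims [simp]:
  "dim_row D = m" "dim_col D = m" "dim_row Z = m" "dim_col Z = m" "dim_row T = m" "dim_col T = m"
  "dim_row G = m" "dim_col G = m" "dim_row U = m" "dim_col U = m"
  using carriers by (auto simp del: carriers)

lemmas ring_simps =
  add_mult_distrib_mat[of _ m m _ _ m] mult_add_distrib_mat[of _ m m _ m]
  minus_mult_distrib_mat[of _ m m _ _ m] mult_minus_distrib_mat[of _ m m _ m]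
  assoc_mult_mat[of _ m m _ m _ m]

lemmas vec_simps =
  add_mult_distrib_mat_vec[of _ m m] mult_add_distrib_mat_vec[of _ m m]
  minus_mult_distrib_mat_vec[of _ m m] mult_minus_distrib_mat_vec[of _ m m]
  assoc_mult_mat_vec[of _ m m _ m]

lemma G_nonneg: "nonneg_square m G"
  using G unfolding minimal_nonneg_solution_def by (simp add: nonneg_square_iff_le)

lemma fixed_point_iff:
  assumes Y: "Y \<in> carrier_mat m m"
  shows "D + (Z - 1\<^sub>m m) * Y + T * (Y * Y) = 0\<^sub>m m m \<longleftrightarrow> D + Z * Y + T * (Y * Y) = Y"
    (is "?l = ?r")
proof
  have eq: "(Z - 1\<^sub>m m) * Y = Z * Y - Y" using Y by (simp add: ring_simps)
  show ?r if l: ?l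
  proof (rule eq_mat_entriesI[of _ m m])
    fix a b assume "a < m" "b < m"
    then show "(D + Z * Y + T * (Y * Y)) $$ (a, b) = Y $$ (a, b)"
      using arg_cong[OF l, of "\<lambda>X. X $$ (a, b)"] Y unfolding eq
      by (simp del: index_mult_mat(1))
  qed (use Y in auto)
  show ?l if r: ?r
  proof (rule eq_mat_entriesI[of _ m m])
    fix a b assume "a < m" "b < m"
    then show "(D + (Z - 1\<^sub>m m) * Y + T * (Y * Y)) $$ (a, b) = 0\<^sub>m m m $$ (a, b)"
      using arg_cong[OF r, of "\<lambda>X. X $$ (a, b)"] Y unfolding eq
      by (simp del: index_mult_mat(1))
  qed (use Y in auto)
qed

lemma G_eq: "D + Z * G + T * (G * G) = G"
  using G fixed_point_iff[of G] unfolding minimal_nonneg_solution_def by simp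

lemma G_minimal:
  assumes Y: "nonneg_square m Y" "D + Z * Y + T * (Y * Y) = Y"
  shows "G \<le> Y"
  using G assms fixed_point_iff[of Y] nonneg_squareD[OF Y(1)]
  unfolding minimal_nonneg_solution_def by (simp add: nonneg_square_iff_le)

fun approx :: "nat \<Rightarrow> real mat" where
  "approx 0 = 0\<^sub>m m m"
| "approx (Suc j) = D + Z * approx j + T * (approx j * approx j)"

lemma approx_nonneg: "nonneg_square m (approx j)"
proof (induction j)
  case 0 then show ?case by (auto simp: nonneg_square_def)
next
  case (Suc j) then show ?case
    by (auto intro!: nonneg_square_add nonneg_square_mult D Z T)
qed

lemma approx_carrier [simp]: "approx j \<in> carrier_mat m m"
  using approx_nonneg nonneg_squareD by blast

lemma approx_dims [simp]: "dim_row (approx j) = m" "dim_col (approx j) = m"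
  using approx_carrier[of j] by (auto simp del: approx_carrier)

lemma step_mono:
  assumes "nonneg_square m X" "nonneg_square m Y" "X \<le> Y"
  shows "D + Z * X + T * (X * X) \<le> D + Z * Y + T * (Y * Y)"
  using assms nonneg_squareD[of m X] nonneg_squareD[of m Y]
  by (intro add_mat_mono[of _ m] mult_mat_mono[of m] nonneg_square_mult Z T) auto

lemma approx_le_G: "approx j \<le> G"
proof (induction j)
  case 0 then show ?case using G_nonneg by (auto simp: nonneg_square_def less_eq_mat_def)
next
  case (Suc j)
  then show ?case using step_mono[OF approx_nonneg G_nonneg Suc] by (simp add: G_eq)
qed

lemma approx_mono: "approx j \<le> approx (Suc j)"
proof (induction j)
  case 0 then show ?case using approx_nonneg[of 1] by (auto simp: nonneg_square_def less_eq_mat_def)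
next
  case (Suc j)
  then show ?case using step_mono[OF approx_nonneg approx_nonneg Suc] by simp
qed

text \<open>The iterates increase and stay below \<open>G\<close>, so they converge to a solution, which is \<open>G\<close> by
  minimality. This is how bounds that are preserved by one step of the iteration reach \<open>G\<close>.\<close>

lemma approx_limit: "mat_limit m approx G"
proof -
  have "\<exists>l. (\<lambda>j. approx j $$ (a, b)) \<longlonglongrightarrow> l" if ab: "a < m" "b < m" for a b
  proof -
    have "approx j $$ (a, b) \<le> approx (Suc j) $$ (a, b)" for j
      using approx_mono[of j] ab by (auto simp: less_eq_mat_def simp del: approx.simps)
    then have "incseq (\<lambda>j. approx j $$ (a, b))" by (intro incseq_SucI)
    moreover have "\<forall>j. approx j $$ (a, b) \<le> G $$ (a, b)"
      using approx_le_G ab by (auto simp: less_eq_mat_def)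
    ultimately obtain l where "(\<lambda>j. approx j $$ (a, b)) \<longlonglongrightarrow> l"
      by (rule incseq_convergent)
    then show ?thesis ..
  qed
  then have lim: "(\<lambda>j. approx j $$ (a, b)) \<longlonglongrightarrow> lim (\<lambda>j. approx j $$ (a, b))"
    if "a < m" "b < m" for a b
    using that by (simp add: convergent_LIMSEQ_iff[symmetric] convergent_def)
  define X where "X = mat m m (\<lambda>(a, b). lim (\<lambda>j. approx j $$ (a, b)))"
  have X: "X \<in> carrier_mat m m" unfolding X_def by simp
  have limX: "mat_limit m approx X"
    using lim unfolding mat_limit_def X_def by simp
  have "mat_limit m (\<lambda>j. approx (Suc j)) (D + Z * X + T * (X * X))"
    unfolding approx.simps using X
    by (intro mat_limit_add mat_limit_mult mat_limit_const limX) auto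
  then have "D + Z * X + T * (X * X) = X"
    by (rule mat_limit_unique[OF _ mat_limit_Suc[OF limX]]) (simp_all add: X)
  moreover have "nonneg_square m X" by (rule nonneg_square_limit[OF limX approx_nonneg X])
  ultimately have "G \<le> X" by (intro G_minimal)
  moreover have "X \<le> G"
  proof -
    have "X $$ (a, b) \<le> G $$ (a, b)" if "a < m" "b < m" for a b
      using limX that approx_le_G unfolding mat_limit_def
      by (intro LIMSEQ_le_const2[of "\<lambda>j. approx j $$ (a, b)"]) (auto simp: less_eq_mat_def)
    then show ?thesis using X by (auto simp: less_eq_mat_def)
  qed
  ultimately have "X = G" by simp
  then show ?thesis using limX by simp
qed

text \<open>A step of the iteration replaces the values of \<open>h\<close> one and two levels up by the lower bounds that
  the previous iterate propagates from the level below.\<close>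

lemma superharmonic_ge_G:
  assumes h: "\<And>r. h r \<in> carrier_vec m" and nonneg: "\<And>r a. a < m \<Longrightarrow> 0 \<le> h r $ a"
    and super: "\<And>r a. a < m \<Longrightarrow>
      (D *\<^sub>v h r) $ a + (Z *\<^sub>v h (Suc r)) $ a + (T *\<^sub>v h (Suc (Suc r))) $ a \<le> h (Suc r) $ a"
    and a: "a < m"
  shows "(G *\<^sub>v h r) $ a \<le> h (Suc r) $ a"
proof -
  have le: "\<forall>a<m. (approx j *\<^sub>v h r) $ a \<le> h (Suc r) $ a" for j r
  proof (induction j arbitrary: r)
    case 0 then show ?case using nonneg h by (auto simp: mult_mat_vec_entry[of _ m m] simp del: index_mult_mat_vec)
  next
    case (Suc j)
    show ?case
    proof (intro allI impI)
      fix a assume a: "a < m"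
      have 1: "(approx j *\<^sub>v h r) $ b \<le> h (Suc r) $ b" if "b < m" for b
        using Suc[of r] that by simp
      have 2: "(approx j *\<^sub>v (approx j *\<^sub>v h r)) $ b \<le> h (Suc (Suc r)) $ b" if "b < m" for b
      proof -
        have "(approx j *\<^sub>v (approx j *\<^sub>v h r)) $ b \<le> (approx j *\<^sub>v h (Suc r)) $ b"
          using 1 that h by (intro mult_mat_vec_mono[OF approx_nonneg]) auto
        also have "\<dots> \<le> h (Suc (Suc r)) $ b" using Suc[of "Suc r"] that by simp
        finally show ?thesis .
      qed
      have "(approx (Suc j) *\<^sub>v h r) $ a = (D *\<^sub>v h r) $ a + (Z *\<^sub>v (approx j *\<^sub>v h r)) $ a
          + (T *\<^sub>v (approx j *\<^sub>v (approx j *\<^sub>v h r))) $ a"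
        using h a by (simp add: vec_simps del: index_mult_mat_vec)
      also have "\<dots> \<le> (D *\<^sub>v h r) $ a + (Z *\<^sub>v h (Suc r)) $ a + (T *\<^sub>v h (Suc (Suc r))) $ a"
        using 1 2 a h by (intro add_mono mult_mat_vec_mono[OF Z] mult_mat_vec_mono[OF T]) auto
      also have "\<dots> \<le> h (Suc r) $ a" by (rule super[OF a])
      finally show "(approx (Suc j) *\<^sub>v h r) $ a \<le> h (Suc r) $ a" .
    qed
  qed
  have "(\<lambda>j. (approx j *\<^sub>v h r) $ a) \<longlonglongrightarrow> (G *\<^sub>v h r) $ a"
    using h a by (intro mult_mat_vec_limit[OF approx_limit]) auto
  then show ?thesis using le a by (intro LIMSEQ_le_const2) auto
qed

lemma superharmonic_ge_G_pow:
  assumes h: "\<And>r. h r \<in> carrier_vec m" and nonneg: "\<And>r a. a < m \<Longrightarrow> 0 \<le> h r $ a"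
    and super: "\<And>r a. a < m \<Longrightarrow>
      (D *\<^sub>v h r) $ a + (Z *\<^sub>v h (Suc r)) $ a + (T *\<^sub>v h (Suc (Suc r))) $ a \<le> h (Suc r) $ a"
    and a: "a < m"
  shows "(G ^\<^sub>m r *\<^sub>v h 0) $ a \<le> h r $ a"
  using a
proof (induction r arbitrary: a)
  case 0 then show ?case using h by (simp del: index_mult_mat_vec)
next
  case (Suc r)
  have "G ^\<^sub>m Suc r *\<^sub>v h 0 = G *\<^sub>v (G ^\<^sub>m r *\<^sub>v h 0)"
    using h by (simp add: pow_mat_Suc_left[of _ m] vec_simps del: pow_mat.simps)
  then have "(G ^\<^sub>m Suc r *\<^sub>v h 0) $ a \<le> (G *\<^sub>v h r) $ a"
    using Suc h by (auto intro!: mult_mat_vec_mono[OF G_nonneg] simp del: index_mult_mat_vec)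
  also have "\<dots> \<le> h (Suc r) $ a" by (rule superharmonic_ge_G[of h]; fact h nonneg super Suc.prems)
  finally show ?case .
qed

lemma G_substochastic: "substochastic m G"
  using G_nonneg superharmonic_ge_G[of "\<lambda>_. ones m"] total by (simp del: index_mult_mat_vec)

lemma U_nonneg: "nonneg_square m U"
  unfolding U_def by (intro nonneg_square_add nonneg_square_mult Z T G_nonneg)

lemma U_mult_vec: "v \<in> carrier_vec m \<Longrightarrow> U *\<^sub>v v = Z *\<^sub>v v + T *\<^sub>v (G *\<^sub>v v)"
  unfolding U_def by (simp add: vec_simps)

lemma TG_ones_le: "a < m \<Longrightarrow> (T *\<^sub>v (G *\<^sub>v ones m)) $ a \<le> (T *\<^sub>v ones m) $ a"
  using G_substochastic by (intro mult_mat_vec_mono[OF T]) (auto simp del: index_mult_mat_vec)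

lemma U_substochastic: "substochastic m U"
proof -
  have "(U *\<^sub>v ones m) $ a \<le> 1" if "a < m" for a
    using that total[OF that] TG_ones_le[OF that] mult_mat_vec_nonneg[OF D, of "ones m" a]
    by (simp add: U_mult_vec del: index_mult_mat_vec)
  then show ?thesis using U_nonneg by blast
qed

lemma G_pow_mult_vec_Suc:
  "v \<in> carrier_vec m \<Longrightarrow> G ^\<^sub>m Suc j *\<^sub>v v = G *\<^sub>v (G ^\<^sub>m j *\<^sub>v v)"
  by (simp add: pow_mat_Suc_left[of _ m] vec_simps del: pow_mat.simps)

lemma G_mult_vec: "v \<in> carrier_vec m \<Longrightarrow> D *\<^sub>v v + Z *\<^sub>v (G *\<^sub>v v) + T *\<^sub>v (G *\<^sub>v (G *\<^sub>v v)) = G *\<^sub>v v"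
  using arg_cong[OF G_eq, of "\<lambda>X. X *\<^sub>v v"] by (simp add: vec_simps)

lemma G_pow_nonneg_le:
  assumes v: "v \<in> carrier_vec m" "\<And>a. a < m \<Longrightarrow> 0 \<le> v $ a \<and> v $ a \<le> c" and c: "0 \<le> c" and a: "a < m"
  shows "0 \<le> (G ^\<^sub>m j *\<^sub>v v) $ a \<and> (G ^\<^sub>m j *\<^sub>v v) $ a \<le> c"
  using a
proof (induction j arbitrary: a)
  case 0 then show ?case using v by (simp del: index_mult_mat_vec)
next
  case (Suc j)
  have "(G *\<^sub>v (G ^\<^sub>m j *\<^sub>v v)) $ a \<le> (G *\<^sub>v (c \<cdot>\<^sub>v ones m)) $ a"
    using Suc v by (intro mult_mat_vec_mono[OF G_nonneg]) (auto simp del: index_mult_mat_vec)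
  also have "\<dots> = c * (G *\<^sub>v ones m) $ a"
    using Suc.prems by (simp add: mult_mat_vec[of _ m m] del: index_mult_mat_vec)
  also have "\<dots> \<le> c * 1" using G_substochastic Suc.prems c by (intro mult_left_mono) auto
  finally show ?case
    using Suc v mult_mat_vec_nonneg[OF G_nonneg, of "G ^\<^sub>m j *\<^sub>v v" a]
    by (simp add: G_pow_mult_vec_Suc del: index_mult_mat_vec pow_mat.simps)
qed

text \<open>Continued upwards by the powers of \<open>G\<close> and downwards by \<open>0\<close>, a nonnegative vector fixed by \<open>U\<close>
  becomes a subharmonic function on all integer levels that attains its maximum. Some phase then
  has this maximum as its value on every level, and the value on the lower levels is \<open>0\<close>.\<close>

lemma U_fixed_vec_zero:
  assumes v: "v \<in> carrier_vec m" "U *\<^sub>v v = v" "\<And>a. a < m \<Longrightarrow> 0 \<le> v $ a"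
  shows "v = 0\<^sub>v m"
proof -
  define c where "c = Max ((\<lambda>a. v $ a) ` {..<m})"
  have le: "v $ a \<le> c" if "a < m" for a using that unfolding c_def by (intro Max_ge) auto
  have "c \<in> (\<lambda>a. v $ a) ` {..<m}" unfolding c_def using m by (intro Max_in) (auto simp: lessThan_empty_iff)
  then obtain a where a: "a < m" "v $ a = c" by auto
  have c0: "0 \<le> c" using v(3) a by force
  define F where "F i = (if i \<ge> 1 then G ^\<^sub>m nat (i - 1) *\<^sub>v v else 0\<^sub>v m)" for i :: int
  have Fc: "F i \<in> carrier_vec m" for i unfolding F_def using v by auto
  have F0: "0 \<le> F i $ a \<and> F i $ a \<le> c" if "a < m" for i a
    unfolding F_def using that G_pow_nonneg_le[OF v(1) _ c0 that] v(3) le c0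
    by (simp del: index_mult_mat_vec)
  have "F i $ a \<le> (D *\<^sub>v F (i - 1)) $ a + (Z *\<^sub>v F i) $ a + (T *\<^sub>v F (i + 1)) $ a"
    if a: "a < m" for i a
  proof -
    consider "i \<le> 0" | "i = 1" | "i \<ge> 2" by linarith
    then show ?thesis
    proof cases
      case 1
      then have "F i $ a = 0" using a unfolding F_def by simp
      then show ?thesis
        using mult_mat_vec_nonneg[OF D Fc _ a, of "i - 1"] mult_mat_vec_nonneg[OF Z Fc _ a, of i]
          mult_mat_vec_nonneg[OF T Fc _ a, of "i + 1"] F0 by simp
    next
      case 2
      have "F 1 = v" "F 2 = G *\<^sub>v v" "F 0 = 0\<^sub>v m"
        unfolding F_def using v by auto
      then show ?thesis
        using 2 a v(1) arg_cong[OF v(2), of "\<lambda>x. x $ a"] mult_mat_vec_nonneg[OF D, of "0\<^sub>v m" a]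
        by (simp add: U_mult_vec del: index_mult_mat_vec)
    next
      case 3
      define j where "j = nat (i - 2)"
      have ij: "nat (i - 1) = Suc j" "nat (i - 2) = j" "nat i = Suc (Suc j)"
        using 3 unfolding j_def by auto
      define x where "x = G ^\<^sub>m j *\<^sub>v v"
      have x: "x \<in> carrier_vec m" unfolding x_def by simp
      have "F (i - 1) = x" "F i = G *\<^sub>v x" "F (i + 1) = G *\<^sub>v (G *\<^sub>v x)"
        using 3 ij v(1) unfolding F_def x_def
        by (simp_all add: G_pow_mult_vec_Suc del: pow_mat.simps)
      then show ?thesis
        using a x arg_cong[OF G_mult_vec[OF x], of "\<lambda>x. x $ a"]
        by (simp del: index_mult_mat_vec)
    qed
  qed
  moreover have "F 1 $ a = c" unfolding F_def using v(1) a by simp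
  ultimately obtain b where "b < m" "\<forall>k. F k $ b = c"
    using two_sided_maximum[of F c a 1] Fc F0 a by auto
  then have "c = 0" using spec[of "\<lambda>k. F k $ b = c" 0] unfolding F_def by simp
  then show ?thesis using v le by (intro eq_vec_entriesI[of _ m]) (auto intro: antisym)
qed

lemma U_pow_limit: "mat_limit m (\<lambda>j. U ^\<^sub>m j) (0\<^sub>m m m)"
proof -
  obtain v where v: "v \<in> carrier_vec m" "U *\<^sub>v v = v" "\<And>a. a < m \<Longrightarrow> 0 \<le> v $ a \<and> v $ a \<le> 1"
    "\<And>a. a < m \<Longrightarrow> (\<lambda>j. (U ^\<^sub>m j *\<^sub>v ones m) $ a) \<longlonglongrightarrow> v $ a"
    using substochastic_pow_ones_limit[OF U_substochastic] by blast
  have "v = 0\<^sub>v m" using U_fixed_vec_zero v by blast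
  then show ?thesis using v(4) U_nonneg by (intro pow_limit_zero_if_ones) auto
qed

text \<open>The expected numbers of visits to the current level before it is left downwards.\<close>

definition N :: "real mat" where "N = minv (1\<^sub>m m - U)"

lemma N_nonneg: "nonneg_square m N"
  unfolding N_def by (rule neumann_series[OF U_nonneg U_pow_limit])

lemma N_carrier [simp]: "N \<in> carrier_mat m m"
  using N_nonneg nonneg_squareD by blast

lemma N_dims [simp]: "dim_row N = m" "dim_col N = m"
  using N_carrier by (auto simp del: N_carrier)

lemma one_minus_U_mult_vec: "v \<in> carrier_vec m \<Longrightarrow> (1\<^sub>m m - U) *\<^sub>v v = v - U *\<^sub>v v"
  by (simp add: vec_simps)

lemma one_minus_U_invertible: "invertible_mat (1\<^sub>m m - U)"
  by (rule neumann_series[OF U_nonneg U_pow_limit])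

lemma N_inverse: "N * (1\<^sub>m m - U) = 1\<^sub>m m" "(1\<^sub>m m - U) * N = 1\<^sub>m m"
  using minv_inverse[OF _ one_minus_U_invertible] unfolding N_def by auto

lemma one_minus_U_N_mult_vec:
  assumes v: "v \<in> carrier_vec m"
  shows "N *\<^sub>v v - U *\<^sub>v (N *\<^sub>v v) = v"
proof -
  have "(1\<^sub>m m - U) *\<^sub>v (N *\<^sub>v v) = ((1\<^sub>m m - U) * N) *\<^sub>v v"
    using v by (intro assoc_mult_mat_vec[symmetric, of _ m m _ m]) auto
  then show ?thesis using v by (simp add: one_minus_U_mult_vec N_inverse)
qed

lemma one_minus_U_G: "(1\<^sub>m m - U) * G = D"
proof (rule eq_mat_entriesI[of _ m m])
  fix a b assume "a < m" "b < m"
  then show "((1\<^sub>m m - U) * G) $$ (a, b) = D $$ (a, b)"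
    using arg_cong[OF G_eq, of "\<lambda>X. X $$ (a, b)"]
    unfolding U_def by (simp add: ring_simps del: index_mult_mat(1))
qed auto

lemma N_D: "N * D = G"
proof -
  have "N * D = (N * (1\<^sub>m m - U)) * G"
    unfolding one_minus_U_G[symmetric] by (intro assoc_mult_mat[symmetric, of _ m m _ m _ m]) auto
  then show ?thesis by (simp add: N_inverse)
qed

lemma one_minus_U_injective:
  assumes v: "v \<in> carrier_vec m" "U *\<^sub>v v = v"
  shows "v = 0\<^sub>v m"
  by (rule pow_limit_zero_no_fixed_vec[OF _ U_pow_limit v]) simp

text \<open>For the mass \<open>v\<close> that \<open>G\<close> never loses, \<open>G v = v\<close> turns the equation of \<open>G\<close> into
  \<open>(D + Z + T) v = v\<close>, so \<open>v\<close> is constant.\<close>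

lemma G_pow_limit_or_stochastic:
  "G *\<^sub>v ones m = ones m \<or> mat_limit m (\<lambda>j. G ^\<^sub>m j) (0\<^sub>m m m)"
proof -
  obtain v where v: "v \<in> carrier_vec m" "G *\<^sub>v v = v" "\<And>a. a < m \<Longrightarrow> 0 \<le> v $ a \<and> v $ a \<le> 1"
    "\<And>a. a < m \<Longrightarrow> (\<lambda>j. (G ^\<^sub>m j *\<^sub>v ones m) $ a) \<longlonglongrightarrow> v $ a"
    using substochastic_pow_ones_limit[OF G_substochastic] by blast
  define c where "c = Max ((\<lambda>a. v $ a) ` {..<m})"
  have le: "v $ a \<le> c" if "a < m" for a using that unfolding c_def by (intro Max_ge) auto
  have "c \<in> (\<lambda>a. v $ a) ` {..<m}" unfolding c_def using m by (intro Max_in) (auto simp: lessThan_empty_iff)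
  then obtain a where a: "a < m" "v $ a = c" by auto
  have harm: "v $ a \<le> (D *\<^sub>v v) $ a + (Z *\<^sub>v v) $ a + (T *\<^sub>v v) $ a" if "a < m" for a
    using arg_cong[OF G_mult_vec[OF v(1)], of "\<lambda>x. x $ a"] that v(1,2)
    by (simp del: index_mult_mat_vec)
  have "v $ b = c" if "b < m" for b
    by (rule phase_maximum[OF v(1) le harm a that])
  then have vc: "v = c \<cdot>\<^sub>v ones m" using v(1) by (intro eq_vec_entriesI[of _ m]) auto
  show ?thesis
  proof (cases "c = 0")
    case True
    then have "\<And>a. a < m \<Longrightarrow> (\<lambda>j. (G ^\<^sub>m j *\<^sub>v ones m) $ a) \<longlonglongrightarrow> 0" using v(4) vc by simp
    then show ?thesis using pow_limit_zero_if_ones[OF G_nonneg] by blast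
  next
    case False
    have "c \<cdot>\<^sub>v (G *\<^sub>v ones m) = c \<cdot>\<^sub>v ones m"
      using v(2) vc by (simp add: mult_mat_vec[of _ m m])
    then have "(c \<cdot>\<^sub>v (G *\<^sub>v ones m)) $ a = (c \<cdot>\<^sub>v ones m) $ a" for a by simp
    then have "c * (G *\<^sub>v ones m) $ a = c * 1" if "a < m" for a
      using that by (metis dim_vec index_smult_vec(1) index_vec dim_mult_mat_vec dims(7))
    then have "(G *\<^sub>v ones m) $ a = 1" if "a < m" for a using False that by simp
    then have "G *\<^sub>v ones m = ones m" by (intro eq_vec_entriesI[of _ m]) auto
    then show ?thesis ..
  qed
qed

text \<open>The mass \<open>1 - G 1\<close> that is lost is then fixed by \<open>U\<close>.\<close>

lemma G_stochastic_if_TG_ones: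
  assumes "T *\<^sub>v (G *\<^sub>v ones m) = T *\<^sub>v ones m"
  shows "G *\<^sub>v ones m = ones m"
proof -
  have "U *\<^sub>v (ones m - G *\<^sub>v ones m) = ones m - G *\<^sub>v ones m"
  proof (rule eq_vec_entriesI[of _ m])
    fix a assume a: "a < m"
    show "(U *\<^sub>v (ones m - G *\<^sub>v ones m)) $ a = (ones m - G *\<^sub>v ones m) $ a"
      using total[OF a] a arg_cong[OF G_mult_vec, of "ones m" "\<lambda>x. x $ a"]
        arg_cong[OF assms, of "\<lambda>x. x $ a"]
      by (simp add: U_mult_vec vec_simps del: index_mult_mat_vec)
  qed auto
  then have 0: "ones m - G *\<^sub>v ones m = 0\<^sub>v m" by (intro one_minus_U_injective) auto
  show ?thesis
  proof (rule eq_vec_entriesI[of _ m])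
    fix a assume "a < m"
    then show "(G *\<^sub>v ones m) $ a = ones m $ a"
      using arg_cong[OF 0, of "\<lambda>x. x $ a"] by (simp del: index_mult_mat_vec)
  qed auto
qed

text \<open>The stochastic matrix \<open>D + Z + T\<close> has the eigenvalue \<open>1\<close>, hence also a left eigenvector \<open>w\<close>. Its
  absolute value can only increase under \<open>D + Z + T\<close>, but the total mass is preserved, so it is
  invariant. Its support is closed under transitions, so the indicator function of the support is
  subharmonic, and the maximum principle makes the support full.\<close>

lemma invariant_phase_measure:
  obtains \<alpha> where "\<alpha> \<in> carrier_vec m" "\<And>a. a < m \<Longrightarrow> 0 < \<alpha> $ a"
    "\<And>v. v \<in> carrier_vec m \<Longrightarrow> \<alpha> \<bullet> (D *\<^sub>v v) + \<alpha> \<bullet> (Z *\<^sub>v v) + \<alpha> \<bullet> (T *\<^sub>v v) = \<alpha> \<bullet> v"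
proof -
  define A where "A = D + Z + T"
  have A: "nonneg_square m A" unfolding A_def by (intro nonneg_square_add D Z T)
  have Ac [simp]: "A \<in> carrier_mat m m" using nonneg_squareD[OF A] .
  have Ad [simp]: "dim_row A = m" "dim_col A = m" using Ac by (auto simp del: Ac)
  have Av: "(A *\<^sub>v v) $ a = (D *\<^sub>v v) $ a + (Z *\<^sub>v v) $ a + (T *\<^sub>v v) $ a"
    if "v \<in> carrier_vec m" "a < m" for v a
    using that unfolding A_def by (simp add: vec_simps del: index_mult_mat_vec)
  have rowsum: "(\<Sum>b<m. A $$ (a, b)) = 1" if "a < m" for a
    using total[OF that] that Av[of "ones m" a] by (simp add: mult_mat_vec_entry[of A m m] del: index_mult_mat_vec)
  have "(1\<^sub>m m - A) *\<^sub>v ones m = 0\<^sub>v m"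
    using Av[of "ones m"] total
    by (intro eq_vec_entriesI[of _ m]) (auto simp: vec_simps simp del: index_mult_mat_vec)
  moreover have "ones m \<noteq> (0\<^sub>v m :: real vec)"
  proof
    assume "ones m = (0\<^sub>v m :: real vec)"
    from arg_cong[OF this, of "\<lambda>x. x $ 0"] m show False by simp
  qed
  ultimately have "det (1\<^sub>m m - A) = 0"
    using det_0_iff_vec_prod_zero_field[of "1\<^sub>m m - A" m] by (metis Ac minus_carrier_mat vec_carrier_vec)
  then have "det (transpose_mat (1\<^sub>m m - A)) = 0"
    using det_transpose[of "1\<^sub>m m - A" m] by simp
  then obtain w where w: "w \<in> carrier_vec m" "w \<noteq> 0\<^sub>v m" "transpose_mat (1\<^sub>m m - A) *\<^sub>v w = 0\<^sub>v m"
    using det_0_iff_vec_prod_zero_field[of "transpose_mat (1\<^sub>m m - A)" m]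
    by (metis Ac minus_carrier_mat transpose_carrier_mat)
  have wA: "(\<Sum>a<m. w $ a * A $$ (a, b)) = w $ b" if b: "b < m" for b
  proof -
    have "0 = (transpose_mat (1\<^sub>m m - A) *\<^sub>v w) $ b" using w b by simp
    also have "\<dots> = (\<Sum>a<m. transpose_mat (1\<^sub>m m - A) $$ (b, a) * w $ a)"
      using w b by (intro mult_mat_vec_entry[of _ m m]) auto
    also have "\<dots> = (\<Sum>a<m. (if a = b then w $ a else 0) - w $ a * A $$ (a, b))"
      using b by (intro sum.cong) (auto simp: algebra_simps)
    also have "\<dots> = w $ b - (\<Sum>a<m. w $ a * A $$ (a, b))"
      using b by (simp add: sum_subtractf)
    finally show ?thesis by simp
  qed
  define \<alpha> where "\<alpha> = vec m (\<lambda>a. \<bar>w $ a\<bar>)"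
  have le: "\<alpha> $ b \<le> (\<Sum>a<m. \<alpha> $ a * A $$ (a, b))" if b: "b < m" for b
  proof -
    have "\<alpha> $ b = \<bar>\<Sum>a<m. w $ a * A $$ (a, b)\<bar>" using b wA unfolding \<alpha>_def by simp
    also have "\<dots> \<le> (\<Sum>a<m. \<bar>w $ a * A $$ (a, b)\<bar>)" by (rule sum_abs)
    also have "\<dots> = (\<Sum>a<m. \<alpha> $ a * A $$ (a, b))"
      using A b unfolding \<alpha>_def nonneg_square_def by (intro sum.cong) (auto simp: abs_mult)
    finally show ?thesis .
  qed
  have "(\<Sum>b<m. (\<Sum>a<m. \<alpha> $ a * A $$ (a, b)) - \<alpha> $ b) = 0"
  proof -
    have "(\<Sum>b<m. \<Sum>a<m. \<alpha> $ a * A $$ (a, b)) = (\<Sum>a<m. \<alpha> $ a * (\<Sum>b<m. A $$ (a, b)))"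
      unfolding sum_distrib_left by (rule sum.swap)
    also have "\<dots> = (\<Sum>a<m. \<alpha> $ a)" using rowsum by simp
    finally show ?thesis by (simp add: sum_subtractf)
  qed
  then have inv: "(\<Sum>a<m. \<alpha> $ a * A $$ (a, b)) = \<alpha> $ b" if "b < m" for b
    using sum_nonneg_0[of "{..<m}" "\<lambda>b. (\<Sum>a<m. \<alpha> $ a * A $$ (a, b)) - \<alpha> $ b" b] le that by simp
  define f where "f = vec m (\<lambda>a. if \<alpha> $ a = 0 then 0 else (1 :: real))"
  have f: "f \<in> carrier_vec m" unfolding f_def by simp
  have sub: "f $ a \<le> (A *\<^sub>v f) $ a" if a: "a < m" for a
  proof (cases "\<alpha> $ a = 0")
    case True
    then show ?thesis using a mult_mat_vec_nonneg[OF A f _ a] unfolding f_def by simp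
  next
    case False
    then have pos: "0 < \<alpha> $ a" using a unfolding \<alpha>_def by auto
    have "(A *\<^sub>v f) $ a = (\<Sum>b<m. A $$ (a, b) * f $ b)"
      by (rule mult_mat_vec_entry[OF Ac f a])
    also have "\<dots> = (\<Sum>b<m. A $$ (a, b))"
    proof (intro sum.cong refl)
      fix b assume b: "b \<in> {..<m}"
      have "A $$ (a, b) = 0" if "\<alpha> $ b = 0"
      proof -
        have "(\<Sum>a<m. \<alpha> $ a * A $$ (a, b)) = 0" using inv b that by simp
        then have "\<alpha> $ a * A $$ (a, b) = 0"
          using a b A unfolding \<alpha>_def nonneg_square_def
          by (subst (asm) sum_nonneg_eq_0_iff) auto
        then show ?thesis using pos by simp
      qed
      then show "A $$ (a, b) * f $ b = A $$ (a, b)" using b unfolding f_def by auto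
    qed
    finally show ?thesis using rowsum[OF a] a unfolding f_def by simp
  qed
  obtain a where a: "a < m" "w $ a \<noteq> 0"
    using w(1,2) eq_vec_entriesI[of w m "0\<^sub>v m"] by auto
  have "f $ b = 1" if b: "b < m" for b
  proof (rule phase_maximum[OF f _ _ a(1) _ b])
    show "f $ c \<le> 1" if "c < m" for c using that unfolding f_def by simp
    show "f $ a = 1" using a unfolding f_def \<alpha>_def by simp
    show "f $ a \<le> (D *\<^sub>v f) $ a + (Z *\<^sub>v f) $ a + (T *\<^sub>v f) $ a" if "a < m" for a
      using sub Av[OF f] that by simp
  qed
  then have pos: "0 < \<alpha> $ b" if "b < m" for b
    using that unfolding f_def \<alpha>_def by (fastforce split: if_splits)
  have "\<alpha> \<bullet> (D *\<^sub>v v) + \<alpha> \<bullet> (Z *\<^sub>v v) + \<alpha> \<bullet> (T *\<^sub>v v) = \<alpha> \<bullet> v" if v: "v \<in> carrier_vec m" for v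
  proof -
    have "\<alpha> \<bullet> (D *\<^sub>v v) + \<alpha> \<bullet> (Z *\<^sub>v v) + \<alpha> \<bullet> (T *\<^sub>v v) = (\<Sum>a<m. \<alpha> $ a * (A *\<^sub>v v) $ a)"
      using v by (simp add: scalar_prod_entries[of _ m] Av sum.distrib distrib_left del: index_mult_mat_vec)
    also have "\<dots> = (\<Sum>a<m. \<Sum>b<m. \<alpha> $ a * A $$ (a, b) * v $ b)"
      using v by (simp add: mult_mat_vec_entry[of A m m] sum_distrib_left mult.assoc del: index_mult_mat_vec)
    also have "\<dots> = (\<Sum>b<m. (\<Sum>a<m. \<alpha> $ a * A $$ (a, b)) * v $ b)"
      unfolding sum_distrib_right by (rule sum.swap)
    also have "\<dots> = \<alpha> \<bullet> v" using v inv by (simp add: scalar_prod_entries[of v m])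
    finally show ?thesis .
  qed
  then show ?thesis using that[of \<alpha>] pos unfolding \<alpha>_def by simp
qed

end

section \<open>Invariant measures, bounded harmonic sequences and the drift\<close>

lemma nonneg_scalar_prod_eq_zero:
  fixes p :: "real vec"
  assumes p: "\<And>a. a < k \<Longrightarrow> 0 < p $ a" and v: "v \<in> carrier_vec k" "\<And>a. a < k \<Longrightarrow> 0 \<le> v $ a"
    and "p \<bullet> v = 0"
  shows "v = 0\<^sub>v k"
proof (rule eq_vec_entriesI[of _ k])
  fix a assume a: "a < k"
  have "(\<Sum>a<k. p $ a * v $ a) = 0" using assms(4) v(1) by (simp add: scalar_prod_entries)
  then have "p $ a * v $ a = 0"
    using a p v(2) by (subst (asm) sum_nonneg_eq_0_iff) (auto intro: mult_nonneg_nonneg less_imp_le)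
  then show "v $ a = 0\<^sub>v k $ a" using p[OF a] a by simp
qed (use v in auto)

lemma entry_le_scalar_prod:
  fixes p :: "real vec"
  assumes p: "\<And>a. a < k \<Longrightarrow> 0 \<le> p $ a" and X: "nonneg_square k X" and ab: "a < k" "b < k"
  shows "p $ a * X $$ (a, b) \<le> p \<bullet> (X *\<^sub>v unit_vec k b)"
proof -
  have Xc: "X \<in> carrier_mat k k" using nonneg_squareD[OF X] .
  have e: "(X *\<^sub>v unit_vec k b) $ i = X $$ (i, b)" if "i < k" for i
    using that Xc ab by simp
  have "p \<bullet> (X *\<^sub>v unit_vec k b) = (\<Sum>i<k. p $ i * X $$ (i, b))"
    using Xc e by (simp add: scalar_prod_entries[of _ k] del: index_mult_mat_vec)
  moreover have "p $ a * X $$ (a, b) \<le> (\<Sum>i<k. p $ i * X $$ (i, b))"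
    using ab p X unfolding nonneg_square_def
    by (intro member_le_sum[of a "{..<k}" "\<lambda>i. p $ i * X $$ (i, b)"]) auto
  ultimately show ?thesis by simp
qed

text \<open>The row \<open>a\<close> of \<open>X\<^sup>j\<close>, weighted by \<open>p a\<close>, is at most \<open>p X\<^sup>j = p\<close>.\<close>

lemma pow_bounded_by_invariant_measure:
  assumes X: "nonneg_square k X" and p: "\<And>a. a < k \<Longrightarrow> 0 < p $ a"
    and inv: "\<And>v. v \<in> carrier_vec k \<Longrightarrow> p \<bullet> (X *\<^sub>v v) = p \<bullet> v"
  shows "\<exists>c\<ge>0. \<forall>j. \<forall>a<k. \<forall>b<k. (X ^\<^sub>m j) $$ (a, b) \<le> c"
proof -
  have Xc: "X \<in> carrier_mat k k" using nonneg_squareD[OF X] .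
  have invj: "p \<bullet> (X ^\<^sub>m j *\<^sub>v v) = p \<bullet> v" if "v \<in> carrier_vec k" for j v
    using that
  proof (induction j)
    case (Suc j)
    have "X ^\<^sub>m Suc j *\<^sub>v v = X *\<^sub>v (X ^\<^sub>m j *\<^sub>v v)"
      using Xc Suc.prems by (simp add: pow_mat_Suc_left[OF Xc] assoc_mult_mat_vec[of _ k k _ k] del: pow_mat.simps)
    then show ?case using Suc inv[of "X ^\<^sub>m j *\<^sub>v v"] Xc by simp
  qed (use Xc in simp)
  define c where "c = (\<Sum>a<k. \<Sum>b<k. p $ b / p $ a)"
  have nn: "0 \<le> p $ b / p $ a" if "a < k" "b < k" for a b
    using p that by (simp add: less_imp_le)
  have "(X ^\<^sub>m j) $$ (a, b) \<le> c" if ab: "a < k" "b < k" for j a b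
  proof -
    have "p $ a * (X ^\<^sub>m j) $$ (a, b) \<le> p \<bullet> (X ^\<^sub>m j *\<^sub>v unit_vec k b)"
      using ab p by (intro entry_le_scalar_prod nonneg_square_pow X) (auto intro: less_imp_le)
    also have "\<dots> = p $ b" using ab invj[of "unit_vec k b" j] by simp
    finally have "(X ^\<^sub>m j) $$ (a, b) \<le> p $ b / p $ a"
      using p[OF ab(1)] by (simp add: field_simps)
    also have "\<dots> \<le> (\<Sum>b<k. p $ b / p $ a)"
      using ab nn by (intro member_le_sum) auto
    also have "\<dots> \<le> c" unfolding c_def
      using ab nn by (intro member_le_sum[of a "{..<k}" "\<lambda>a. \<Sum>b<k. p $ b / p $ a"] sum_nonneg) auto
    finally show ?thesis .
  qed
  moreover have "0 \<le> c" unfolding c_def using nn by (intro sum_nonneg) auto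
  ultimately show ?thesis by blast
qed

lemma substochastic_entry_le:
  assumes "substochastic k X" "a < k" "b < k"
  shows "X $$ (a, b) \<le> 1"
proof -
  have "X $$ (a, b) \<le> (\<Sum>i<k. X $$ (a, i))"
    using assms unfolding nonneg_square_def by (intro member_le_sum) auto
  also have "\<dots> = (X *\<^sub>v ones k) $ a"
    using assms nonneg_squareD[of k X] by (subst mult_mat_vec_entry[of _ k k]) auto
  finally show ?thesis using assms by force
qed

context level_walk
begin

text \<open>Adding the bound \<open>c\<close> makes the sequence nonnegative, so it dominates what \<open>G\<close> propagates from
  level \<open>0\<close>. As \<open>G\<close> is stochastic, this is the constant \<open>c\<close> again.\<close>

lemma bounded_superharmonic_nonneg:
  assumes G1: "G *\<^sub>v ones m = ones m"
    and f: "\<And>r. f r \<in> carrier_vec m" "f 0 = 0\<^sub>v m" and bound: "\<And>r a. a < m \<Longrightarrow> - c \<le> f r $ a"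
    and super: "\<And>r a. a < m \<Longrightarrow>
      (D *\<^sub>v f r) $ a + (Z *\<^sub>v f (Suc r)) $ a + (T *\<^sub>v f (Suc (Suc r))) $ a \<le> f (Suc r) $ a"
    and a: "a < m"
  shows "0 \<le> f r $ a"
proof -
  define h where "h r = c \<cdot>\<^sub>v ones m + f r" for r
  have h: "h r \<in> carrier_vec m" for r unfolding h_def using f by simp
  have mh: "(X *\<^sub>v h r) $ a = c * (X *\<^sub>v ones m) $ a + (X *\<^sub>v f r) $ a"
    if "X \<in> carrier_mat m m" "a < m" for X r a
    using that f unfolding h_def by (simp add: vec_simps mult_mat_vec[of _ m m] del: index_mult_mat_vec)
  have "(G ^\<^sub>m r *\<^sub>v h 0) $ a \<le> h r $ a"
  proof (rule superharmonic_ge_G_pow[OF h _ _ a])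
    show "0 \<le> h r $ a" if "a < m" for r a using bound[OF that, of r] that f(1)[of r] unfolding h_def by simp
    fix r a assume a: "a < m"
    have "(D *\<^sub>v h r) $ a + (Z *\<^sub>v h (Suc r)) $ a + (T *\<^sub>v h (Suc (Suc r))) $ a =
      c * ((D *\<^sub>v ones m) $ a + (Z *\<^sub>v ones m) $ a + (T *\<^sub>v ones m) $ a) +
      ((D *\<^sub>v f r) $ a + (Z *\<^sub>v f (Suc r)) $ a + (T *\<^sub>v f (Suc (Suc r))) $ a)"
      using a by (simp add: mh algebra_simps del: index_mult_mat_vec)
    also have "\<dots> \<le> c + f (Suc r) $ a" using super[OF a, of r] total[OF a] by simp
    also have "\<dots> = h (Suc r) $ a" using a f(1)[of "Suc r"] unfolding h_def by simp
    finally show "(D *\<^sub>v h r) $ a + (Z *\<^sub>v h (Suc r)) $ a + (T *\<^sub>v h (Suc (Suc r))) $ a \<le> h (Suc r) $ a" .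
  qed
  moreover have "h 0 = c \<cdot>\<^sub>v ones m" unfolding h_def using f(2) by auto
  moreover have "G ^\<^sub>m r *\<^sub>v (c \<cdot>\<^sub>v ones m) = c \<cdot>\<^sub>v ones m"
    by (rule pow_fixed_vec) (simp_all add: mult_mat_vec[of _ m m] G1)
  ultimately show ?thesis using a f(1)[of r] unfolding h_def by simp
qed

lemma bounded_harmonic_zero:
  assumes G1: "G *\<^sub>v ones m = ones m"
    and f: "\<And>r. f r \<in> carrier_vec m" "f 0 = 0\<^sub>v m" and bound: "\<And>r a. a < m \<Longrightarrow> \<bar>f r $ a\<bar> \<le> c"
    and harm: "\<And>r. D *\<^sub>v f r + Z *\<^sub>v f (Suc r) + T *\<^sub>v f (Suc (Suc r)) = f (Suc r)"
  shows "f r = 0\<^sub>v m"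
proof (rule eq_vec_entriesI[of _ m])
  fix a assume a: "a < m"
  have harm': "(D *\<^sub>v f r) $ a + (Z *\<^sub>v f (Suc r)) $ a + (T *\<^sub>v f (Suc (Suc r))) $ a = f (Suc r) $ a"
    if "a < m" for r a
    using arg_cong[OF harm[of r], of "\<lambda>x. x $ a"] that by (simp del: index_mult_mat_vec)
  have "0 \<le> f r $ a"
  proof (rule bounded_superharmonic_nonneg[where f = f and c = c, OF G1 f _ _ a])
    show "- c \<le> f r $ a" if "a < m" for r a using bound[OF that, of r] by linarith
  qed (use harm' in auto)
  moreover have "0 \<le> (- f r) $ a"
  proof (rule bounded_superharmonic_nonneg[OF G1 _ _ _ _ a, where f = "\<lambda>r. - f r" and c = c])
    have neg: "(X *\<^sub>v (- f r)) $ a = - (X *\<^sub>v f r) $ a" if "X \<in> carrier_mat m m" "a < m" for X r a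
      using that f(1)[of r] by (simp add: mult_mat_vec_entry[of _ m m] sum_negf del: index_mult_mat_vec)
    fix r a assume a: "a < m"
    show "- c \<le> (- f r) $ a" using bound[OF a, of r] a f(1)[of r] by simp
    show "(D *\<^sub>v - f r) $ a + (Z *\<^sub>v - f (Suc r)) $ a + (T *\<^sub>v - f (Suc (Suc r))) $ a \<le> (- f (Suc r)) $ a"
      using harm'[OF a, of r] a f(1)[of "Suc r"] by (simp add: neg del: index_mult_mat_vec)
  qed (use f in auto)
  ultimately show "f r $ a = 0\<^sub>v m $ a" using a f(1)[of r] by simp
qed (use f in auto)

text \<open>If \<open>G\<close> loses mass, then \<open>I - G\<close> is invertible. The invariant measure annihilates
  \<open>(I - U - T)(I - G) = I - (D + Z + T)\<close> and therefore the first factor. Evaluated at \<open>1\<close> this says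
  that the drift \<open>\<alpha> (T - D) 1\<close> equals \<open>\<alpha> T (1 - G 1)\<close>, which is positive.\<close>

lemma drift_if_not_stochastic:
  assumes \<alpha>: "\<alpha> \<in> carrier_vec m" "\<And>a. a < m \<Longrightarrow> 0 < \<alpha> $ a"
      "\<And>v. v \<in> carrier_vec m \<Longrightarrow> \<alpha> \<bullet> (D *\<^sub>v v) + \<alpha> \<bullet> (Z *\<^sub>v v) + \<alpha> \<bullet> (T *\<^sub>v v) = \<alpha> \<bullet> v"
    and G1: "G *\<^sub>v ones m \<noteq> ones m"
  shows "\<And>v. v \<in> carrier_vec m \<Longrightarrow> \<alpha> \<bullet> (T *\<^sub>v v) = \<alpha> \<bullet> v - \<alpha> \<bullet> (U *\<^sub>v v)"
    and "\<alpha> \<bullet> (D *\<^sub>v ones m) < \<alpha> \<bullet> (T *\<^sub>v ones m)"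
proof -
  note sp = scalar_prod_add_distrib[of _ m] scalar_prod_minus_distrib[of _ m]
  have lim: "mat_limit m (\<lambda>j. G ^\<^sub>m j) (0\<^sub>m m m)" using G_pow_limit_or_stochastic G1 by blast
  note inv = minv_inverse[OF _ neumann_series(1)[OF G_nonneg lim]]
  show *: "\<alpha> \<bullet> (T *\<^sub>v w) = \<alpha> \<bullet> w - \<alpha> \<bullet> (U *\<^sub>v w)" if w: "w \<in> carrier_vec m" for w
  proof -
    define v where "v = minv (1\<^sub>m m - G) *\<^sub>v w"
    have v: "v \<in> carrier_vec m" unfolding v_def using inv(1)[of m] by simp
    have wv: "w = v - G *\<^sub>v v"
    proof -
      have "w = ((1\<^sub>m m - G) * minv (1\<^sub>m m - G)) *\<^sub>v w" using inv(2)[of m] w by simp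
      also have "\<dots> = (1\<^sub>m m - G) *\<^sub>v v" unfolding v_def
        using inv(1)[of m] w by (intro assoc_mult_mat_vec[of _ m m _ m]) auto
      finally show ?thesis using v by (simp add: vec_simps)
    qed
    have g: "\<alpha> \<bullet> (G *\<^sub>v v) = \<alpha> \<bullet> (D *\<^sub>v v) + \<alpha> \<bullet> (Z *\<^sub>v (G *\<^sub>v v)) + \<alpha> \<bullet> (T *\<^sub>v (G *\<^sub>v (G *\<^sub>v v)))"
      using arg_cong[OF G_mult_vec[OF v], of "\<lambda>x. \<alpha> \<bullet> x"] \<alpha>(1) v by (simp add: sp)
    show ?thesis unfolding wv using g \<alpha>(3)[OF v] \<alpha>(1) v
      by (simp add: sp vec_simps U_mult_vec)
  qed
  have eq: "\<alpha> \<bullet> (D *\<^sub>v ones m) = \<alpha> \<bullet> (T *\<^sub>v (G *\<^sub>v ones m))"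
    using *[of "ones m"] \<alpha>(3)[of "ones m"] \<alpha>(1) by (simp add: U_mult_vec sp)
  define v where "v = T *\<^sub>v ones m - T *\<^sub>v (G *\<^sub>v ones m)"
  have v: "v \<in> carrier_vec m" "\<And>a. a < m \<Longrightarrow> 0 \<le> v $ a"
    unfolding v_def using TG_ones_le by (auto simp del: index_mult_mat_vec)
  have ge: "0 \<le> \<alpha> \<bullet> v" using v \<alpha>(2)
    by (auto simp: scalar_prod_entries[of _ m] less_imp_le intro!: sum_nonneg mult_nonneg_nonneg)
  have "\<alpha> \<bullet> v \<noteq> 0"
  proof
    assume "\<alpha> \<bullet> v = 0"
    then have "v = 0\<^sub>v m" using nonneg_scalar_prod_eq_zero[OF \<alpha>(2) v] by blast
    then have eq: "v $ a = 0" if "a < m" for a using that by simp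
    have "T *\<^sub>v (G *\<^sub>v ones m) = T *\<^sub>v ones m"
    proof (rule eq_vec_entriesI[of _ m])
      fix a assume "a < m"
      then show "(T *\<^sub>v (G *\<^sub>v ones m)) $ a = (T *\<^sub>v ones m) $ a"
        using eq[of a] unfolding v_def by (simp del: index_mult_mat_vec)
    qed auto
    then show False using G_stochastic_if_TG_ones G1 by blast
  qed
  then show "\<alpha> \<bullet> (D *\<^sub>v ones m) < \<alpha> \<bullet> (T *\<^sub>v ones m)"
    using ge eq \<alpha>(1) unfolding v_def by (simp add: sp)
qed

end

section \<open>The matrix \<open>R\<close>\<close>

locale qbd_core = level_walk m Am A0 A1 G + reversed: level_walk m A1 A0 Am Gh
  for m :: nat and Am A0 A1 G Gh :: "real mat" +
  fixes R :: "real mat"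
  assumes R: "minimal_nonneg_solution m (\<lambda>X. A1 + X * (A0 - 1\<^sub>m m) + (X * X) * Am) R"
begin

text \<open>The drift cannot be positive in both directions.\<close>

lemma Gh_stochastic_if_G_not:
  assumes "G *\<^sub>v ones m \<noteq> ones m"
  shows "Gh *\<^sub>v ones m = ones m"
proof (rule ccontr)
  assume Gh1: "Gh *\<^sub>v ones m \<noteq> ones m"
  obtain \<alpha> where \<alpha>: "\<alpha> \<in> carrier_vec m" "\<And>a. a < m \<Longrightarrow> 0 < \<alpha> $ a"
    "\<And>v. v \<in> carrier_vec m \<Longrightarrow> \<alpha> \<bullet> (Am *\<^sub>v v) + \<alpha> \<bullet> (A0 *\<^sub>v v) + \<alpha> \<bullet> (A1 *\<^sub>v v) = \<alpha> \<bullet> v"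
    using invariant_phase_measure by blast
  have \<alpha>': "\<alpha> \<bullet> (A1 *\<^sub>v v) + \<alpha> \<bullet> (A0 *\<^sub>v v) + \<alpha> \<bullet> (Am *\<^sub>v v) = \<alpha> \<bullet> v"
    if "v \<in> carrier_vec m" for v using \<alpha>(3)[OF that] by simp
  show False
    using drift_if_not_stochastic(2)[OF \<alpha> assms] reversed.drift_if_not_stochastic(2)[OF \<alpha>(1,2) \<alpha>' Gh1]
    by simp
qed

lemma R_nonneg: "nonneg_square m R" and R_carrier [simp]: "R \<in> carrier_mat m m"
  using R unfolding minimal_nonneg_solution_def by (auto simp: nonneg_square_iff_le)

lemma R_dims [simp]: "dim_row R = m" "dim_col R = m"
  using R_carrier by (auto simp del: R_carrier)

lemma R_eq: "A1 + R * A0 + R * (R * Am) = R"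
proof (rule eq_mat_entriesI[of _ m m])
  have eq: "A1 + R * (A0 - 1\<^sub>m m) + (R * R) * Am = 0\<^sub>m m m"
    using R unfolding minimal_nonneg_solution_def by simp
  fix a b assume "a < m" "b < m"
  then show "(A1 + R * A0 + R * (R * Am)) $$ (a, b) = R $$ (a, b)"
    using arg_cong[OF eq, of "\<lambda>X. X $$ (a, b)"]
    by (simp add: ring_simps del: index_mult_mat(1))
qed auto

lemma R_minimal:
  assumes Y: "nonneg_square m Y" and eq: "A1 + Y * A0 + Y * (Y * Am) = Y"
  shows "R \<le> Y"
proof -
  have Yc [simp]: "Y \<in> carrier_mat m m" using nonneg_squareD[OF Y] .
  have [simp]: "dim_row Y = m" "dim_col Y = m" using Yc by (auto simp del: Yc)
  have "A1 + Y * (A0 - 1\<^sub>m m) + (Y * Y) * Am = 0\<^sub>m m m"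
  proof (rule eq_mat_entriesI[of _ m m])
    fix a b assume "a < m" "b < m"
    then show "(A1 + Y * (A0 - 1\<^sub>m m) + (Y * Y) * Am) $$ (a, b) = 0\<^sub>m m m $$ (a, b)"
      using arg_cong[OF eq, of "\<lambda>X. X $$ (a, b)"]
      by (simp add: ring_simps del: index_mult_mat(1))
  qed auto
  then show ?thesis using R Y unfolding minimal_nonneg_solution_def by (simp add: nonneg_square_iff_le)
qed

lemma pow_mono:
  assumes "nonneg_square m X" "nonneg_square m Y" "X \<le> Y"
  shows "X ^\<^sub>m j \<le> Y ^\<^sub>m j"
proof (induction j)
  case 0 then show ?case using nonneg_squareD[OF assms(1)] nonneg_squareD[OF assms(2)] by simp
next
  case (Suc j)
  then show ?case using assms by (simp add: mult_mat_mono[of m] nonneg_square_pow)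
qed

text \<open>The matrix \<open>A\<^sub>1 N\<close> solves the equation of \<open>R\<close>, and \<open>(I - A\<^sub>0 - R A\<^sub>-\<^sub>1)\<^sup>-\<^sup>1 A\<^sub>-\<^sub>1\<close> solves the equation of
  \<open>G\<close>, so both are at least the minimal solutions. From \<open>R \<le> A\<^sub>1 N\<close> and the monotonicity of the
  Neumann series the second one is also at most \<open>G\<close>; hence it is \<open>G\<close>, and everything else follows.\<close>

lemma R_eq_A1_N: "R = A1 * N" and R_Am: "R * Am = A1 * G"
proof -
  define R' where "R' = A1 * N"
  have R': "nonneg_square m R'" unfolding R'_def by (intro nonneg_square_mult N_nonneg T)
  have R'c [simp]: "R' \<in> carrier_mat m m" using nonneg_squareD[OF R'] .
  have R'd [simp]: "dim_row R' = m" "dim_col R' = m" using R'c by (auto simp del: R'c)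
  have R'U: "R' * (1\<^sub>m m - U) = A1"
    unfolding R'_def by (simp add: assoc_mult_mat[of _ m m _ m _ m] N_inverse)
  have R'Am: "R' * Am = A1 * G"
    unfolding R'_def by (simp add: assoc_mult_mat[of _ m m _ m _ m] N_D)
  have "R \<le> R'"
  proof (rule R_minimal[OF R'], rule eq_mat_entriesI[of _ m m])
    fix a b assume "a < m" "b < m"
    then show "(A1 + R' * A0 + R' * (R' * Am)) $$ (a, b) = R' $$ (a, b)"
      using arg_cong[OF R'U, of "\<lambda>X. X $$ (a, b)"] unfolding R'Am U_def
      by (simp add: ring_simps del: index_mult_mat(1))
  qed auto
  define UR where "UR = A0 + R * Am"
  have UR: "nonneg_square m UR" unfolding UR_def by (intro nonneg_square_add nonneg_square_mult Z R_nonneg D)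
  have URc [simp]: "UR \<in> carrier_mat m m" using nonneg_squareD[OF UR] .
  have URd [simp]: "dim_row UR = m" "dim_col UR = m" using URc by (auto simp del: URc)
  have "UR \<le> U" unfolding UR_def U_def R'Am[symmetric]
    by (intro add_mat_mono[of _ m] mult_mat_mono[of m] R_nonneg R' D \<open>R \<le> R'\<close>) auto
  then have le: "UR ^\<^sub>m j \<le> U ^\<^sub>m j" for j by (intro pow_mono UR U_nonneg)
  have URlim: "mat_limit m (\<lambda>j. UR ^\<^sub>m j) (0\<^sub>m m m)"
    unfolding mat_limit_def
  proof (intro allI impI)
    fix a b assume ab: "a < m" "b < m"
    have "(\<lambda>j. (UR ^\<^sub>m j) $$ (a, b)) \<longlonglongrightarrow> 0"
    proof (rule tendsto_sandwich[of "\<lambda>_. 0" _ _ "\<lambda>j. (U ^\<^sub>m j) $$ (a, b)"])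
      show "\<forall>\<^sub>F j in sequentially. 0 \<le> (UR ^\<^sub>m j) $$ (a, b)"
        using nonneg_square_pow[OF UR] ab unfolding nonneg_square_def by auto
      show "\<forall>\<^sub>F j in sequentially. (UR ^\<^sub>m j) $$ (a, b) \<le> (U ^\<^sub>m j) $$ (a, b)"
        using le ab by (auto simp: less_eq_mat_def)
      show "(\<lambda>j. (U ^\<^sub>m j) $$ (a, b)) \<longlonglongrightarrow> 0"
        using U_pow_limit ab unfolding mat_limit_def by simp
    qed auto
    then show "(\<lambda>j. (UR ^\<^sub>m j) $$ (a, b)) \<longlonglongrightarrow> 0\<^sub>m m m $$ (a, b)" using ab by simp
  qed
  define NR where "NR = minv (1\<^sub>m m - UR)"
  note nR = neumann_series[OF UR URlim, folded NR_def]
  have NRi: "NR \<in> carrier_mat m m" "(1\<^sub>m m - UR) * NR = 1\<^sub>m m" "NR * (1\<^sub>m m - UR) = 1\<^sub>m m"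
    using minv_inverse[OF _ nR(1)] unfolding NR_def by auto
  note [simp] = NRi(1)
  have [simp]: "dim_row NR = m" "dim_col NR = m" using NRi(1) by (auto simp del: NRi(1))
  have RUR: "R * (1\<^sub>m m - UR) = A1"
  proof (rule eq_mat_entriesI[of _ m m])
    fix a b assume "a < m" "b < m"
    then show "(R * (1\<^sub>m m - UR)) $$ (a, b) = A1 $$ (a, b)"
      using arg_cong[OF R_eq, of "\<lambda>X. X $$ (a, b)"] unfolding UR_def
      by (simp add: ring_simps del: index_mult_mat(1))
  qed auto
  define G' where "G' = NR * Am"
  have G': "nonneg_square m G'" unfolding G'_def by (intro nonneg_square_mult nR D)
  have G'c [simp]: "G' \<in> carrier_mat m m" using nonneg_squareD[OF G'] .
  have [simp]: "dim_row G' = m" "dim_col G' = m" using G'c by (auto simp del: G'c)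
  have UG': "(1\<^sub>m m - UR) * G' = Am"
  proof -
    have "(1\<^sub>m m - UR) * G' = ((1\<^sub>m m - UR) * NR) * Am"
      unfolding G'_def by (intro assoc_mult_mat[symmetric, of _ m m _ m _ m]) auto
    then show ?thesis by (simp add: NRi)
  qed
  have A1G': "A1 * G' = R * Am"
  proof -
    have "A1 * G' = R * ((1\<^sub>m m - UR) * G')"
      unfolding RUR[symmetric] by (intro assoc_mult_mat[of _ m m _ m _ m]) auto
    then show ?thesis by (simp add: UG')
  qed
  have "G \<le> G'"
  proof (rule G_minimal[OF G'], rule eq_mat_entriesI[of _ m m])
    have e: "A1 * (G' * G') = R * (Am * G')"
      using A1G' by (simp add: assoc_mult_mat[symmetric, of _ m m _ m _ m])
    fix a b assume "a < m" "b < m"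
    then show "(Am + A0 * G' + A1 * (G' * G')) $$ (a, b) = G' $$ (a, b)"
      using arg_cong[OF UG', of "\<lambda>X. X $$ (a, b)"] unfolding e UR_def
      by (simp add: ring_simps del: index_mult_mat(1))
  qed auto
  moreover have "G' \<le> G"
  proof -
    have "NR $$ (a, b) \<le> N $$ (a, b)" if ab: "a < m" "b < m" for a b
    proof (rule LIMSEQ_le)
      show "(\<lambda>j. geo_sum m UR j $$ (a, b)) \<longlonglongrightarrow> NR $$ (a, b)"
        using nR(2) ab unfolding mat_limit_def by blast
      show "(\<lambda>j. geo_sum m U j $$ (a, b)) \<longlonglongrightarrow> N $$ (a, b)"
        using neumann_series(2)[OF U_nonneg U_pow_limit] ab unfolding mat_limit_def N_def by blast
      show "\<exists>n. \<forall>j\<ge>n. geo_sum m UR j $$ (a, b) \<le> geo_sum m U j $$ (a, b)"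
        using ab le by (auto simp: geo_sum_entry less_eq_mat_def intro!: sum_mono)
    qed
    then have "NR \<le> N" using N_carrier by (auto simp: less_eq_mat_def simp del: N_carrier)
    then have "NR * Am \<le> N * Am"
      by (intro mult_mat_mono[of m] nR N_nonneg D) auto
    then show ?thesis unfolding G'_def N_D .
  qed
  ultimately have "G' = G" by simp
  with A1G' show RAm: "R * Am = A1 * G" by simp
  then have "UR = U" unfolding UR_def U_def by simp
  have "R = R * ((1\<^sub>m m - U) * N)" by (simp add: N_inverse)
  also have "\<dots> = (R * (1\<^sub>m m - U)) * N" by (intro assoc_mult_mat[symmetric, of _ m m _ m _ m]) auto
  finally show "R = A1 * N" using RUR \<open>UR = U\<close> by simp
qed

lemma R_one_minus_U: "R * (1\<^sub>m m - U) = A1"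
  unfolding R_eq_A1_N by (simp add: assoc_mult_mat[of _ m m _ m _ m] N_inverse)

lemma U_eq: "U = A0 + R * Am"
  unfolding U_def R_Am ..

section \<open>The series \<open>W\<close>\<close>

text \<open>The expected numbers of visits of the walk on all integer levels to its starting level at times
  when the lowest level so far lies \<open>j\<close> levels below.\<close>

definition green_term :: "nat \<Rightarrow> real mat" where
  "green_term j = G ^\<^sub>m j * N * R ^\<^sub>m j"

lemma green_term_nonneg: "nonneg_square m (green_term j)"
  unfolding green_term_def by (intro nonneg_square_mult nonneg_square_pow G_nonneg N_nonneg R_nonneg)

lemma green_term_carrier [simp]: "green_term j \<in> carrier_mat m m"
  unfolding green_term_def by simp

lemma green_term_summable:
  assumes "\<And>a k l b. a < m \<Longrightarrow> k < m \<Longrightarrow> l < m \<Longrightarrow> b < m \<Longrightarrow>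
    summable (\<lambda>j. (G ^\<^sub>m j) $$ (a, k) * (R ^\<^sub>m j) $$ (l, b))"
    and ab: "a < m" "b < m"
  shows "summable (\<lambda>j. green_term j $$ (a, b))"
proof -
  have "green_term j $$ (a, b) =
      (\<Sum>l<m. \<Sum>k<m. N $$ (k, l) * ((G ^\<^sub>m j) $$ (a, k) * (R ^\<^sub>m j) $$ (l, b)))" for j
    unfolding green_term_def using ab
    by (simp add: mult_mat_entry[of _ m m _ m] sum_distrib_right sum_distrib_left mult_ac del: index_mult_mat(1))
  then show ?thesis using assms by (auto intro!: summable_sum summable_mult)
qed

text \<open>The matrix \<open>-W\<close>; its sign makes it the nonnegative Green kernel within a level.\<close>

definition green :: "real mat" where
  "green = mat m m (\<lambda>(a, b). \<Sum>j. green_term j $$ (a, b))"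

lemma green_carrier [simp]: "green \<in> carrier_mat m m"
  unfolding green_def by simp

lemma green_dims [simp]: "dim_row green = m" "dim_col green = m"
  unfolding green_def by simp_all

fun green_sum :: "nat \<Rightarrow> real mat" where
  "green_sum 0 = 0\<^sub>m m m"
| "green_sum (Suc j) = green_sum j + green_term j"

lemma green_sum_carrier [simp]: "green_sum j \<in> carrier_mat m m"
  by (induction j) auto

lemma green_sum_entry: "a < m \<Longrightarrow> b < m \<Longrightarrow> green_sum j $$ (a, b) = (\<Sum>i<j. green_term i $$ (a, b))"
proof (induction j)
  case (Suc j)
  have "dim_row (green_term j) = m" "dim_col (green_term j) = m" using green_term_carrier[of j] by blast+
  then show ?case using Suc by simp
qed simp

lemma green_sum_Suc: "green_sum (Suc j) = N + G * green_sum j * R"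
proof (induction j)
  case 0
  have "green_sum (Suc 0) = N"
    using left_mult_one_mat[OF N_carrier] right_mult_one_mat[OF N_carrier]
    by (simp add: green_term_def left_add_zero_mat[of _ m m])
  moreover have "N + G * green_sum 0 * R = N"
    by (intro eq_mat_entriesI[of _ m m]) simp_all
  ultimately show ?case by simp
next
  case (Suc j)
  have t: "green_term (Suc j) = G * green_term j * R"
    unfolding green_term_def
    by (simp add: pow_mat_Suc_left[of G m] assoc_mult_mat[of _ m m _ m _ m] pow_mat.simps(2)[of R] del: pow_mat.simps(2))
  have "green_sum (Suc (Suc j)) = (N + G * green_sum j * R) + G * green_term j * R"
    unfolding green_sum.simps(2)[of "Suc j"] Suc t ..
  also have "\<dots> = N + (G * green_sum j * R + G * green_term j * R)"
    by (intro assoc_add_mat[of _ m m]) auto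
  also have "G * green_sum j * R + G * green_term j * R = G * green_sum (Suc j) * R"
    by (simp add: ring_simps)
  finally show ?case .
qed

end

locale qbd_green = qbd_core +
  assumes summable_green: "\<And>a b. a < m \<Longrightarrow> b < m \<Longrightarrow> summable (\<lambda>j. green_term j $$ (a, b))"
begin

lemma green_limit: "mat_limit m green_sum green"
  unfolding mat_limit_def
proof (intro allI impI)
  fix a b assume ab: "a < m" "b < m"
  show "(\<lambda>i. green_sum i $$ (a, b)) \<longlonglongrightarrow> green $$ (a, b)"
    using summable_LIMSEQ[OF summable_green[OF ab]] ab unfolding green_def by (simp add: green_sum_entry)
qed

lemma green_eq: "green = N + G * green * R"
proof (rule mat_limit_unique[OF mat_limit_Suc[OF green_limit]])
  show "mat_limit m (\<lambda>i. green_sum (Suc i)) (N + G * green * R)"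
    unfolding green_sum_Suc by (intro mat_limit_add mat_limit_mult mat_limit_const green_limit) auto
qed auto

lemma green_nonneg: "nonneg_square m green"
proof (rule nonneg_square_limit[OF green_limit])
  show "nonneg_square m (green_sum j)" for j
  proof (induction j)
    case 0 then show ?case by (auto simp: nonneg_square_def)
  next
    case (Suc j) then show ?case by (auto intro!: nonneg_square_add green_term_nonneg)
  qed
qed simp

lemma one_minus_U_green: "(1\<^sub>m m - U) * green = 1\<^sub>m m + Am * green * R"
proof -
  have "(1\<^sub>m m - U) * green = (1\<^sub>m m - U) * N + (1\<^sub>m m - U) * (G * green * R)"
    by (subst green_eq) (intro mult_add_distrib_mat[of _ m m _ m], auto)
  also have "(1\<^sub>m m - U) * (G * green * R) = ((1\<^sub>m m - U) * G) * green * R"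
    by (simp add: assoc_mult_mat[of _ m m _ m _ m])
  finally show ?thesis by (simp add: one_minus_U_G N_inverse)
qed

lemma green_harmonic:
  "A1 * green + A0 * (green * R) + Am * (green * R * R) = green * R"
proof -
  have 1: "A1 * green = R + A1 * G * green * R"
    by (subst green_eq) (simp add: ring_simps R_eq_A1_N[symmetric])
  have 2: "(1\<^sub>m m - U) * green * R = R + Am * green * R * R"
    unfolding one_minus_U_green by (simp add: ring_simps)
  show ?thesis
  proof (rule eq_mat_entriesI[of _ m m])
    fix a b assume "a < m" "b < m"
    then show "(A1 * green + A0 * (green * R) + Am * (green * R * R)) $$ (a, b) = (green * R) $$ (a, b)"
      using arg_cong[OF 1, of "\<lambda>X. X $$ (a, b)"] arg_cong[OF 2, of "\<lambda>X. X $$ (a, b)"]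
      unfolding U_def by (simp add: ring_simps del: index_mult_mat(1))
  qed auto
qed

lemma green_R_pow_harmonic:
  assumes v: "v \<in> carrier_vec m"
  shows "A1 *\<^sub>v (green *\<^sub>v (R ^\<^sub>m r *\<^sub>v v)) + A0 *\<^sub>v (green *\<^sub>v (R ^\<^sub>m Suc r *\<^sub>v v))
    + Am *\<^sub>v (green *\<^sub>v (R ^\<^sub>m Suc (Suc r) *\<^sub>v v)) = green *\<^sub>v (R ^\<^sub>m Suc r *\<^sub>v v)"
proof -
  have S: "R ^\<^sub>m Suc r *\<^sub>v v = R *\<^sub>v (R ^\<^sub>m r *\<^sub>v v)" for r
    using v by (simp add: pow_mat_Suc_left[of _ m] vec_simps del: pow_mat.simps)
  show ?thesis unfolding S
    using arg_cong[OF green_harmonic, of "\<lambda>X. X *\<^sub>v (R ^\<^sub>m r *\<^sub>v v)"] v by (simp add: vec_simps)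
qed

text \<open>The sequences \<open>green R\<^sup>r\<close> and \<open>Gh\<^sup>r green\<close> are harmonic for the reversed walk and agree for \<open>r = 0\<close>. This is
  the harmonicity of their difference at \<open>r = 1\<close>, with the difference at \<open>r = 2\<close> expressed by the one at
  \<open>r = 1\<close>.\<close>

lemma commutator_eq:
  "(1\<^sub>m m - reversed.U) * (green * R - Gh * green) = Am * (green * R - Gh * green) * R"
proof (rule eq_mat_entriesI[of _ m m])
  have g: "A1 * green + A0 * Gh * green + Am * Gh * Gh * green = Gh * green"
    using arg_cong[OF reversed.G_eq, of "\<lambda>X. X * green"]
    by (simp add: ring_simps)
  fix a b assume "a < m" "b < m"
  then show "((1\<^sub>m m - reversed.U) * (green * R - Gh * green)) $$ (a, b) =
      (Am * (green * R - Gh * green) * R) $$ (a, b)"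
    using arg_cong[OF green_harmonic, of "\<lambda>X. X $$ (a, b)"] arg_cong[OF g, of "\<lambda>X. X $$ (a, b)"]
    unfolding reversed.U_def by (simp add: ring_simps del: index_mult_mat(1))
qed auto

text \<open>This is the one-step equation of the Green kernel at the starting level, where \<open>Gh * green\<close> and
  \<open>G * green\<close> describe the two neighbouring levels.\<close>

lemma inverse_green_if_intertwining:
  assumes "green * R = Gh * green"
  shows "(1\<^sub>m m - U - Am * Gh) * green = 1\<^sub>m m"
proof (rule eq_mat_entriesI[of _ m m])
  fix a b assume "a < m" "b < m"
  then show "((1\<^sub>m m - U - Am * Gh) * green) $$ (a, b) = 1\<^sub>m m $$ (a, b)"
    using arg_cong[OF one_minus_U_green, of "\<lambda>X. X $$ (a, b)"] assms
    by (simp add: ring_simps del: index_mult_mat(1))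
qed auto

end

lemma summable_mult_bounded:
  fixes x y :: "nat \<Rightarrow> real"
  assumes "summable x" "\<And>j. 0 \<le> x j" "\<And>j. 0 \<le> y j" "\<And>j. y j \<le> c"
  shows "summable (\<lambda>j. x j * y j)"
proof (rule summable_comparison_test[OF _ summable_mult[OF assms(1), of c]])
  have "norm (x j * y j) \<le> c * x j" for j
    using mult_mono[OF order_refl[of "x j"] assms(4)[of j]] assms by (simp add: mult.commute)
  then show "\<exists>N. \<forall>n\<ge>N. norm (x n * y n) \<le> c * x n" by blast
qed

lemma neumann_summable:
  assumes "nonneg_square k X" "mat_limit k (\<lambda>j. X ^\<^sub>m j) (0\<^sub>m k k)" "a < k" "b < k"
  shows "summable (\<lambda>j. (X ^\<^sub>m j) $$ (a, b))"
proof -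
  have "(\<lambda>j. geo_sum k X j $$ (a, b)) \<longlonglongrightarrow> minv (1\<^sub>m k - X) $$ (a, b)"
    using neumann_series(2)[OF assms(1,2)] assms(3,4) unfolding mat_limit_def by blast
  then have "(\<lambda>j. (X ^\<^sub>m j) $$ (a, b)) sums minv (1\<^sub>m k - X) $$ (a, b)"
    using assms(3,4) nonneg_squareD[OF assms(1)] by (simp add: sums_def geo_sum_entry)
  then show ?thesis by (rule sums_summable)
qed

lemma tendsto_zero_bounded_scalar_prod:
  fixes p x :: "nat \<Rightarrow> real vec"
  assumes p: "\<And>a. a < k \<Longrightarrow> (\<lambda>j. p j $ a) \<longlonglongrightarrow> 0"
    and x: "\<And>j. x j \<in> carrier_vec k" "\<And>j a. a < k \<Longrightarrow> \<bar>x j $ a\<bar> \<le> c"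
  shows "(\<lambda>j. p j \<bullet> x j) \<longlonglongrightarrow> 0"
proof -
  have "(\<lambda>j. p j $ a * x j $ a) \<longlonglongrightarrow> 0" if a: "a < k" for a
  proof (rule tendsto_0_le[OF p[OF a], of _ c])
    show "\<forall>\<^sub>F j in sequentially. norm (p j $ a * x j $ a) \<le> norm (p j $ a) * c"
      using x(2)[OF a] by (auto simp: abs_mult intro!: mult_left_mono always_eventually)
  qed
  then have "(\<lambda>j. \<Sum>a<k. p j $ a * x j $ a) \<longlonglongrightarrow> (\<Sum>a<k. 0)" by (intro tendsto_sum) auto
  then show ?thesis using x(1) by (simp add: scalar_prod_entries[of _ k])
qed

lemma mult_mat_vec_abs_le:
  fixes A :: "real mat"
  assumes A: "A \<in> carrier_mat k k" and v: "v \<in> carrier_vec k" "\<And>b. b < k \<Longrightarrow> \<bar>v $ b\<bar> \<le> c" and a: "a < k"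
  shows "\<bar>(A *\<^sub>v v) $ a\<bar> \<le> (\<Sum>i<k. \<Sum>b<k. \<bar>A $$ (i, b)\<bar>) * c"
proof -
  have c: "0 \<le> c" using v(2)[OF a] by linarith
  have "\<bar>(A *\<^sub>v v) $ a\<bar> \<le> (\<Sum>b<k. \<bar>A $$ (a, b)\<bar> * c)"
    unfolding mult_mat_vec_entry[OF A v(1) a] using v(2)
    by (intro order_trans[OF sum_abs] sum_mono) (auto simp: abs_mult intro!: mult_left_mono)
  also have "\<dots> = (\<Sum>b<k. \<bar>A $$ (a, b)\<bar>) * c" by (simp add: sum_distrib_right)
  also have "\<dots> \<le> (\<Sum>i<k. \<Sum>b<k. \<bar>A $$ (i, b)\<bar>) * c"
    using a c by (intro mult_right_mono member_le_sum[of a "{..<k}" "\<lambda>i. \<Sum>b<k. \<bar>A $$ (i, b)\<bar>"] sum_nonneg) auto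
  finally show ?thesis .
qed

lemma unit_vec_mult_entry:
  fixes X :: "'a :: semiring_1 mat"
  assumes "X \<in> carrier_mat k k" "a < k" "b < k"
  shows "(X *\<^sub>v unit_vec k b) $ a = X $$ (a, b)"
  using assms by simp

lemma mat_diff_zeroD:
  fixes A B :: "'a :: group_add mat"
  assumes "A \<in> carrier_mat k l" "B \<in> carrier_mat k l" "A - B = 0\<^sub>m k l"
  shows "A = B"
proof (rule eq_mat_entriesI[OF assms(1,2)])
  fix a b assume "a < k" "b < l"
  then show "A $$ (a, b) = B $$ (a, b)"
    using arg_cong[OF assms(3), of "\<lambda>X. X $$ (a, b)"] assms(1,2) by simp
qed

lemma mat_zero_if_columns_zero:
  fixes X :: "'a :: semiring_1 mat"
  assumes X: "X \<in> carrier_mat k k" and "\<And>b. b < k \<Longrightarrow> X *\<^sub>v unit_vec k b = 0\<^sub>v k"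
  shows "X = 0\<^sub>m k k"
proof (rule eq_mat_entriesI[OF X])
  fix a b assume ab: "a < k" "b < k"
  then show "X $$ (a, b) = 0\<^sub>m k k $$ (a, b)"
    using unit_vec_mult_entry[OF X ab] assms(2)[OF ab(2)] by simp
qed simp

context qbd_core
begin

lemma G_pow_entry_le: "a < m \<Longrightarrow> b < m \<Longrightarrow> (G ^\<^sub>m j) $$ (a, b) \<le> 1"
proof -
  assume ab: "a < m" "b < m"
  have "(G ^\<^sub>m j *\<^sub>v ones m) $ a \<le> 1" if "a < m" for a
    using G_pow_nonneg_le[of "ones m" 1 a j] that by (simp del: index_mult_mat_vec)
  then show ?thesis
    using ab nonneg_square_pow[OF G_nonneg] by (intro substochastic_entry_le[of m]) auto
qed

lemma pow_nonneg_entries: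
  "nonneg_square k X \<Longrightarrow> a < k \<Longrightarrow> b < k \<Longrightarrow> 0 \<le> (X ^\<^sub>m j) $$ (a, b)"
  using nonneg_square_pow unfolding nonneg_square_def by blast

section \<open>Convergence and intertwining when \<open>G\<close> loses mass\<close>

text \<open>Multiplying \<open>\<alpha> A\<^sub>1 = \<alpha> (I - U)\<close> by \<open>N\<close> gives \<open>\<alpha> R = \<alpha>\<close>.\<close>

lemma R_pow_bounded_if_not_stochastic:
  assumes G1: "G *\<^sub>v ones m \<noteq> ones m"
  shows "\<exists>c\<ge>0. \<forall>j. \<forall>a<m. \<forall>b<m. (R ^\<^sub>m j) $$ (a, b) \<le> c"
proof -
  obtain \<alpha> where \<alpha>: "\<alpha> \<in> carrier_vec m" "\<And>a. a < m \<Longrightarrow> 0 < \<alpha> $ a"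
    "\<And>v. v \<in> carrier_vec m \<Longrightarrow> \<alpha> \<bullet> (Am *\<^sub>v v) + \<alpha> \<bullet> (A0 *\<^sub>v v) + \<alpha> \<bullet> (A1 *\<^sub>v v) = \<alpha> \<bullet> v"
    using invariant_phase_measure by blast
  have "\<alpha> \<bullet> (R *\<^sub>v v) = \<alpha> \<bullet> v" if v: "v \<in> carrier_vec m" for v
  proof -
    have "\<alpha> \<bullet> (R *\<^sub>v v) = \<alpha> \<bullet> (A1 *\<^sub>v (N *\<^sub>v v))"
      unfolding R_eq_A1_N using v by (simp add: assoc_mult_mat_vec[of _ m m _ m])
    also have "\<dots> = \<alpha> \<bullet> (N *\<^sub>v v) - \<alpha> \<bullet> (U *\<^sub>v (N *\<^sub>v v))"
      using drift_if_not_stochastic(1)[OF \<alpha> G1] by simp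
    also have "\<dots> = \<alpha> \<bullet> (N *\<^sub>v v - U *\<^sub>v (N *\<^sub>v v))"
      using \<alpha>(1) v by (simp add: scalar_prod_minus_distrib[of _ m])
    finally show ?thesis unfolding one_minus_U_N_mult_vec[OF v] .
  qed
  then show ?thesis by (intro pow_bounded_by_invariant_measure[OF R_nonneg \<alpha>(2)])
qed

text \<open>The series converges because the powers of \<open>G\<close> are summable and those of \<open>R\<close> are bounded. Column
  by column, \<open>green R\<^sup>r - Gh\<^sup>r green\<close> is a bounded harmonic sequence of the reversed walk that starts
  in \<open>0\<close>; as \<open>Gh\<close> is stochastic, it vanishes, in particular for \<open>r = 1\<close>.\<close>

lemma green_intertwines_if_not_stochastic:
  assumes G1: "G *\<^sub>v ones m \<noteq> ones m"
  shows "qbd_green m Am A0 A1 G Gh R" and "green * R = Gh * green"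
    and "mat_limit m (\<lambda>j. G ^\<^sub>m j) (0\<^sub>m m m)"
proof -
  show lim: "mat_limit m (\<lambda>j. G ^\<^sub>m j) (0\<^sub>m m m)"
    using G_pow_limit_or_stochastic G1 by blast
  obtain c where c: "0 \<le> c" "\<And>j a b. a < m \<Longrightarrow> b < m \<Longrightarrow> (R ^\<^sub>m j) $$ (a, b) \<le> c"
    using R_pow_bounded_if_not_stochastic[OF G1] by blast
  have "summable (\<lambda>j. green_term j $$ (a, b))" if "a < m" "b < m" for a b
    using that neumann_summable[OF G_nonneg lim] c(2)
    by (intro green_term_summable summable_mult_bounded[of _ _ c])
      (auto intro!: pow_nonneg_entries G_nonneg R_nonneg)
  then show Q: "qbd_green m Am A0 A1 G Gh R" by unfold_locales
  interpret qbd_green m Am A0 A1 G Gh R by (rule Q)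
  have Gh1: "Gh *\<^sub>v ones m = ones m" by (rule Gh_stochastic_if_G_not[OF G1])
  have "green * R - Gh * green = 0\<^sub>m m m"
  proof (rule mat_zero_if_columns_zero)
    fix b assume b: "b < m"
    define e where "e = (unit_vec m b :: real vec)"
    have e: "e \<in> carrier_vec m" unfolding e_def by simp
    define f where "f r = green *\<^sub>v (R ^\<^sub>m r *\<^sub>v e) - Gh ^\<^sub>m r *\<^sub>v (green *\<^sub>v e)" for r
    have fc: "f r \<in> carrier_vec m" for r unfolding f_def by simp
    have "f (Suc 0) = 0\<^sub>v m"
    proof (rule reversed.bounded_harmonic_zero[OF Gh1 fc])
      show "f 0 = 0\<^sub>v m" unfolding f_def using e by simp
      define ge where "ge = green *\<^sub>v e"
      have ge: "ge \<in> carrier_vec m" unfolding ge_def by simp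
      define g where "g = Max ((\<lambda>a. ge $ a) ` {..<m})"
      have nonneg_ge: "0 \<le> ge $ a" if "a < m" for a
        using that green_nonneg b unfolding ge_def e_def nonneg_square_def by simp
      have le_g: "ge $ a \<le> g" if "a < m" for a using that unfolding g_def by (intro Max_ge) auto
      have g0: "0 \<le> g" using nonneg_ge[of 0] le_g[of 0] m by simp
      have b1: "\<bar>(Gh ^\<^sub>m r *\<^sub>v ge) $ a\<bar> \<le> g" if "a < m" for r a
        using reversed.G_pow_nonneg_le[OF ge _ g0 that, of r] nonneg_ge le_g by auto
      define s where "s = (\<Sum>i<m. \<Sum>b<m. \<bar>green $$ (i, b)\<bar>)"
      have Re: "(R ^\<^sub>m r *\<^sub>v e) $ a = (R ^\<^sub>m r) $$ (a, b)" if "a < m" for r a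
        unfolding e_def using that b by (intro unit_vec_mult_entry) auto
      have b2: "\<bar>(green *\<^sub>v (R ^\<^sub>m r *\<^sub>v e)) $ a\<bar> \<le> s * c" if "a < m" for r a
        unfolding s_def
        using that b c pow_nonneg_entries[OF R_nonneg]
        by (intro mult_mat_vec_abs_le) (auto simp: Re simp del: index_mult_mat_vec)
      show "\<bar>f r $ a\<bar> \<le> s * c + g" if "a < m" for r a
        using b1[OF that, of r] b2[OF that, of r] that
        unfolding f_def ge_def by (simp del: index_mult_mat_vec)
      fix r
      define x where "x = Gh ^\<^sub>m r *\<^sub>v ge"
      have x: "x \<in> carrier_vec m" unfolding x_def by simp
      have fx: "f r = green *\<^sub>v (R ^\<^sub>m r *\<^sub>v e) - x"
        "f (Suc r) = green *\<^sub>v (R ^\<^sub>m Suc r *\<^sub>v e) - Gh *\<^sub>v x"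
        "f (Suc (Suc r)) = green *\<^sub>v (R ^\<^sub>m Suc (Suc r) *\<^sub>v e) - Gh *\<^sub>v (Gh *\<^sub>v x)"
        unfolding f_def x_def ge_def[symmetric] reversed.G_pow_mult_vec_Suc[OF ge] by simp_all
      show "A1 *\<^sub>v f r + A0 *\<^sub>v f (Suc r) + Am *\<^sub>v f (Suc (Suc r)) = f (Suc r)"
      proof (rule eq_vec_entriesI[of _ m])
        fix a assume a: "a < m"
        show "(A1 *\<^sub>v f r + A0 *\<^sub>v f (Suc r) + Am *\<^sub>v f (Suc (Suc r))) $ a = f (Suc r) $ a"
          using arg_cong[OF green_R_pow_harmonic[OF e, of r], of "\<lambda>v. v $ a"]
            arg_cong[OF reversed.G_mult_vec[OF x], of "\<lambda>v. v $ a"] a x unfolding fx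
          by (simp add: vec_simps del: index_mult_mat_vec pow_mat.simps)
      qed (auto simp: fc)
    qed
    then show "(green * R - Gh * green) *\<^sub>v unit_vec m b = 0\<^sub>v m"
      unfolding f_def e_def by (simp add: vec_simps)
  qed simp
  then show "green * R = Gh * green"
    by (rule mat_diff_zeroD[of _ m m, rotated 2]) simp_all
qed

section \<open>Convergence and intertwining when the powers of \<open>R\<close> vanish\<close>

text \<open>The defect \<open>e\<^sub>i = \<pi>\<^sub>i\<^sub>+\<^sub>1 (I - U) - \<pi>\<^sub>i A\<^sub>1\<close> satisfies \<open>e\<^sub>i = e\<^sub>i\<^sub>+\<^sub>1 G\<close>, hence \<open>e\<^sub>i = e\<^sub>i\<^sub>+\<^sub>j G\<^sup>j\<close> for all \<open>j\<close>.
  The powers of \<open>G\<close> are bounded and the measures of high levels tend to \<open>0\<close>.\<close>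

lemma stationary_geometric:
  fixes \<pi> :: "nat \<Rightarrow> real vec"
  assumes \<pi>: "\<And>i. \<pi> i \<in> carrier_vec m"
    and lim: "\<And>a. a < m \<Longrightarrow> (\<lambda>i. \<pi> i $ a) \<longlonglongrightarrow> 0"
    and bal: "\<And>i v. v \<in> carrier_vec m \<Longrightarrow>
      \<pi> i \<bullet> (A1 *\<^sub>v v) + \<pi> (Suc i) \<bullet> (A0 *\<^sub>v v) + \<pi> (Suc (Suc i)) \<bullet> (Am *\<^sub>v v) = \<pi> (Suc i) \<bullet> v"
    and v: "v \<in> carrier_vec m"
  shows "\<pi> (Suc i) \<bullet> v = \<pi> i \<bullet> (R *\<^sub>v v)"
proof -
  note sp = scalar_prod_add_distrib[of _ m] scalar_prod_minus_distrib[of _ m]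
  define e where "e i v = \<pi> (Suc i) \<bullet> ((1\<^sub>m m - U) *\<^sub>v v) - \<pi> i \<bullet> (A1 *\<^sub>v v)" for i and v :: "real vec"
  have step: "e i v = e (Suc i) (G *\<^sub>v v)" if v: "v \<in> carrier_vec m" for i v
  proof -
    have 1: "(1\<^sub>m m - U) *\<^sub>v (G *\<^sub>v v) = Am *\<^sub>v v"
      using v arg_cong[OF one_minus_U_G, of "\<lambda>X. X *\<^sub>v v"] by (simp add: assoc_mult_mat_vec[of _ m m _ m])
    show ?thesis unfolding e_def 1 using bal[OF v, of i] v \<pi>
      by (simp add: vec_simps sp U_mult_vec)
  qed
  have steps: "e i v = e (i + j) (G ^\<^sub>m j *\<^sub>v v)" if v: "v \<in> carrier_vec m" for i j v
  proof (induction j)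
    case 0 then show ?case using v by simp
  next
    case (Suc j)
    then show ?case using v step[of "G ^\<^sub>m j *\<^sub>v v" "i + j"]
      by (simp add: G_pow_mult_vec_Suc del: pow_mat.simps)
  qed
  have e0: "e i v = 0" if v: "v \<in> carrier_vec m" for i v
  proof -
    define c where "c = (\<Sum>b<m. \<bar>v $ b\<bar>)"
    have bound: "\<bar>(G ^\<^sub>m j *\<^sub>v v) $ a\<bar> \<le> c" if a: "a < m" for j a
    proof -
      have "\<bar>(G ^\<^sub>m j *\<^sub>v v) $ a\<bar> \<le> (\<Sum>b<m. \<bar>(G ^\<^sub>m j) $$ (a, b) * v $ b\<bar>)"
        using v a by (subst mult_mat_vec_entry[of _ m m]) auto
      also have "\<dots> \<le> (\<Sum>b<m. 1 * \<bar>v $ b\<bar>)"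
        using G_pow_entry_le[OF a] pow_nonneg_entries[OF G_nonneg a]
        by (intro sum_mono) (auto simp: abs_mult intro!: mult_left_le_one_le)
      finally show ?thesis unfolding c_def by simp
    qed
    have s1: "(\<lambda>j. \<pi> (Suc (i + j)) $ a) \<longlonglongrightarrow> 0" if "a < m" for a
      using LIMSEQ_ignore_initial_segment[OF lim[OF that], of "Suc i"] by (simp add: add.commute)
    have s2: "(\<lambda>j. \<pi> (i + j) $ a) \<longlonglongrightarrow> 0" if "a < m" for a
      using LIMSEQ_ignore_initial_segment[OF lim[OF that], of i] by (simp add: add.commute)
    have "(\<lambda>j. e (i + j) (G ^\<^sub>m j *\<^sub>v v)) \<longlonglongrightarrow> 0 - 0"
      unfolding e_def
    proof (rule tendsto_diff)
      show "(\<lambda>j. \<pi> (Suc (i + j)) \<bullet> ((1\<^sub>m m - U) *\<^sub>v (G ^\<^sub>m j *\<^sub>v v))) \<longlonglongrightarrow> 0"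
        by (rule tendsto_zero_bounded_scalar_prod[OF s1 _ mult_mat_vec_abs_le[OF _ _ bound]]) auto
      show "(\<lambda>j. \<pi> (i + j) \<bullet> (A1 *\<^sub>v (G ^\<^sub>m j *\<^sub>v v))) \<longlonglongrightarrow> 0"
        by (rule tendsto_zero_bounded_scalar_prod[OF s2 _ mult_mat_vec_abs_le[OF _ _ bound]]) auto
    qed
    then show ?thesis using steps[OF v, of i] by (simp add: LIMSEQ_const_iff)
  qed
  have Nv: "v = (1\<^sub>m m - U) *\<^sub>v (N *\<^sub>v v)"
    using one_minus_U_N_mult_vec[OF v] by (simp add: one_minus_U_mult_vec)
  have "A1 *\<^sub>v (N *\<^sub>v v) = R *\<^sub>v v"
    unfolding R_eq_A1_N using v by (simp add: assoc_mult_mat_vec[of _ m m _ m])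
  then show ?thesis using e0[of "N *\<^sub>v v" i] Nv unfolding e_def by simp
qed

text \<open>Superharmonicity gives \<open>Gh\<^sup>r green 1 \<le> green R\<^sup>r 1\<close>, which tends to \<open>0\<close>, whereas \<open>green 1 \<ge> 1\<close>. So
  \<open>Gh\<close> loses mass, and the invariant measure of the phases is invariant for \<open>Rh\<close>, the counterpart
  of \<open>R\<close> for the reversed walk, whose powers are therefore bounded. The product \<open>C'\<close> of the
  difference with the invertible matrix \<open>I - U\<close> of the reversed walk satisfies \<open>C' = Rh\<^sup>j C' R\<^sup>j\<close> for
  all \<open>j\<close> and hence vanishes.\<close>

lemma green_intertwines_if_R_vanishes:
  assumes lim: "mat_limit m (\<lambda>j. R ^\<^sub>m j) (0\<^sub>m m m)"
  shows "qbd_green m Am A0 A1 G Gh R" and "green * R = Gh * green"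
proof -
  have "summable (\<lambda>j. green_term j $$ (a, b))" if ab: "a < m" "b < m" for a b
  proof (rule green_term_summable[OF _ ab])
    fix a k l b assume *: "a < m" "k < m" "l < m" "b < m"
    have "summable (\<lambda>j. (R ^\<^sub>m j) $$ (l, b) * (G ^\<^sub>m j) $$ (a, k))"
      using * neumann_summable[OF R_nonneg lim] G_pow_entry_le
      by (intro summable_mult_bounded[of _ _ 1]) (auto intro!: pow_nonneg_entries G_nonneg R_nonneg)
    then show "summable (\<lambda>j. (G ^\<^sub>m j) $$ (a, k) * (R ^\<^sub>m j) $$ (l, b))" by (simp add: mult.commute)
  qed
  then show Q: "qbd_green m Am A0 A1 G Gh R" by unfold_locales
  interpret qbd_green m Am A0 A1 G Gh R by (rule Q)
  have green_ones: "1 \<le> (green *\<^sub>v ones m) $ a" if a: "a < m" for a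
  proof -
    have "green *\<^sub>v ones m = N *\<^sub>v ones m + G *\<^sub>v (green *\<^sub>v (R *\<^sub>v ones m))"
      using arg_cong[OF green_eq, of "\<lambda>X. X *\<^sub>v ones m"] by (simp add: vec_simps)
    moreover have "0 \<le> (G *\<^sub>v (green *\<^sub>v (R *\<^sub>v ones m))) $ a"
      using a by (intro mult_mat_vec_nonneg[of m] G_nonneg green_nonneg R_nonneg) auto
    moreover have "1 \<le> (N *\<^sub>v ones m) $ a"
    proof -
      from arg_cong[OF one_minus_U_N_mult_vec[of "ones m"], of "\<lambda>x. x $ a"]
      have "(N *\<^sub>v ones m) $ a = 1 + (U *\<^sub>v (N *\<^sub>v ones m)) $ a"
        using a by (simp del: index_mult_mat_vec)
      moreover have "0 \<le> (U *\<^sub>v (N *\<^sub>v ones m)) $ a"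
        using a by (intro mult_mat_vec_nonneg[of m] U_nonneg N_nonneg) auto
      ultimately show ?thesis by simp
    qed
    ultimately show ?thesis using a by (simp del: index_mult_mat_vec)
  qed
  have Gh1: "Gh *\<^sub>v ones m \<noteq> ones m"
  proof
    assume Gh1: "Gh *\<^sub>v ones m = ones m"
    have "1 \<le> (green *\<^sub>v (R ^\<^sub>m r *\<^sub>v ones m)) $ a" if a: "a < m" for r a
    proof -
      have "1 = (Gh ^\<^sub>m r *\<^sub>v ones m) $ a"
        using a pow_fixed_vec[of Gh m "ones m" r, OF _ _ Gh1] by simp
      also have "\<dots> \<le> (Gh ^\<^sub>m r *\<^sub>v (green *\<^sub>v ones m)) $ a"
        using a green_ones
        by (intro mult_mat_vec_mono[of m] nonneg_square_pow reversed.G_nonneg) (auto simp del: index_mult_mat_vec)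
      also have "green *\<^sub>v ones m = green *\<^sub>v (R ^\<^sub>m 0 *\<^sub>v ones m)" by simp
      also have "(Gh ^\<^sub>m r *\<^sub>v \<dots>) $ a \<le> (green *\<^sub>v (R ^\<^sub>m r *\<^sub>v ones m)) $ a"
      proof (rule reversed.superharmonic_ge_G_pow[OF _ _ _ a, where h = "\<lambda>r. green *\<^sub>v (R ^\<^sub>m r *\<^sub>v ones m)"])
        fix r a assume a: "a < m"
        show "0 \<le> (green *\<^sub>v (R ^\<^sub>m r *\<^sub>v ones m)) $ a"
          using a by (intro mult_mat_vec_nonneg[of m] green_nonneg nonneg_square_pow R_nonneg) auto
        show "(A1 *\<^sub>v (green *\<^sub>v (R ^\<^sub>m r *\<^sub>v ones m))) $ a
            + (A0 *\<^sub>v (green *\<^sub>v (R ^\<^sub>m Suc r *\<^sub>v ones m))) $ a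
            + (Am *\<^sub>v (green *\<^sub>v (R ^\<^sub>m Suc (Suc r) *\<^sub>v ones m))) $ a
            \<le> (green *\<^sub>v (R ^\<^sub>m Suc r *\<^sub>v ones m)) $ a"
          using arg_cong[OF green_R_pow_harmonic[of "ones m" r], of "\<lambda>x. x $ a"] a
          by (simp del: index_mult_mat_vec pow_mat.simps)
      qed simp
      finally show ?thesis .
    qed
    moreover have "(\<lambda>r. (green *\<^sub>v (R ^\<^sub>m r *\<^sub>v ones m)) $ 0) \<longlonglongrightarrow> (green *\<^sub>v (0\<^sub>m m m *\<^sub>v ones m)) $ 0"
      using m by (intro const_mult_mat_vec_limit[of _ m] mult_mat_vec_limit[OF lim]) auto
    moreover have "(green *\<^sub>v (0\<^sub>m m m *\<^sub>v ones m)) $ 0 = 0"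
    proof -
      have "0\<^sub>m m m *\<^sub>v ones m = (0\<^sub>v m :: real vec)" by (intro eq_vec_entriesI[of _ m]) auto
      then show ?thesis using m by (simp add: mult_mat_vec_entry[of _ m m] del: index_mult_mat_vec)
    qed
    ultimately have "(\<lambda>r. (green *\<^sub>v (R ^\<^sub>m r *\<^sub>v ones m)) $ 0) \<longlonglongrightarrow> 0"
      and "\<And>r. 1 \<le> (green *\<^sub>v (R ^\<^sub>m r *\<^sub>v ones m)) $ 0"
      using m by auto
    then have "1 \<le> (0 :: real)" by (intro LIMSEQ_le_const) auto
    then show False by simp
  qed
  obtain \<alpha> where \<alpha>: "\<alpha> \<in> carrier_vec m" "\<And>a. a < m \<Longrightarrow> 0 < \<alpha> $ a"
    "\<And>v. v \<in> carrier_vec m \<Longrightarrow> \<alpha> \<bullet> (A1 *\<^sub>v v) + \<alpha> \<bullet> (A0 *\<^sub>v v) + \<alpha> \<bullet> (Am *\<^sub>v v) = \<alpha> \<bullet> v"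
    using reversed.invariant_phase_measure by blast
  define Rh where "Rh = Am * reversed.N"
  have Rh: "nonneg_square m Rh" unfolding Rh_def by (intro nonneg_square_mult D reversed.N_nonneg)
  have Rhc [simp]: "Rh \<in> carrier_mat m m" using nonneg_squareD[OF Rh] .
  have "\<alpha> \<bullet> (Rh *\<^sub>v v) = \<alpha> \<bullet> v" if v: "v \<in> carrier_vec m" for v
  proof -
    have "\<alpha> \<bullet> (Rh *\<^sub>v v) = \<alpha> \<bullet> (Am *\<^sub>v (reversed.N *\<^sub>v v))"
      unfolding Rh_def using v by (simp add: assoc_mult_mat_vec[of _ m m _ m])
    also have "\<dots> = \<alpha> \<bullet> (reversed.N *\<^sub>v v) - \<alpha> \<bullet> (reversed.U *\<^sub>v (reversed.N *\<^sub>v v))"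
      using reversed.drift_if_not_stochastic(1)[OF \<alpha> Gh1] by simp
    also have "\<dots> = \<alpha> \<bullet> (reversed.N *\<^sub>v v - reversed.U *\<^sub>v (reversed.N *\<^sub>v v))"
      using \<alpha>(1) v by (simp add: scalar_prod_minus_distrib[of _ m])
    finally show ?thesis unfolding reversed.one_minus_U_N_mult_vec[OF v] .
  qed
  then obtain c where c: "0 \<le> c" "\<And>j a b. a < m \<Longrightarrow> b < m \<Longrightarrow> (Rh ^\<^sub>m j) $$ (a, b) \<le> c"
    using pow_bounded_by_invariant_measure[OF Rh \<alpha>(2)] by blast
  define C where "C = green * R - Gh * green"
  have Cc [simp]: "C \<in> carrier_mat m m" unfolding C_def by simp
  define C' where "C' = (1\<^sub>m m - reversed.U) * C"
  have C'c [simp]: "C' \<in> carrier_mat m m" unfolding C'_def by simp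
  have NC': "reversed.N * C' = C"
    unfolding C'_def using left_mult_one_mat[OF Cc]
    by (simp add: assoc_mult_mat[symmetric, of _ m m _ m _ m] reversed.N_inverse)
  have C'eq: "C' = Rh * C' * R"
  proof -
    have "C' = Am * C * R" unfolding C'_def C_def by (rule commutator_eq)
    also have "\<dots> = Rh * C' * R"
      unfolding NC'[symmetric] Rh_def by (simp add: assoc_mult_mat[of _ m m _ m _ m])
    finally show ?thesis .
  qed
  have C'pow: "C' = Rh ^\<^sub>m j * (C' * R ^\<^sub>m j)" for j
  proof (induction j)
    case 0
    have "dim_row Rh = m" using nonneg_squareD[OF Rh] by blast
    then show ?case using left_mult_one_mat[OF C'c] right_mult_one_mat[OF C'c] by simp
  next
    case (Suc j)
    have "Rh ^\<^sub>m Suc j * (C' * R ^\<^sub>m Suc j) = Rh ^\<^sub>m j * ((Rh * C' * R) * R ^\<^sub>m j)"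
      by (simp add: pow_mat_Suc_left[of R m] pow_mat.simps(2)[of Rh] assoc_mult_mat[of _ m m _ m _ m] del: pow_mat.simps(2))
    then show ?case using Suc C'eq by simp
  qed
  have "C' = 0\<^sub>m m m"
  proof (rule eq_mat_entriesI[of _ m m])
    fix a b assume ab: "a < m" "b < m"
    have "mat_limit m (\<lambda>j. C' * R ^\<^sub>m j) (C' * 0\<^sub>m m m)"
      by (intro mat_limit_mult mat_limit_const lim) auto
    moreover have "C' * 0\<^sub>m m m = 0\<^sub>m m m" by (rule right_mult_zero_mat) simp
    ultimately have Clim: "(\<lambda>j. (C' * R ^\<^sub>m j) $$ (i, b)) \<longlonglongrightarrow> 0" if "i < m" for i
      using ab that unfolding mat_limit_def by (simp del: index_mult_mat)
    have "(\<lambda>j. (Rh ^\<^sub>m j) $$ (a, i) * (C' * R ^\<^sub>m j) $$ (i, b)) \<longlonglongrightarrow> 0" if i: "i < m" for i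
    proof (rule tendsto_0_le[OF Clim[OF i], of _ c])
      show "\<forall>\<^sub>F j in sequentially. norm ((Rh ^\<^sub>m j) $$ (a, i) * (C' * R ^\<^sub>m j) $$ (i, b))
          \<le> norm ((C' * R ^\<^sub>m j) $$ (i, b)) * c"
        using c(2)[OF ab(1) i] pow_nonneg_entries[OF Rh ab(1) i]
        by (auto simp: abs_mult mult.commute[of _ c] simp del: index_mult_mat(1) intro!: mult_right_mono always_eventually)
    qed
    then have "(\<lambda>j. \<Sum>i<m. (Rh ^\<^sub>m j) $$ (a, i) * (C' * R ^\<^sub>m j) $$ (i, b)) \<longlonglongrightarrow> (\<Sum>i<m. 0)"
      by (intro tendsto_sum) auto
    moreover have "(\<Sum>i<m. (Rh ^\<^sub>m j) $$ (a, i) * (C' * R ^\<^sub>m j) $$ (i, b)) = C' $$ (a, b)" for j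
      using ab arg_cong[OF C'pow[of j], of "\<lambda>X. X $$ (a, b)"]
      by (subst mult_mat_entry[symmetric, of _ m m _ m]) auto
    ultimately show "C' $$ (a, b) = 0\<^sub>m m m $$ (a, b)" using ab by (simp add: LIMSEQ_const_iff)
  qed auto
  then have "C = 0\<^sub>m m m" using NC' by (simp add: right_mult_zero_mat[of _ m m])
  then show "green * R = Gh * green" unfolding C_def
    by (rule mat_diff_zeroD[of _ m m, rotated 2]) simp_all
qed

end

section \<open>The chain on the half line\<close>

lemma qbd_states_iff [simp]: "(i, a) \<in> qbd_states m \<longleftrightarrow> a < m"
  by (simp add: qbd_states_def)

definition neighbours :: "nat \<Rightarrow> nat \<times> nat \<Rightarrow> (nat \<times> nat) set" where
  "neighbours m s = {fst s - 1..Suc (fst s)} \<times> {..<m}"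

lemma neighbours_facts:
  "finite (neighbours m s)" "neighbours m s \<subseteq> qbd_states m"
  "t \<in> qbd_states m - neighbours m s \<Longrightarrow> qbd B Am A0 A1 s t = 0"
  "t \<in> qbd_states m - neighbours m s \<Longrightarrow> qbd B Am A0 A1 t s = 0"
  by (auto simp: neighbours_def qbd_states_def qbd_def split: prod.splits)

lemma neighbour_in_states: "t \<in> neighbours m s \<Longrightarrow> t \<in> qbd_states m"
  using neighbours_facts(2) by blast

lemma atLeastAtMost_three: "{q..Suc (Suc q)} = {q, Suc q, Suc (Suc q)}"
  by auto

lemma qbd_row_sum_0:
  fixes f :: "nat \<times> nat \<Rightarrow> 'a :: real_normed_field"
  shows "(\<Sum>t\<in>neighbours m (0, a). of_real (qbd B Am A0 A1 (0, a) t) * f t) =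
    (\<Sum>b<m. of_real (B $$ (a, b)) * f (0, b)) + (\<Sum>b<m. of_real (A1 $$ (a, b)) * f (1, b))"
proof -
  have "{0 - 1..Suc 0} = {0, Suc 0}" by auto
  then show ?thesis
    unfolding neighbours_def by (simp add: sum.cartesian_product' qbd_def)
qed

lemma qbd_row_sum_Suc:
  fixes f :: "nat \<times> nat \<Rightarrow> 'a :: real_normed_field"
  shows "(\<Sum>t\<in>neighbours m (Suc i, a). of_real (qbd B Am A0 A1 (Suc i, a) t) * f t) =
    (\<Sum>b<m. of_real (Am $$ (a, b)) * f (i, b)) + (\<Sum>b<m. of_real (A0 $$ (a, b)) * f (Suc i, b))
    + (\<Sum>b<m. of_real (A1 $$ (a, b)) * f (Suc (Suc i), b))"
  unfolding neighbours_def
  by (simp add: sum.cartesian_product' qbd_def atLeastAtMost_three add.assoc)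

lemma qbd_column_sum_0:
  "(\<Sum>s\<in>neighbours m (0, b). f s * qbd B Am A0 A1 s (0, b)) =
    (\<Sum>a<m. f (0, a) * B $$ (a, b)) + (\<Sum>a<m. f (1, a) * Am $$ (a, b))"
proof -
  have "{0 - 1..Suc 0} = {0, Suc 0}" by auto
  then show ?thesis
    unfolding neighbours_def by (simp add: sum.cartesian_product' qbd_def)
qed

lemma qbd_column_sum_Suc:
  "(\<Sum>s\<in>neighbours m (Suc i, b). f s * qbd B Am A0 A1 s (Suc i, b)) =
    (\<Sum>a<m. f (i, a) * A1 $$ (a, b)) + (\<Sum>a<m. f (Suc i, a) * A0 $$ (a, b))
    + (\<Sum>a<m. f (Suc (Suc i), a) * Am $$ (a, b))"
  unfolding neighbours_def
  by (simp add: sum.cartesian_product' qbd_def atLeastAtMost_three add.assoc)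

lemma qbd_row_has_sum:
  fixes f :: "nat \<times> nat \<Rightarrow> 'a :: real_normed_field"
  shows "((\<lambda>t. of_real (qbd B Am A0 A1 s t) * f t) has_sum
    (\<Sum>t\<in>neighbours m s. of_real (qbd B Am A0 A1 s t) * f t)) (qbd_states m)"
  using neighbours_facts by (intro has_sum_finite_neutralI[of "neighbours m s"]) auto

lemma qbd_column_has_sum:
  fixes f :: "nat \<times> nat \<Rightarrow> real"
  shows "((\<lambda>s. f s * qbd B Am A0 A1 s t) has_sum
    (\<Sum>s\<in>neighbours m t. f s * qbd B Am A0 A1 s t)) (qbd_states m)"
  using neighbours_facts by (intro has_sum_finite_neutralI[of "neighbours m t"]) auto

lemma phase_maximum_if_irreducible:
  assumes A: "nonneg_square m A" "\<And>a. a < m \<Longrightarrow> (A *\<^sub>v ones m) $ a = 1"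
    and irr: "irreducible_on {..<m} (\<lambda>i j. A $$ (i, j))"
    and v: "v \<in> carrier_vec m" "\<And>a. a < m \<Longrightarrow> v $ a \<le> c" "\<And>a. a < m \<Longrightarrow> v $ a \<le> (A *\<^sub>v v) $ a"
    and a: "a < m" "v $ a = c" and b: "b < m"
  shows "v $ b = c"
proof (rule maximum_principle[where S = "{..<m}" and T = "\<lambda>_. {..<m}" and K = "\<lambda>i j. A $$ (i, j)"
      and f = "\<lambda>a. v $ a"])
  have Ac: "A \<in> carrier_mat m m" using nonneg_squareD[OF A(1)] .
  show "(\<Sum>t\<in>{..<m}. A $$ (s, t)) = 1" if "s \<in> {..<m}" for s
    using that A(2)[of s] Ac by (simp add: mult_mat_vec_entry[of A m m] del: index_mult_mat_vec)
  show "v $ s \<le> (\<Sum>t\<in>{..<m}. A $$ (s, t) * v $ t)" if "s \<in> {..<m}" for s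
    using that v(1) v(3)[of s] Ac by (simp add: mult_mat_vec_entry[of A m m] del: index_mult_mat_vec)
  show "reachable_on {..<m} (\<lambda>i j. A $$ (i, j)) a b"
    using irr a b unfolding irreducible_on_def by auto
qed (use A v a in \<open>auto simp: nonneg_square_def\<close>)

text \<open>Every state leads into the final class, which contains every level of each of its phases.\<close>

lemma two_sided_maximum_if_final_class:
  assumes nn: "nonneg_square m Am" "nonneg_square m A0" "nonneg_square m A1"
    and total: "\<And>a. a < m \<Longrightarrow> (Am *\<^sub>v ones m) $ a + (A0 *\<^sub>v ones m) $ a + (A1 *\<^sub>v ones m) $ a = 1"
    and final: "unique_final_class m Am A0 A1"
    and F: "\<And>i. F i \<in> carrier_vec m" "\<And>i a. a < m \<Longrightarrow> F i $ a \<le> c"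
      "\<And>i a. a < m \<Longrightarrow> F i $ a \<le> (Am *\<^sub>v F (i - 1)) $ a + (A0 *\<^sub>v F i) $ a + (A1 *\<^sub>v F (i + 1)) $ a"
    and a: "a < m" "F (i :: int) $ a = c"
  shows "\<exists>b<m. \<forall>k. F k $ b = c"
proof -
  let ?S = "UNIV \<times> {..<m} :: (int \<times> nat) set"
  let ?K = "bi_qbd Am A0 A1"
  let ?nb = "\<lambda>s. {fst s - 1, fst s, fst s + 1} \<times> {..<m}"
  note c = nonneg_squareD[OF nn(1)] nonneg_squareD[OF nn(2)] nonneg_squareD[OF nn(3)]
  have row: "(\<Sum>t\<in>?nb (i, a). ?K (i, a) t * (F (fst t) $ snd t)) =
      (Am *\<^sub>v F (i - 1)) $ a + (A0 *\<^sub>v F i) $ a + (A1 *\<^sub>v F (i + 1)) $ a"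
    if "\<And>i. F i \<in> carrier_vec m" "a < m" for i a and F :: "int \<Rightarrow> real vec"
    using that c
    by (simp add: sum.cartesian_product' mult_mat_vec_entry[of _ m m] bi_qbd_def del: index_mult_mat_vec)
  have max: "F (fst t) $ snd t = c" if "reachable_on ?S ?K s t" "F (fst s) $ snd s = c" for s t
  proof (rule maximum_principle[where S = ?S and T = ?nb and K = ?K and f = "\<lambda>t. F (fst t) $ snd t" and s = s])
    fix s assume s: "s \<in> ?S"
    obtain i a where [simp]: "s = (i, a)" by (cases s)
    have a: "a < m" using s by simp
    have "?K s t = 0" if "t \<in> ?S - ?nb s" for t
      using that by (cases t) (auto simp: bi_qbd_def)
    then show "finite (?nb s) \<and> ?nb s \<subseteq> ?S \<and> (\<forall>t\<in>?S - ?nb s. ?K s t = 0)"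
      by auto
    show "F (fst s) $ snd s \<le> (\<Sum>t\<in>?nb s. ?K s t * (F (fst t) $ snd t))"
      using row[of F, OF F(1) a] F(3)[OF a] by simp
    have "(\<Sum>t\<in>?nb s. ?K s t) = (\<Sum>t\<in>?nb (i, a). ?K (i, a) t * ((\<lambda>_. ones m) (fst t) $ snd t))"
      by (intro sum.cong) auto
    then show "(\<Sum>t\<in>?nb s. ?K s t) = 1"
      using row[of "\<lambda>_. ones m", OF _ a] total[OF a] by simp
    show "0 \<le> ?K s t" if "t \<in> ?nb s" for t
    proof -
      obtain j b where "t = (j, b)" by (cases t)
      moreover from this have "b < m" using that by simp
      ultimately show ?thesis using nn a unfolding nonneg_square_def bi_qbd_def by simp
    qed
    show "F (fst s) $ snd s \<le> c" using F(2) a by simp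
  qed (fact that)+
  obtain E where E: "E \<noteq> {}" "E \<subseteq> {..<m}"
    "{C. final_class_on ?S ?K C} = {UNIV \<times> E}"
    "\<forall>s\<in>?S. \<exists>t\<in>UNIV \<times> E. reachable_on ?S ?K s t"
    using final unfolding unique_final_class_def by (elim exE conjE)
  have "final_class_on ?S ?K (UNIV \<times> E)" using E(3) by blast
  then have fc: "\<And>s t. s \<in> UNIV \<times> E \<Longrightarrow> t \<in> UNIV \<times> E \<Longrightarrow> reachable_on ?S ?K s t"
    using E(2) unfolding final_class_on_def by blast
  obtain t where t: "t \<in> UNIV \<times> E" "reachable_on ?S ?K (i, a) t" using bspec[OF E(4), of "(i, a)"] a by blast
  have 1: "F (fst t) $ snd t = c" using max[OF t(2)] a by simp
  have "F k $ snd t = c" for k using max[OF fc[OF t(1), of "(k, snd t)"] 1] t(1) by auto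
  then show ?thesis using t(1) E(2) by auto
qed

locale qbd_chain =
  fixes m :: nat and B Am A0 A1 :: "real mat"
  assumes m: "1 \<le> m"
    and nn: "nonneg_square m B" "nonneg_square m Am" "nonneg_square m A0" "nonneg_square m A1"
    and stochastic: "stochastic_on (qbd_states m) (qbd B Am A0 A1)"
    and irreducible: "irreducible_on (qbd_states m) (qbd B Am A0 A1)"
begin

abbreviation P :: "nat \<times> nat \<Rightarrow> nat \<times> nat \<Rightarrow> real" where
  "P \<equiv> qbd B Am A0 A1"

lemma block_carriers [simp]: "B \<in> carrier_mat m m" "Am \<in> carrier_mat m m" "A0 \<in> carrier_mat m m" "A1 \<in> carrier_mat m m"
  using nn nonneg_squareD by blast+

lemma block_dims [simp]:
  "dim_row B = m" "dim_col B = m" "dim_row Am = m" "dim_col Am = m"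
  "dim_row A0 = m" "dim_col A0 = m" "dim_row A1 = m" "dim_col A1 = m"
  using block_carriers by (auto simp del: block_carriers)

lemma P_nonneg: "s \<in> qbd_states m \<Longrightarrow> t \<in> qbd_states m \<Longrightarrow> 0 \<le> P s t"
  using stochastic unfolding stochastic_on_def by blast

lemma P_row_total: 
  assumes "s \<in> qbd_states m"
  shows "(\<Sum>t\<in>neighbours m s. P s t) = 1"
proof -
  have "(P s has_sum 1) (qbd_states m)" using assms stochastic unfolding stochastic_on_def by auto
  moreover have "(P s has_sum (\<Sum>t\<in>neighbours m s. P s t)) (qbd_states m)"
    using qbd_row_has_sum[where 'a = real and f = "\<lambda>_. 1"] by simp
  ultimately show ?thesis by (rule has_sum_unique[symmetric])
qed

lemma row_vec_sum_0:
  assumes "\<And>r. F r \<in> carrier_vec m" "a < m"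
  shows "(\<Sum>t\<in>neighbours m (0, a). P (0, a) t * (F (fst t) $ snd t)) = (B *\<^sub>v F 0) $ a + (A1 *\<^sub>v F 1) $ a"
  using qbd_row_sum_0[where 'a = real and f = "\<lambda>t. F (fst t) $ snd t"] assms
  by (simp add: mult_mat_vec_entry[of _ m m] del: index_mult_mat_vec)

lemma row_vec_sum_Suc:
  assumes "\<And>r. F r \<in> carrier_vec m" "a < m"
  shows "(\<Sum>t\<in>neighbours m (Suc r, a). P (Suc r, a) t * (F (fst t) $ snd t)) =
    (Am *\<^sub>v F r) $ a + (A0 *\<^sub>v F (Suc r)) $ a + (A1 *\<^sub>v F (Suc (Suc r))) $ a"
  using qbd_row_sum_Suc[where 'a = real and f = "\<lambda>t. F (fst t) $ snd t"] assms
  by (simp add: mult_mat_vec_entry[of _ m m] del: index_mult_mat_vec)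

lemma row_total_ones:
  assumes a: "a < m"
  shows "(\<Sum>t\<in>neighbours m (r, a). P (r, a) t * ((\<lambda>_. ones m) (fst t) $ snd t)) = 1"
proof -
  have "(\<Sum>t\<in>neighbours m (r, a). P (r, a) t * ((\<lambda>_. ones m) (fst t) $ snd t)) = (\<Sum>t\<in>neighbours m (r, a). P (r, a) t)"
    by (intro sum.cong) (auto simp: neighbours_def)
  then show ?thesis using P_row_total[of "(r, a)"] a by simp
qed

lemma total_0: "a < m \<Longrightarrow> (B *\<^sub>v ones m) $ a + (A1 *\<^sub>v ones m) $ a = 1"
  using row_vec_sum_0[of "\<lambda>_. ones m" a] row_total_ones[of a 0] by simp

lemma total_Suc: "a < m \<Longrightarrow> (Am *\<^sub>v ones m) $ a + (A0 *\<^sub>v ones m) $ a + (A1 *\<^sub>v ones m) $ a = 1"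
  using row_vec_sum_Suc[of "\<lambda>_. ones m" a 0] row_total_ones[of a "Suc 0"] by simp

lemma chain_maximum:
  assumes F: "\<And>r. F r \<in> carrier_vec m" "\<And>r a. a < m \<Longrightarrow> F r $ a \<le> c"
    and sub: "\<And>a. a < m \<Longrightarrow> F 0 $ a \<le> (B *\<^sub>v F 0) $ a + (A1 *\<^sub>v F 1) $ a"
      "\<And>r a. a < m \<Longrightarrow>
        F (Suc r) $ a \<le> (Am *\<^sub>v F r) $ a + (A0 *\<^sub>v F (Suc r)) $ a + (A1 *\<^sub>v F (Suc (Suc r))) $ a"
    and a: "a < m" "F i $ a = c" and b: "b < m"
  shows "F j $ b = c"
proof -
  have "F (fst (j, b)) $ snd (j, b) = c"
  proof (rule maximum_principle[where S = "qbd_states m" and T = "neighbours m" and K = P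
      and f = "\<lambda>t. F (fst t) $ snd t" and s = "(i, a)"])
    fix s assume s: "s \<in> qbd_states m"
    show "finite (neighbours m s) \<and> neighbours m s \<subseteq> qbd_states m \<and>
        (\<forall>t\<in>qbd_states m - neighbours m s. P s t = 0)"
      using neighbours_facts by blast
    show "(\<Sum>t\<in>neighbours m s. P s t) = 1" by (rule P_row_total[OF s])
    show "0 \<le> P s t" if "t \<in> neighbours m s" for t
      using P_nonneg[OF s] that neighbours_facts(2) by blast
    obtain r a where [simp]: "s = (r, a)" by (cases s)
    have a: "a < m" using s by simp
    show "F (fst s) $ snd s \<le> (\<Sum>t\<in>neighbours m s. P s t * (F (fst t) $ snd t))"
      using row_vec_sum_0[of F, OF F(1) a] row_vec_sum_Suc[of F, OF F(1) a] sub a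
      by (cases r) auto
    show "F (fst s) $ snd s \<le> c" using F(2) a by simp
  next
    show "reachable_on (qbd_states m) P (i, a) (j, b)"
      using irreducible a b unfolding irreducible_on_def by simp
  qed (use a in auto)
  then show ?thesis by simp
qed

end

locale qbd_process = qbd_chain m B Am A0 A1 + qbd_core m Am A0 A1 G Gh R
  for m :: nat and B Am A0 A1 G Gh R :: "real mat"
begin

text \<open>If \<open>G\<close> is stochastic then level \<open>0\<close> is certain to be visited from everywhere, so a
  nonnegative superharmonic function attains its minimum on that finite level and is constant.
  The probability of ever hitting a given state is such a function.\<close>

lemma recurrent_if_stochastic:
  assumes G1: "G *\<^sub>v ones m = ones m"
  shows "recurrent_chain (qbd_states m) P"
  unfolding recurrent_chain_def
proof
  fix s assume s: "s \<in> qbd_states m"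
  define p where "p n t = first_passage (qbd_states m) P n t s" for n t
  have p0: "p 0 t = 0" and p1: "p (Suc 0) t = P t s" for t by (simp_all add: p_def)
  have pSS: "p (Suc (Suc n)) t = (\<Sum>k\<in>neighbours m t - {s}. P t k * p (Suc n) k)" for n t
    unfolding p_def first_passage.simps
  proof (intro infsumI has_sum_finite_neutralI[of "neighbours m t - {s}"])
    show "P t k * first_passage (qbd_states m) P (Suc n) k s = 0"
      if "k \<in> qbd_states m - {s} - (neighbours m t - {s})" for k
      using that neighbours_facts(3)[of k m t B Am A0 A1] by auto
  qed (use neighbours_facts(1)[of m t] neighbours_facts(2)[of m t] in auto)
  define f where "f n t = (\<Sum>i<n. p i t)" for n t
  have fS: "f (Suc (Suc n)) t = P t s + (\<Sum>k\<in>neighbours m t - {s}. P t k * f (Suc n) k)" for n t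
  proof -
    have "f (Suc (Suc n)) t = P t s + (\<Sum>i<n. p (Suc (Suc i)) t)"
      unfolding f_def sum.lessThan_Suc_shift by (simp add: p0 p1)
    also have "(\<Sum>i<n. p (Suc (Suc i)) t) = (\<Sum>k\<in>neighbours m t - {s}. P t k * (\<Sum>i<n. p (Suc i) k))"
      unfolding pSS sum_distrib_left by (rule sum.swap)
    also have "(\<lambda>k. \<Sum>i<n. p (Suc i) k) = (\<lambda>k. f (Suc n) k)"
      unfolding f_def sum.lessThan_Suc_shift by (simp add: p0)
    finally show ?thesis by (simp add: fun_eq_iff)
  qed
  have split: "P t s + (\<Sum>k\<in>neighbours m t - {s}. P t k * x k) = (\<Sum>k\<in>neighbours m t. P t k * (if k = s then 1 else x k))"
    if "t \<in> qbd_states m" for t and x :: "nat \<times> nat \<Rightarrow> real"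
  proof (cases "s \<in> neighbours m t")
    case True
    then show ?thesis
      using neighbours_facts(1) by (simp add: sum.remove[of _ s])
  next
    case False
    then have "P t s = 0" using neighbours_facts(3) s by blast
    moreover have "neighbours m t - {s} = neighbours m t" using False by blast
    ultimately show ?thesis using False by (auto intro!: sum.cong)
  qed
  have bounds: "0 \<le> p n t" "f (Suc n) t \<le> 1" if "t \<in> qbd_states m" for n t
  proof -
    have "0 \<le> p (Suc n) t" if "t \<in> qbd_states m" for n t
      using that
    proof (induction n arbitrary: t)
      case 0 then show ?case using P_nonneg s by (simp add: p1)
    next
      case (Suc n)
      show ?case unfolding pSS
      proof (rule sum_nonneg)
        fix k assume "k \<in> neighbours m t - {s}"
        then have "k \<in> neighbours m t" by simp
        then have k: "k \<in> qbd_states m" by (rule neighbour_in_states)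
        show "0 \<le> P t k * p (Suc n) k"
          by (rule mult_nonneg_nonneg[OF P_nonneg[OF Suc.prems k] Suc.IH[OF k]])
      qed
    qed
    then show "0 \<le> p n t" using that by (cases n) (auto simp: p0)
  next
    show "f (Suc n) t \<le> 1" using that
    proof (induction n arbitrary: t)
      case 0 then show ?case by (simp add: f_def p0)
    next
      case (Suc n)
      have "f (Suc (Suc n)) t = (\<Sum>k\<in>neighbours m t. P t k * (if k = s then 1 else f (Suc n) k))"
        unfolding fS using split[OF Suc.prems] by simp
      also have "\<dots> \<le> (\<Sum>k\<in>neighbours m t. P t k * 1)"
      proof (rule sum_mono)
        fix k assume "k \<in> neighbours m t"
        then have k: "k \<in> qbd_states m" by (rule neighbour_in_states)
        have "(if k = s then 1 else f (Suc n) k) \<le> 1" using Suc.IH[OF k] by simp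
        then show "P t k * (if k = s then 1 else f (Suc n) k) \<le> P t k * 1"
          by (rule mult_left_mono[OF _ P_nonneg[OF Suc.prems k]])
      qed
      finally show ?case using P_row_total[OF Suc.prems] by simp
    qed
  qed
  have sums: "summable (\<lambda>n. p n t)" if "t \<in> qbd_states m" for t
  proof (rule summableI_nonneg_bounded)
    show "(\<Sum>i<n. p i t) \<le> 1" for n
    proof (cases n)
      case (Suc n')
      then show ?thesis using bounds(2)[OF that, of n'] unfolding f_def by simp
    qed simp
    show "0 \<le> p n t" for n by (rule bounds(1)[OF that])
  qed
  define q where "q t = (\<Sum>n. p n t)" for t
  have lim: "(\<lambda>n. f n t) \<longlonglongrightarrow> q t" if "t \<in> qbd_states m" for t
    unfolding f_def q_def using summable_LIMSEQ[OF sums[OF that]] .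
  have q_nonneg: "0 \<le> q t" if "t \<in> qbd_states m" for t
    unfolding q_def using bounds(1)[OF that] sums[OF that] by (intro suminf_nonneg) auto
  \<comment> \<open>The first-passage probabilities \<open>q\<close> are harmonic only off \<open>s\<close>; with the value \<open>1\<close> at \<open>s\<close> they become
    superharmonic everywhere.\<close>
  define h where "h k = (if k = s then 1 else q k)" for k
  have q_eq: "q t = (\<Sum>k\<in>neighbours m t. P t k * h k)" if t: "t \<in> qbd_states m" for t
  proof -
    have "(\<lambda>n. f (Suc n) k) \<longlonglongrightarrow> q k" if "k \<in> neighbours m t - {s}" for k
    proof -
      have "k \<in> neighbours m t" using that by simp
      then show ?thesis using neighbour_in_states LIMSEQ_Suc[OF lim] by blast
    qed
    then have "(\<lambda>n. P t s + (\<Sum>k\<in>neighbours m t - {s}. P t k * f (Suc n) k)) \<longlonglongrightarrow>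
        P t s + (\<Sum>k\<in>neighbours m t - {s}. P t k * q k)"
      by (intro tendsto_add tendsto_const tendsto_sum tendsto_mult)
    then have "q t = P t s + (\<Sum>k\<in>neighbours m t - {s}. P t k * q k)"
      using LIMSEQ_Suc[OF LIMSEQ_Suc[OF lim[OF t]]] unfolding fS by (rule LIMSEQ_unique[rotated])
    then show ?thesis unfolding h_def split[OF t] .
  qed
  have q_le: "q t \<le> 1" if t: "t \<in> qbd_states m" for t
    using LIMSEQ_le_const2[OF LIMSEQ_Suc[OF lim[OF t]]] bounds(2)[OF t] by blast
  have h_ge: "q t \<le> h t" if "t \<in> qbd_states m" for t
    unfolding h_def using q_le[OF that] by auto
  define H where "H r = vec m (\<lambda>a. h (r, a))" for r
  have Hc: "H r \<in> carrier_vec m" for r unfolding H_def by simp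
  have Hd [simp]: "dim_vec (H r) = m" for r unfolding H_def by simp
  have Hnn: "0 \<le> H r $ a" if "a < m" for r a
    unfolding H_def h_def using that q_nonneg by simp
  have hH: "(\<Sum>t\<in>neighbours m (r, a). P (r, a) t * h t) = (\<Sum>t\<in>neighbours m (r, a). P (r, a) t * (H (fst t) $ snd t))" for r a
    unfolding H_def by (intro sum.cong) (auto simp: neighbours_def)
  have qH0: "q (0, a) = (B *\<^sub>v H 0) $ a + (A1 *\<^sub>v H 1) $ a" if "a < m" for a
    using q_eq[of "(0, a)"] row_vec_sum_0[of H, OF Hc that] that by (simp add: hH)
  have qHS: "q (Suc r, a) = (Am *\<^sub>v H r) $ a + (A0 *\<^sub>v H (Suc r)) $ a + (A1 *\<^sub>v H (Suc (Suc r))) $ a" if "a < m" for r a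
    using q_eq[of "(Suc r, a)"] row_vec_sum_Suc[of H, OF Hc that] that by (simp add: hH)
  have H_ge: "q (r, a) \<le> H r $ a" if "a < m" for r a
    using h_ge[of "(r, a)"] that unfolding H_def by simp
  define c where "c = Min ((\<lambda>a. H 0 $ a) ` {..<m})"
  have c_le: "c \<le> H 0 $ a" if "a < m" for a unfolding c_def using that by (intro Min_le) auto
  have "c \<in> (\<lambda>a. H 0 $ a) ` {..<m}" unfolding c_def using m by (intro Min_in) (auto simp: lessThan_empty_iff)
  then obtain a0 where a0: "a0 < m" "H 0 $ a0 = c" by auto
  \<comment> \<open>As \<open>G\<close> is stochastic, the bound on level \<open>0\<close> is propagated to all levels.\<close>
  have H_ge_c: "c \<le> H r $ a" if a: "a < m" for r a
  proof -
    have "G ^\<^sub>m r *\<^sub>v (c \<cdot>\<^sub>v ones m) = c \<cdot>\<^sub>v ones m"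
      by (rule pow_fixed_vec) (simp_all add: mult_mat_vec[of _ m m] G1)
    then have "c = (G ^\<^sub>m r *\<^sub>v (c \<cdot>\<^sub>v ones m)) $ a" using a by simp
    also have "\<dots> \<le> (G ^\<^sub>m r *\<^sub>v H 0) $ a"
      using a c_le Hc by (intro mult_mat_vec_mono[of m] nonneg_square_pow G_nonneg) auto
    also have "\<dots> \<le> H r $ a"
    proof (rule superharmonic_ge_G_pow[of H, OF Hc Hnn _ a])
      fix r a assume "a < m"
      then show "(Am *\<^sub>v H r) $ a + (A0 *\<^sub>v H (Suc r)) $ a + (A1 *\<^sub>v H (Suc (Suc r))) $ a \<le> H (Suc r) $ a"
        using qHS[of a r] H_ge[of a "Suc r"] by simp
    qed
    finally show ?thesis .
  qed
  have neg: "(X *\<^sub>v (- H r)) $ a = - (X *\<^sub>v H r) $ a" if "X \<in> carrier_mat m m" "a < m" for X r a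
    using that Hc[of r] by (simp add: mult_mat_vec_entry[of _ m m] sum_negf del: index_mult_mat_vec)
  have const: "(- H r) $ a = - c" if a: "a < m" for r a
  proof (rule chain_maximum[where F = "\<lambda>r. - H r" and i = 0 and a = a0])
    show "(- H 0) $ a \<le> (B *\<^sub>v - H 0) $ a + (A1 *\<^sub>v - H 1) $ a" if "a < m" for a
      using that Hc[of 0] qH0[of a] H_ge[of a 0] by (simp add: neg del: index_mult_mat_vec)
    show "(- H (Suc r)) $ a \<le> (Am *\<^sub>v - H r) $ a + (A0 *\<^sub>v - H (Suc r)) $ a + (A1 *\<^sub>v - H (Suc (Suc r))) $ a"
      if "a < m" for r a
      using that Hc[of "Suc r"] qHS[of a r] H_ge[of a "Suc r"] by (simp add: neg del: index_mult_mat_vec)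
    show "(- H r) $ a \<le> - c" if "a < m" for r a using H_ge_c[OF that, of r] that Hc[of r] by simp
  qed (use a a0 Hc[of 0] Hc in auto)
  have hc: "h (r, a) = c" if "a < m" for r a
    using const[OF that, of r] that unfolding H_def by simp
  obtain r a where s_eq: "s = (r, a)" by (cases s)
  have "c = 1" using hc[of a r] s s_eq unfolding h_def by simp
  then have "h t = 1" if "t \<in> neighbours m s" for t
    using hc[of "snd t" "fst t"] that by (auto simp: neighbours_def)
  then have "q s = 1" using q_eq[OF s] P_row_total[OF s] by simp
  then show "return_prob (qbd_states m) P s = 1" unfolding return_prob_def q_def p_def .
qed

definition Pstar :: "real mat" where "Pstar = B + A1 * G"

lemma Pstar_carrier [simp]: "Pstar \<in> carrier_mat m m"
  unfolding Pstar_def by simp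

lemma Pstar_dims [simp]: "dim_row Pstar = m" "dim_col Pstar = m"
  unfolding Pstar_def by simp_all

lemma Pstar_mult_vec: "v \<in> carrier_vec m \<Longrightarrow> Pstar *\<^sub>v v = B *\<^sub>v v + A1 *\<^sub>v (G *\<^sub>v v)"
  unfolding Pstar_def by (simp add: vec_simps)

text \<open>The vectors \<open>G\<^sup>r v\<close> on the levels \<open>r\<close> form a function that is harmonic above level \<open>0\<close> and, since
  \<open>P\<^sub>*\<close> is the chain watched on level \<open>0\<close>, subharmonic on level \<open>0\<close>.\<close>

lemma harmonic_extension_maximum:
  assumes v: "v \<in> carrier_vec m" and sub: "\<And>a. a < m \<Longrightarrow> v $ a \<le> (Pstar *\<^sub>v v) $ a"
    and bound: "\<And>r a. a < m \<Longrightarrow> (G ^\<^sub>m r *\<^sub>v v) $ a \<le> c"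
    and a: "a < m" "(G ^\<^sub>m i *\<^sub>v v) $ a = c" and b: "b < m"
  shows "(G ^\<^sub>m j *\<^sub>v v) $ b = c"
proof (rule chain_maximum[where F = "\<lambda>r. G ^\<^sub>m r *\<^sub>v v", OF _ bound _ _ a b])
  show "(G ^\<^sub>m 0 *\<^sub>v v) $ a \<le> (B *\<^sub>v (G ^\<^sub>m 0 *\<^sub>v v)) $ a + (A1 *\<^sub>v (G ^\<^sub>m 1 *\<^sub>v v)) $ a" if "a < m" for a
    using sub[OF that] that v by (simp add: Pstar_mult_vec del: index_mult_mat_vec)
  fix r a assume a: "a < m"
  show "(G ^\<^sub>m Suc r *\<^sub>v v) $ a \<le> (Am *\<^sub>v (G ^\<^sub>m r *\<^sub>v v)) $ a + (A0 *\<^sub>v (G ^\<^sub>m Suc r *\<^sub>v v)) $ a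
      + (A1 *\<^sub>v (G ^\<^sub>m Suc (Suc r) *\<^sub>v v)) $ a"
    using arg_cong[OF G_mult_vec[of "G ^\<^sub>m r *\<^sub>v v"], of "\<lambda>x. x $ a"] a v
    by (simp add: G_pow_mult_vec_Suc del: index_mult_mat_vec pow_mat.simps)
qed (use v in auto)

text \<open>The harmonic extension of a fixed vector tends to \<open>0\<close> along the levels. A positive value would
  therefore force a positive maximum, and the extension would be constant and positive.\<close>

lemma one_minus_Pstar_invertible_if_not_stochastic:
  assumes lim: "mat_limit m (\<lambda>j. G ^\<^sub>m j) (0\<^sub>m m m)"
  shows "invertible_mat (1\<^sub>m m - Pstar)"
proof (rule one_minus_invertible_if_no_fixed_vec)
  have le0: "v $ a \<le> 0" if v: "v \<in> carrier_vec m" "Pstar *\<^sub>v v = v" and a: "a < m" for v a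
  proof (rule ccontr)
    assume pos: "\<not> v $ a \<le> 0"
    have x0: "(\<lambda>r. (G ^\<^sub>m r *\<^sub>v v) $ b) \<longlonglongrightarrow> 0" if "b < m" for b
    proof -
      have "(\<lambda>r. (G ^\<^sub>m r *\<^sub>v v) $ b) \<longlonglongrightarrow> (0\<^sub>m m m *\<^sub>v v) $ b"
        using v that by (intro mult_mat_vec_limit[OF lim]) auto
      then show ?thesis using that v by simp
    qed
    have "\<forall>\<^sub>F r in sequentially. \<forall>b\<in>{..<m}. (G ^\<^sub>m r *\<^sub>v v) $ b < v $ a"
      using x0 pos by (intro eventually_ball_finite ballI order_tendstoD(2)[of _ 0]) auto
    then obtain n where n: "\<And>r b. r \<ge> n \<Longrightarrow> b < m \<Longrightarrow> (G ^\<^sub>m r *\<^sub>v v) $ b < v $ a"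
      unfolding eventually_sequentially by auto
    define c where "c = Max ((\<lambda>(r, b). (G ^\<^sub>m r *\<^sub>v v) $ b) ` ({..n} \<times> {..<m}))"
    have le_c: "(G ^\<^sub>m r *\<^sub>v v) $ b \<le> c" if "r \<le> n" "b < m" for r b
      unfolding c_def using that
      by (intro Max_ge) (auto intro!: image_eqI[of _ _ "(r, b)"] simp del: index_mult_mat_vec)
    have v_le: "v $ a \<le> c" using le_c[of 0 a] a v(1) by (simp del: index_mult_mat_vec)
    have bound: "(G ^\<^sub>m r *\<^sub>v v) $ b \<le> c" if "b < m" for r b
      using le_c[of r b] n[of r b] v_le that by (cases "r \<le> n") auto
    have "c \<in> (\<lambda>(r, b). (G ^\<^sub>m r *\<^sub>v v) $ b) ` ({..n} \<times> {..<m})"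
      unfolding c_def using m by (intro Max_in) (auto simp: lessThan_empty_iff)
    then obtain i b where ib: "b < m" "(G ^\<^sub>m i *\<^sub>v v) $ b = c" by auto
    have "(G ^\<^sub>m j *\<^sub>v v) $ a = c" for j
      by (rule harmonic_extension_maximum[OF v(1) _ bound ib a]) (use v(2) in auto)
    then have "c = 0" using x0[OF a] by (simp add: LIMSEQ_const_iff)
    then show False using v_le pos by simp
  qed
  fix v assume v: "v \<in> carrier_vec m" "Pstar *\<^sub>v v = v"
  have neg: "Pstar *\<^sub>v (- v) = - v"
  proof (rule eq_vec_entriesI[of _ m])
    fix a assume a: "a < m"
    then have "(Pstar *\<^sub>v (- v)) $ a = - (Pstar *\<^sub>v v) $ a"
      using v(1) by (simp add: mult_mat_vec_entry[of _ m m] sum_negf del: index_mult_mat_vec)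
    then show "(Pstar *\<^sub>v (- v)) $ a = (- v) $ a" using a v by simp
  qed (use v in auto)
  show "v = 0\<^sub>v m"
    using le0[OF v] le0[OF _ neg] v(1)
    by (intro eq_vec_entriesI[of _ m]) (auto intro: antisym)
qed simp

end

section \<open>Stationary distributions\<close>

lemma scalar_prod_mult_mat_vec:
  assumes "A \<in> carrier_mat k k" "v \<in> carrier_vec k"
  shows "w \<bullet> (A *\<^sub>v v) = (\<Sum>b<k. (\<Sum>a<k. w $ a * A $$ (a, b)) * v $ b)"
proof -
  have "w \<bullet> (A *\<^sub>v v) = (\<Sum>a<k. \<Sum>b<k. w $ a * A $$ (a, b) * v $ b)"
    using assms
    by (simp add: scalar_prod_entries[of _ k] mult_mat_vec_entry[of _ k k] sum_distrib_left mult.assoc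
        del: index_mult_mat_vec)
  also have "\<dots> = (\<Sum>b<k. (\<Sum>a<k. w $ a * A $$ (a, b)) * v $ b)"
    unfolding sum_distrib_right by (rule sum.swap)
  finally show ?thesis .
qed

locale qbd_stationary = qbd_process +
  fixes \<pi> :: "nat \<Rightarrow> real vec"
  assumes \<pi>_carrier [simp]: "\<And>i. \<pi> i \<in> carrier_vec m"
    and stationary: "stationary_distribution_on (qbd_states m) P (\<lambda>(i, a). \<pi> i $ a)"
begin

lemma \<pi>_dim [simp]: "dim_vec (\<pi> i) = m"
  using \<pi>_carrier[of i] by (simp del: \<pi>_carrier)

lemma \<pi>_nonneg: "a < m \<Longrightarrow> 0 \<le> \<pi> i $ a"
  using stationary unfolding stationary_distribution_on_def by (metis (no_types, lifting) case_prod_conv qbd_states_iff)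

lemma \<pi>_has_sum: "((\<lambda>(i, a). \<pi> i $ a) has_sum 1) (qbd_states m)"
  using stationary unfolding stationary_distribution_on_def by blast

lemma \<pi>_column:
  assumes "t \<in> qbd_states m"
  shows "(\<Sum>s\<in>neighbours m t. (\<lambda>(i, a). \<pi> i $ a) s * P s t) = (\<lambda>(i, a). \<pi> i $ a) t"
proof -
  have "((\<lambda>s. (\<lambda>(i, a). \<pi> i $ a) s * P s t) has_sum (\<lambda>(i, a). \<pi> i $ a) t) (qbd_states m)"
    using stationary assms unfolding stationary_distribution_on_def by blast
  then show ?thesis by (rule has_sum_unique[OF qbd_column_has_sum])
qed

lemma balance_0:
  assumes v: "v \<in> carrier_vec m"
  shows "\<pi> 0 \<bullet> (B *\<^sub>v v) + \<pi> 1 \<bullet> (Am *\<^sub>v v) = \<pi> 0 \<bullet> v"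
proof -
  have c: "(\<Sum>a<m. \<pi> 0 $ a * B $$ (a, b)) + (\<Sum>a<m. \<pi> 1 $ a * Am $$ (a, b)) = \<pi> 0 $ b" if "b < m" for b
    using \<pi>_column[of "(0, b)"] that unfolding qbd_column_sum_0 by simp
  have "\<pi> 0 \<bullet> (B *\<^sub>v v) + \<pi> 1 \<bullet> (Am *\<^sub>v v) =
    (\<Sum>b<m. ((\<Sum>a<m. \<pi> 0 $ a * B $$ (a, b)) + (\<Sum>a<m. \<pi> 1 $ a * Am $$ (a, b))) * v $ b)"
    using v by (simp add: scalar_prod_mult_mat_vec[of _ m] sum.distrib distrib_right)
  also have "\<dots> = \<pi> 0 \<bullet> v" using v c by (simp add: scalar_prod_entries[of _ m])
  finally show ?thesis .
qed

lemma balance_Suc: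
  assumes v: "v \<in> carrier_vec m"
  shows "\<pi> i \<bullet> (A1 *\<^sub>v v) + \<pi> (Suc i) \<bullet> (A0 *\<^sub>v v) + \<pi> (Suc (Suc i)) \<bullet> (Am *\<^sub>v v) = \<pi> (Suc i) \<bullet> v"
proof -
  have c: "(\<Sum>a<m. \<pi> i $ a * A1 $$ (a, b)) + (\<Sum>a<m. \<pi> (Suc i) $ a * A0 $$ (a, b))
      + (\<Sum>a<m. \<pi> (Suc (Suc i)) $ a * Am $$ (a, b)) = \<pi> (Suc i) $ b" if "b < m" for b
    using \<pi>_column[of "(Suc i, b)"] that unfolding qbd_column_sum_Suc by simp
  have "\<pi> i \<bullet> (A1 *\<^sub>v v) + \<pi> (Suc i) \<bullet> (A0 *\<^sub>v v) + \<pi> (Suc (Suc i)) \<bullet> (Am *\<^sub>v v) =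
    (\<Sum>b<m. ((\<Sum>a<m. \<pi> i $ a * A1 $$ (a, b)) + (\<Sum>a<m. \<pi> (Suc i) $ a * A0 $$ (a, b))
      + (\<Sum>a<m. \<pi> (Suc (Suc i)) $ a * Am $$ (a, b))) * v $ b)"
    using v by (simp add: scalar_prod_mult_mat_vec[of _ m] sum.distrib distrib_right)
  also have "\<dots> = \<pi> (Suc i) \<bullet> v" using v c by (simp add: scalar_prod_entries[of _ m])
  finally show ?thesis .
qed

lemma \<pi>_limit:
  assumes a: "a < m"
  shows "(\<lambda>i. \<pi> i $ a) \<longlonglongrightarrow> 0"
proof -
  have "(\<lambda>(i, a). \<pi> i $ a) summable_on (qbd_states m)"
    using \<pi>_has_sum by (rule has_sum_imp_summable)
  then have "(\<lambda>(i, a). \<pi> i $ a) summable_on ((\<lambda>i. (i, a)) ` UNIV)"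
    by (rule summable_on_subset_banach) (use a in auto)
  then have "((\<lambda>(i, a). \<pi> i $ a) \<circ> (\<lambda>i. (i, a))) summable_on UNIV"
    by (subst (asm) summable_on_reindex) (auto simp: inj_on_def)
  then have "summable (\<lambda>i. \<pi> i $ a)"
    using summable_on_imp_summable by (simp add: o_def)
  then show ?thesis by (rule summable_LIMSEQ_zero)
qed

lemma \<pi>_Suc: "v \<in> carrier_vec m \<Longrightarrow> \<pi> (Suc i) \<bullet> v = \<pi> i \<bullet> (R *\<^sub>v v)"
  by (rule stationary_geometric[OF \<pi>_carrier \<pi>_limit balance_Suc])

lemma \<pi>_eq: "v \<in> carrier_vec m \<Longrightarrow> \<pi> i \<bullet> v = \<pi> 0 \<bullet> (R ^\<^sub>m i *\<^sub>v v)"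
proof (induction i arbitrary: v)
  case (Suc i)
  have "R ^\<^sub>m Suc i *\<^sub>v v = R ^\<^sub>m i *\<^sub>v (R *\<^sub>v v)"
    using Suc.prems by (simp add: vec_simps)
  then show ?case using \<pi>_Suc[OF Suc.prems, of i] Suc.IH[of "R *\<^sub>v v"] by simp
qed simp

lemma \<pi>_entry: "b < m \<Longrightarrow> \<pi> i $ b = \<pi> 0 \<bullet> (R ^\<^sub>m i *\<^sub>v unit_vec m b)"
  using \<pi>_eq[of "unit_vec m b" i] by simp

lemma \<pi>_positive:
  assumes a: "a < m"
  shows "0 < \<pi> i $ a"
proof -
  let ?\<mu> = "\<lambda>(i, a). \<pi> i $ a"
  obtain s where s: "s \<in> qbd_states m" "?\<mu> s \<noteq> 0"
  proof (rule ccontr)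
    assume "\<not> thesis"
    then have "\<And>s. s \<in> qbd_states m \<Longrightarrow> ?\<mu> s = 0" using that by blast
    then have "(?\<mu> has_sum 0) (qbd_states m)" by (rule has_sum_0)
    then show False using has_sum_unique[OF \<pi>_has_sum] by fastforce
  qed
  then have pos: "0 < ?\<mu> s" using \<pi>_nonneg by (cases s) (auto simp: less_le)
  have "reachable_on (qbd_states m) P s (i, a)"
    using irreducible s(1) a unfolding irreducible_on_def by simp
  then have "0 < ?\<mu> (i, a)"
    unfolding reachable_on_def
  proof (induction rule: rtrancl_induct)
    case (step y z)
    then have y: "y \<in> qbd_states m" and z: "z \<in> qbd_states m" and P: "0 < P y z" by auto
    have nonneg: "0 \<le> ?\<mu> t * P t z" if "t \<in> neighbours m z" for t
    proof -
      have "t \<in> qbd_states m" using that by (rule neighbour_in_states)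
      then show ?thesis using P_nonneg[of t z] z \<pi>_nonneg by (cases t) simp
    qed
    have "y \<in> neighbours m z" using neighbours_facts(4)[of y m z B Am A0 A1] y P by force
    then have "?\<mu> y * P y z \<le> (\<Sum>t\<in>neighbours m z. ?\<mu> t * P t z)"
      using nonneg neighbours_facts(1) by (intro member_le_sum) auto
    then show ?case using \<pi>_column[OF z] mult_pos_pos[OF step.IH P] by linarith
  qed (rule pos)
  then show ?thesis by simp
qed

text \<open>The entries of \<open>\<pi>\<^sub>0 R\<^sup>j = \<pi>\<^sub>j\<close> tend to \<open>0\<close>, and \<open>\<pi>\<^sub>0\<close> is positive.\<close>

lemma R_pow_limit: "mat_limit m (\<lambda>j. R ^\<^sub>m j) (0\<^sub>m m m)"
  unfolding mat_limit_def
proof (intro allI impI)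
  fix a b assume ab: "a < m" "b < m"
  have le: "\<pi> 0 $ a * (R ^\<^sub>m j) $$ (a, b) \<le> \<pi> j $ b" for j
    unfolding \<pi>_entry[OF ab(2)]
    using ab \<pi>_nonneg by (intro entry_le_scalar_prod nonneg_square_pow R_nonneg) auto
  have "(\<lambda>j. (R ^\<^sub>m j) $$ (a, b)) \<longlonglongrightarrow> 0"
  proof (rule tendsto_sandwich[of "\<lambda>_. 0" _ _ "\<lambda>j. \<pi> j $ b / \<pi> 0 $ a"])
    show "\<forall>\<^sub>F j in sequentially. (R ^\<^sub>m j) $$ (a, b) \<le> \<pi> j $ b / \<pi> 0 $ a"
      using le \<pi>_positive[OF ab(1), of 0] by (auto simp: field_simps)
    show "(\<lambda>j. \<pi> j $ b / \<pi> 0 $ a) \<longlonglongrightarrow> 0"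
      using tendsto_divide[OF \<pi>_limit[OF ab(2)] tendsto_const, of "\<pi> 0 $ a"] \<pi>_positive[OF ab(1), of 0] by simp
  qed (use ab pow_nonneg_entries[OF R_nonneg] in auto)
  then show "(\<lambda>j. (R ^\<^sub>m j) $$ (a, b)) \<longlonglongrightarrow> 0\<^sub>m m m $$ (a, b)" using ab by simp
qed

text \<open>The measure \<open>\<pi>\<^sub>0\<close> is invariant for \<open>B + R A\<^sub>-\<^sub>1\<close>, which is \<open>B + A\<^sub>1 G\<close>.\<close>

lemma \<pi>_Pstar:
  assumes v: "v \<in> carrier_vec m"
  shows "\<pi> 0 \<bullet> (Pstar *\<^sub>v v) = \<pi> 0 \<bullet> v"
proof -
  have "R *\<^sub>v (Am *\<^sub>v v) = A1 *\<^sub>v (G *\<^sub>v v)"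
    using arg_cong[OF R_Am, of "\<lambda>X. X *\<^sub>v v"] v by (simp add: vec_simps)
  then have "\<pi> 1 \<bullet> (Am *\<^sub>v v) = \<pi> 0 \<bullet> (A1 *\<^sub>v (G *\<^sub>v v))"
    using \<pi>_Suc[of "Am *\<^sub>v v" 0] by simp
  then show ?thesis
    using balance_0[OF v] v by (simp add: Pstar_mult_vec scalar_prod_add_distrib[of _ m])
qed

text \<open>Since the positive measure \<open>\<pi>\<^sub>0\<close> is invariant for the substochastic matrix \<open>P\<^sub>*\<close>, no mass is lost
  in \<open>P\<^sub>* 1\<close>, and hence none in \<open>A\<^sub>1 G 1\<close>.\<close>

lemma G_stochastic: "G *\<^sub>v ones m = ones m"
proof -
  define v where "v = A1 *\<^sub>v ones m - A1 *\<^sub>v (G *\<^sub>v ones m)"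
  have v: "v \<in> carrier_vec m" "\<And>a. a < m \<Longrightarrow> 0 \<le> v $ a"
    unfolding v_def using TG_ones_le by (auto simp del: index_mult_mat_vec)
  have "B *\<^sub>v ones m + A1 *\<^sub>v ones m = ones m"
    using total_0 by (intro eq_vec_entriesI[of _ m]) (auto simp del: index_mult_mat_vec)
  from arg_cong[OF this, of "\<lambda>x. \<pi> 0 \<bullet> x"]
  have "\<pi> 0 \<bullet> v = 0" unfolding v_def
    using \<pi>_Pstar[of "ones m"]
    by (simp add: Pstar_mult_vec scalar_prod_add_distrib[of _ m] scalar_prod_minus_distrib[of _ m])
  then have "v = 0\<^sub>v m"
    using nonneg_scalar_prod_eq_zero[of m "\<pi> 0" v] \<pi>_positive v by blast
  then have e: "v $ a = 0" if "a < m" for a using that by simp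
  have "A1 *\<^sub>v (G *\<^sub>v ones m) = A1 *\<^sub>v ones m"
  proof (rule eq_vec_entriesI[of _ m])
    fix a assume "a < m"
    then show "(A1 *\<^sub>v (G *\<^sub>v ones m)) $ a = (A1 *\<^sub>v ones m) $ a"
      using e[of a] unfolding v_def by (simp del: index_mult_mat_vec)
  qed auto
  then show ?thesis by (rule G_stochastic_if_TG_ones)
qed

lemma Pstar_ones: "Pstar *\<^sub>v ones m = ones m"
  using total_0
  by (intro eq_vec_entriesI[of _ m]) (auto simp: Pstar_mult_vec G_stochastic simp del: index_mult_mat_vec)

text \<open>As \<open>G\<close> is stochastic, the harmonic extension of the vector attains its maximum on level \<open>0\<close>.\<close>

lemma Pstar_fixed_vec_const:
  assumes v: "v \<in> carrier_vec m" "Pstar *\<^sub>v v = v"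
  obtains c where "v = c \<cdot>\<^sub>v ones m"
proof -
  define c where "c = Max ((\<lambda>a. v $ a) ` {..<m})"
  have le: "v $ a \<le> c" if "a < m" for a using that unfolding c_def by (intro Max_ge) auto
  have "c \<in> (\<lambda>a. v $ a) ` {..<m}" unfolding c_def using m by (intro Max_in) (auto simp: lessThan_empty_iff)
  then obtain a where a: "a < m" "v $ a = c" by auto
  have fixed: "G ^\<^sub>m r *\<^sub>v (c \<cdot>\<^sub>v ones m) = c \<cdot>\<^sub>v ones m" for r
    by (rule pow_fixed_vec) (simp_all add: mult_mat_vec[of _ m m] G_stochastic)
  have bound: "(G ^\<^sub>m r *\<^sub>v v) $ b \<le> c" if b: "b < m" for r b
  proof -
    have "(G ^\<^sub>m r *\<^sub>v v) $ b \<le> (G ^\<^sub>m r *\<^sub>v (c \<cdot>\<^sub>v ones m)) $ b"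
      using v b le by (intro mult_mat_vec_mono[of m] nonneg_square_pow G_nonneg) auto
    then show ?thesis using fixed[of r] b by simp
  qed
  have a': "(G ^\<^sub>m 0 *\<^sub>v v) $ a = c" using a v by simp
  have "v $ b = c" if "b < m" for b
    using harmonic_extension_maximum[OF v(1) _ bound a(1) a' that, of 0] v by simp
  then have "v = c \<cdot>\<^sub>v ones m" using v(1) by (intro eq_vec_entriesI[of _ m]) auto
  then show ?thesis by (rule that)
qed

end

section \<open>The group inverse of \<open>I - P\<^sub>*\<close>\<close>

lemma group_inverse_unique:
  assumes H: "H \<in> carrier_mat k k" and X: "is_group_inverse H X" and Y: "is_group_inverse H Y"
  shows "X = Y"
proof -
  have c [simp]: "X \<in> carrier_mat k k" "Y \<in> carrier_mat k k" "H \<in> carrier_mat k k"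
    using H X Y unfolding is_group_inverse_def by auto
  have Xe: "H * X = X * H" "H * X * H = H" "X * H * X = X"
    and Ye: "H * Y = Y * H" "H * Y * H = H" "Y * H * Y = Y"
    using X Y unfolding is_group_inverse_def by auto
  note as = assoc_mult_mat[of _ k k _ k _ k]
  have 1: "H * X = (H * Y) * (H * X)"
    using arg_cong[OF Ye(2), of "\<lambda>A. A * X"] by (simp add: as)
  have 2: "Y * H = (Y * H) * (X * H)"
    using arg_cong[OF Xe(2), of "\<lambda>A. Y * A"] by (simp add: as)
  have ef: "H * X = H * Y" using 1 2 Xe(1) Ye(1) by simp
  have "X = X * (H * X)" using Xe(3) by (simp add: as)
  also have "\<dots> = (X * H) * Y" unfolding ef by (simp add: as)
  also have "\<dots> = Y * H * Y" using ef Xe(1) Ye(1) by simp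
  finally show ?thesis using Ye(3) by simp
qed

lemma group_inverse_eqI:
  "H \<in> carrier_mat k k \<Longrightarrow> is_group_inverse H X \<Longrightarrow> group_inverse H = X"
  unfolding group_inverse_def using group_inverse_unique by blast

lemma eq_minus_if_add_eq:
  fixes A B C :: "'a :: ab_group_add mat"
  assumes "A \<in> carrier_mat k l" "B \<in> carrier_mat k l" "A + B = C"
  shows "A = C - B"
  using assms by (intro eq_mat_entriesI[of _ k l]) auto

context qbd_stationary
begin

definition level0_mass :: real where "level0_mass = \<pi> 0 \<bullet> ones m"

lemma level0_mass_pos: "0 < level0_mass"
proof -
  have "0 < (\<Sum>a<m. \<pi> 0 $ a)" using \<pi>_positive m by (intro sum_pos) (auto simp: lessThan_empty_iff)
  then show ?thesis unfolding level0_mass_def by (simp add: scalar_prod_entries[of _ m])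
qed

text \<open>The projection onto the kernel of \<open>I - P\<^sub>*\<close> along its range. It is also the device by which
  conditions on the product with \<open>\<pi>\<^sub>0\<close> are written as equations between square matrices.\<close>

definition projection :: "real mat" where
  "projection = mat m m (\<lambda>(a, b). \<pi> 0 $ b / level0_mass)"

lemma projection_carrier [simp]: "projection \<in> carrier_mat m m"
  unfolding projection_def by simp

lemma projection_dims [simp]: "dim_row projection = m" "dim_col projection = m"
  unfolding projection_def by simp_all

lemma projection_mult_vec:
  assumes v: "v \<in> carrier_vec m"
  shows "projection *\<^sub>v v = ((\<pi> 0 \<bullet> v) / level0_mass) \<cdot>\<^sub>v ones m"
proof (rule eq_vec_entriesI[of _ m])
  fix a assume a: "a < m"
  then show "(projection *\<^sub>v v) $ a = (((\<pi> 0 \<bullet> v) / level0_mass) \<cdot>\<^sub>v ones m) $ a"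
    using v by (simp add: mult_mat_vec_entry[of _ m m] projection_def scalar_prod_entries[of _ m]
        sum_divide_distrib del: index_mult_mat_vec)
qed auto

abbreviation H :: "real mat" where "H \<equiv> 1\<^sub>m m - Pstar"

lemma mat_eq_if_mult_vec_eq:
  fixes X Y :: "real mat"
  assumes X: "X \<in> carrier_mat m m" and Y: "Y \<in> carrier_mat m m"
    and eq: "\<And>v. v \<in> carrier_vec m \<Longrightarrow> X *\<^sub>v v = Y *\<^sub>v v"
  shows "X = Y"
proof (rule eq_mat_entriesI[OF X Y])
  fix a b assume ab: "a < m" "b < m"
  show "X $$ (a, b) = Y $$ (a, b)"
    using arg_cong[OF eq[of "unit_vec m b"], of "\<lambda>x. x $ a"]
      unit_vec_mult_entry[OF X ab] unit_vec_mult_entry[OF Y ab] by simp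
qed

lemma H_mult_vec: "v \<in> carrier_vec m \<Longrightarrow> H *\<^sub>v v = v - Pstar *\<^sub>v v"
  by (simp add: vec_simps)

lemma H_ones: "H *\<^sub>v (c \<cdot>\<^sub>v ones m) = 0\<^sub>v m"
  by (simp add: H_mult_vec mult_mat_vec[of _ m m] Pstar_ones)

lemma \<pi>_H: "v \<in> carrier_vec m \<Longrightarrow> \<pi> 0 \<bullet> (H *\<^sub>v v) = 0"
  by (simp add: H_mult_vec scalar_prod_minus_distrib[of _ m] \<pi>_Pstar)

lemma H_projection: "H * projection = 0\<^sub>m m m"
  by (rule mat_eq_if_mult_vec_eq)
    (simp_all add: assoc_mult_mat_vec[of _ m m _ m] projection_mult_vec H_ones)

lemma projection_H: "projection * H = 0\<^sub>m m m"
  by (rule mat_eq_if_mult_vec_eq)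
    (simp_all add: assoc_mult_mat_vec[of _ m m _ m] projection_mult_vec \<pi>_H)

lemma projection_idem: "projection * projection = projection"
proof (rule mat_eq_if_mult_vec_eq)
  fix v :: "real vec" assume v: "v \<in> carrier_vec m"
  have "\<pi> 0 \<bullet> (c \<cdot>\<^sub>v ones m) = c * level0_mass" for c
    unfolding level0_mass_def by simp
  then have "\<pi> 0 \<bullet> ((\<pi> 0 \<bullet> v / level0_mass) \<cdot>\<^sub>v ones m) / level0_mass = \<pi> 0 \<bullet> v / level0_mass"
    using level0_mass_pos by (simp only: nonzero_eq_divide_eq) simp
  then show "(projection * projection) *\<^sub>v v = projection *\<^sub>v v"
    using v by (simp add: assoc_mult_mat_vec[of _ m m _ m] projection_mult_vec del: scalar_prod_smult_distrib)
qed auto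

text \<open>A vector in the kernel is annihilated by \<open>\<pi>\<^sub>0\<close>, because \<open>\<pi>\<^sub>0\<close> annihilates the range of \<open>H\<close>. It is
  then fixed by \<open>P\<^sub>*\<close>, thus constant, and the constant is \<open>0\<close>.\<close>

lemma H_projection_invertible: "invertible_mat (H + projection)"
proof (rule invertible_if_injective)
  fix v assume v: "v \<in> carrier_vec m" and 0: "(H + projection) *\<^sub>v v = 0\<^sub>v m"
  have s: "H *\<^sub>v v + projection *\<^sub>v v = 0\<^sub>v m"
    using 0 v by (simp add: add_mult_distrib_mat_vec[of _ m m])
  from arg_cong[OF this, of "\<lambda>x. \<pi> 0 \<bullet> x"]
  have "(\<pi> 0 \<bullet> v / level0_mass) * level0_mass = 0"
    using v by (simp add: scalar_prod_add_distrib[of _ m] \<pi>_H projection_mult_vec level0_mass_def)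
  then have \<pi>v: "\<pi> 0 \<bullet> v = 0" using level0_mass_pos by simp
  have "Pstar *\<^sub>v v = v"
  proof (rule eq_vec_entriesI[of _ m])
    fix a assume "a < m"
    then show "(Pstar *\<^sub>v v) $ a = v $ a"
      using arg_cong[OF s, of "\<lambda>x. x $ a"] v
      by (simp add: projection_mult_vec \<pi>v H_mult_vec del: index_mult_mat_vec)
  qed (use v in auto)
  then obtain c where c: "v = c \<cdot>\<^sub>v ones m" using Pstar_fixed_vec_const v by blast
  then have "c * level0_mass = 0" using \<pi>v unfolding level0_mass_def by simp
  then have "c = 0" using level0_mass_pos by simp
  then show "v = 0\<^sub>v m" unfolding c by (intro eq_vec_entriesI[of _ m]) auto
qed auto

text \<open>The group inverse is \<open>(H + projection)\<^sup>-\<^sup>1 - projection\<close>: the correction by the projection makes \<open>H\<close>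
  invertible without changing it on its range.\<close>

lemma group_inverse_H:
  shows "is_group_inverse H (group_inverse H)"
    and "H * group_inverse H = 1\<^sub>m m - projection" and "group_inverse H * H = 1\<^sub>m m - projection"
    and "group_inverse H \<in> carrier_mat m m"
proof -
  define Y where "Y = minv (H + projection)"
  have Hc [simp]: "H \<in> carrier_mat m m" by simp
  have Y: "Y \<in> carrier_mat m m" "(H + projection) * Y = 1\<^sub>m m" "Y * (H + projection) = 1\<^sub>m m"
    unfolding Y_def by (rule minv_inverse[OF _ H_projection_invertible], simp)+
  note [simp] = Y(1)
  have [simp]: "dim_row Y = m" "dim_col Y = m" using Y(1) by (auto simp del: Y(1))
  note as = assoc_mult_mat[of _ m m _ m _ m]
  have YP: "Y * projection = projection"
  proof -
    have "Y * ((H + projection) * projection) = projection"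
      using Y(3) left_mult_one_mat[OF projection_carrier] by (simp add: as[symmetric])
    moreover have "(H + projection) * projection = projection"
      by (simp add: add_mult_distrib_mat[of _ m m _ _ m] H_projection projection_idem left_add_zero_mat[of _ m m])
    ultimately show ?thesis by simp
  qed
  have PY: "projection * Y = projection"
  proof -
    have "(projection * (H + projection)) * Y = projection"
      using Y(2) right_mult_one_mat[OF projection_carrier] by (simp add: as)
    moreover have "projection * (H + projection) = projection"
      by (simp add: mult_add_distrib_mat[of _ m m _ m] projection_H projection_idem left_add_zero_mat[of _ m m])
    ultimately show ?thesis by simp
  qed
  have HY: "H * Y = 1\<^sub>m m - projection"
  proof -
    have "H * Y + projection = 1\<^sub>m m"
      using Y(2) PY by (simp add: add_mult_distrib_mat[of _ m m _ _ m])
    then show ?thesis by (intro eq_minus_if_add_eq) auto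
  qed
  have YH: "Y * H = 1\<^sub>m m - projection"
  proof -
    have "Y * H + projection = 1\<^sub>m m"
      using Y(3) YP by (simp add: mult_add_distrib_mat[of _ m m _ m])
    then show ?thesis by (intro eq_minus_if_add_eq) auto
  qed
  define X where "X = Y - projection"
  have Xc [simp]: "X \<in> carrier_mat m m" unfolding X_def by simp
  have mz: "A - 0\<^sub>m m m = A" if "A \<in> carrier_mat m m" for A :: "real mat"
    using that by (intro eq_mat_entriesI[of _ m m]) auto
  have mm: "A - A = 0\<^sub>m m m" if "A \<in> carrier_mat m m" for A :: "real mat"
    using that by (intro eq_mat_entriesI[of _ m m]) auto
  have HX: "H * X = 1\<^sub>m m - projection"
    unfolding X_def by (simp add: mult_minus_distrib_mat[OF Hc Y(1)] HY H_projection mz)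
  have XH: "X * H = 1\<^sub>m m - projection"
    unfolding X_def by (simp add: minus_mult_distrib_mat[OF Y(1) _ Hc] YH projection_H mz)
  have XP: "X * projection = 0\<^sub>m m m"
    unfolding X_def by (simp add: minus_mult_distrib_mat[of _ m m _ _ m] YP projection_idem mm)
  have "H * X * H = 1\<^sub>m m * H - projection * H"
    unfolding HX by (intro minus_mult_distrib_mat) auto
  then have HXH: "H * X * H = H" using left_mult_one_mat[OF Hc] by (simp add: projection_H mz)
  have "X * H * X = X * (1\<^sub>m m - projection)" unfolding HX[symmetric] by (simp add: as)
  also have "\<dots> = X * 1\<^sub>m m - X * projection"
    by (rule mult_minus_distrib_mat[OF Xc]) auto
  finally have XHX: "X * H * X = X" using right_mult_one_mat[OF Xc] by (simp add: XP mz)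
  have gi: "is_group_inverse H X"
    unfolding is_group_inverse_def using HX XH HXH XHX by simp
  then have eq: "group_inverse H = X" by (intro group_inverse_eqI[of _ m]) auto
  show "is_group_inverse H (group_inverse H)" "H * group_inverse H = 1\<^sub>m m - projection"
    "group_inverse H * H = 1\<^sub>m m - projection" "group_inverse H \<in> carrier_mat m m"
    unfolding eq by (fact gi HX XH Xc)+
qed

end

section \<open>Linear recurrences of vectors\<close>

lemma vsum_entry:
  assumes "finite A" "\<And>i. i \<in> A \<Longrightarrow> f i \<in> carrier_vec k" "a < k"
  shows "vsum k f A $ a = (\<Sum>i\<in>A. f i $ a)"
  using assms by (intro index_finsum_vec) auto

lemma vsum_carrier:
  assumes "\<And>i. i \<in> A \<Longrightarrow> f i \<in> carrier_vec k"
  shows "vsum k f A \<in> carrier_vec k"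
  using assms by (intro finsum_vec_closed) auto

lemma vsum_cong:
  assumes "finite A" "\<And>i. i \<in> A \<Longrightarrow> f i \<in> carrier_vec k" "\<And>i. i \<in> A \<Longrightarrow> f i = h i"
  shows "vsum k f A = vsum k h A"
proof -
  have h: "h i \<in> carrier_vec k" if "i \<in> A" for i using assms(2,3) that by metis
  show ?thesis
    using assms h by (intro eq_vec_entriesI[of _ k] vsum_carrier) (auto simp: vsum_entry)
qed

lemma vsum_insert:
  assumes "finite A" "x \<notin> A" "\<And>i. i \<in> insert x A \<Longrightarrow> f i \<in> carrier_vec k"
  shows "vsum k f (insert x A) = f x + vsum k f A"
  using assms by (intro finsum_vec_insert) auto

lemma vsum_empty [simp]: "vsum k f {} = 0\<^sub>v k"
  by (rule finsum_vec_empty)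

lemma mult_mat_vec_vsum:
  assumes A: "A \<in> carrier_mat l k" and S: "finite S" and f: "\<And>i. i \<in> S \<Longrightarrow> f i \<in> carrier_vec k"
  shows "A *\<^sub>v vsum k f S = vsum l (\<lambda>i. A *\<^sub>v f i) S"
proof (rule eq_vec_entriesI[of _ l])
  have c: "vsum k f S \<in> carrier_vec k" using f by (rule vsum_carrier)
  have c': "\<And>i. i \<in> S \<Longrightarrow> A *\<^sub>v f i \<in> carrier_vec l" using A by simp
  show "vsum l (\<lambda>i. A *\<^sub>v f i) S \<in> carrier_vec l" by (rule vsum_carrier[OF c'])
  fix a assume a: "a < l"
  have "(A *\<^sub>v vsum k f S) $ a = (\<Sum>b<k. A $$ (a, b) * (\<Sum>i\<in>S. f i $ b))"
    using f S by (simp add: mult_mat_vec_entry[OF A c a] vsum_entry)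
  also have "\<dots> = (\<Sum>i\<in>S. \<Sum>b<k. A $$ (a, b) * f i $ b)"
    unfolding sum_distrib_left by (rule sum.swap)
  also have "\<dots> = (\<Sum>i\<in>S. (A *\<^sub>v f i) $ a)"
    using f by (intro sum.cong refl) (simp add: mult_mat_vec_entry[OF A _ a] del: index_mult_mat_vec)
  also have "\<dots> = vsum l (\<lambda>i. A *\<^sub>v f i) S $ a"
    by (rule vsum_entry[symmetric, OF S c' a])
  finally show "(A *\<^sub>v vsum k f S) $ a = vsum l (\<lambda>i. A *\<^sub>v f i) S $ a" .
qed (use A in simp)

lemma vsum_minus:
  assumes "finite A" "\<And>i. i \<in> A \<Longrightarrow> f i \<in> carrier_vec k" "\<And>i. i \<in> A \<Longrightarrow> h i \<in> carrier_vec k"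
  shows "vsum k (\<lambda>i. f i - h i) A = vsum k f A - vsum k h A"
proof -
  have d: "\<And>i. i \<in> A \<Longrightarrow> f i - h i \<in> carrier_vec k" using assms by simp
  have c: "vsum k f A \<in> carrier_vec k" "vsum k h A \<in> carrier_vec k" "vsum k (\<lambda>i. f i - h i) A \<in> carrier_vec k"
    using assms d by (auto intro!: vsum_carrier)
  have e: "(f i - h i) $ a = f i $ a - h i $ a" if "i \<in> A" "a < k" for i a
    using assms(3)[OF that(1)] that(2) by simp
  show ?thesis
    using assms c d e
    by (intro eq_vec_entriesI[of _ k]) (auto simp: vsum_entry sum_subtractf[symmetric] intro!: sum.cong)
qed

lemma mult_mat_zero_vec [simp]:
  "A \<in> carrier_mat k l \<Longrightarrow> A *\<^sub>v 0\<^sub>v l = (0\<^sub>v k :: 'a :: semiring_0 vec)"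
  by (intro eq_vec_entriesI[of _ k]) (auto simp: scalar_prod_def)

lemma mult_mat_uminus_vec:
  fixes A :: "'a :: ring mat"
  assumes A: "A \<in> carrier_mat k l" and v: "v \<in> carrier_vec l"
  shows "A *\<^sub>v (- v) = - (A *\<^sub>v v)"
proof (rule eq_vec_entriesI[of _ k])
  fix a assume a: "a < k"
  have c: "- v \<in> carrier_vec l" using v by simp
  have "(A *\<^sub>v (- v)) $ a = (\<Sum>i<l. - (A $$ (a, i) * v $ i))"
    unfolding mult_mat_vec_entry[OF A c a] using v by (intro sum.cong) auto
  also have "\<dots> = - (A *\<^sub>v v) $ a" unfolding mult_mat_vec_entry[OF A v a] by (rule sum_negf)
  finally show "(A *\<^sub>v (- v)) $ a = (- (A *\<^sub>v v)) $ a" using A a by simp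
qed (use A v in auto)

text \<open>The solution of the recurrence \<open>c (r + 1) = X c r + h (r + 1)\<close> with \<open>c 0 = 0\<close>.\<close>

definition convolution :: "nat \<Rightarrow> complex mat \<Rightarrow> (nat \<Rightarrow> complex vec) \<Rightarrow> nat \<Rightarrow> complex vec" where
  "convolution k X h r = vsum k (\<lambda>i. X ^\<^sub>m (r - i) *\<^sub>v h i) {1..r}"

lemma convolution_carrier [simp]:
  "X \<in> carrier_mat k k \<Longrightarrow> convolution k X h r \<in> carrier_vec k"
  unfolding convolution_def by (intro vsum_carrier) simp

lemma convolution_0 [simp]: "convolution k X h 0 = 0\<^sub>v k"
  unfolding convolution_def by simp

lemma convolution_Suc:
  assumes X: "X \<in> carrier_mat k k" and h: "\<And>i. h i \<in> carrier_vec k"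
  shows "convolution k X h (Suc r) = X *\<^sub>v convolution k X h r + h (Suc r)"
proof -
  have "{1..Suc r} = insert (Suc r) {1..r}" by auto
  then have "convolution k X h (Suc r) = h (Suc r) + vsum k (\<lambda>i. X ^\<^sub>m (Suc r - i) *\<^sub>v h i) {1..r}"
    unfolding convolution_def using X h by (simp add: vsum_insert)
  also have "vsum k (\<lambda>i. X ^\<^sub>m (Suc r - i) *\<^sub>v h i) {1..r} = vsum k (\<lambda>i. X *\<^sub>v (X ^\<^sub>m (r - i) *\<^sub>v h i)) {1..r}"
  proof (rule vsum_cong)
    fix i assume "i \<in> {1..r}"
    then have "Suc r - i = Suc (r - i)" by auto
    then show "X ^\<^sub>m (Suc r - i) *\<^sub>v h i = X *\<^sub>v (X ^\<^sub>m (r - i) *\<^sub>v h i)"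
      using X h by (simp add: pow_mat_Suc_left[OF X] assoc_mult_mat_vec[of _ k k _ k] del: pow_mat.simps)
  qed (use X in auto)
  also have "\<dots> = X *\<^sub>v convolution k X h r"
    unfolding convolution_def using X h by (intro mult_mat_vec_vsum[symmetric]) auto
  finally show ?thesis using X h comm_add_vec[of "h (Suc r)" k] by simp
qed

lemma affine_recurrence_iff:
  assumes X: "X \<in> carrier_mat k k" and h: "\<And>i. h i \<in> carrier_vec k" and c: "\<And>r. c r \<in> carrier_vec k"
  shows "(\<forall>r. c (Suc r) = X *\<^sub>v c r + h (Suc r)) \<longleftrightarrow>
    (\<forall>r. c r = X ^\<^sub>m r *\<^sub>v c 0 + convolution k X h r)"
proof -
  define d where "d r = X ^\<^sub>m r *\<^sub>v c 0 + convolution k X h r" for r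
  have d0: "d 0 = c 0" unfolding d_def using X c by simp
  have dS: "d (Suc r) = X *\<^sub>v d r + h (Suc r)" for r
  proof -
    have "d (Suc r) = X *\<^sub>v (X ^\<^sub>m r *\<^sub>v c 0) + (X *\<^sub>v convolution k X h r + h (Suc r))"
      unfolding d_def convolution_Suc[OF X h] using X c
      by (simp add: pow_mat_Suc_left[OF X] assoc_mult_mat_vec[of _ k k _ k] del: pow_mat.simps)
    also have "\<dots> = X *\<^sub>v (X ^\<^sub>m r *\<^sub>v c 0) + X *\<^sub>v convolution k X h r + h (Suc r)"
      using X c h by (intro assoc_add_vec[symmetric, of _ k]) auto
    also have "X *\<^sub>v (X ^\<^sub>m r *\<^sub>v c 0) + X *\<^sub>v convolution k X h r = X *\<^sub>v d r"
      unfolding d_def using X c by (simp add: mult_add_distrib_mat_vec[of _ k k])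
    finally show ?thesis .
  qed
  show ?thesis
  proof
    assume rec: "\<forall>r. c (Suc r) = X *\<^sub>v c r + h (Suc r)"
    have "c r = d r" for r by (induction r) (simp_all add: d0 rec dS)
    then show "\<forall>r. c r = X ^\<^sub>m r *\<^sub>v c 0 + convolution k X h r" unfolding d_def by blast
  next
    assume "\<forall>r. c r = X ^\<^sub>m r *\<^sub>v c 0 + convolution k X h r"
    then have "c r = d r" for r unfolding d_def by blast
    then show "\<forall>r. c (Suc r) = X *\<^sub>v c r + h (Suc r)" using dS by simp
  qed
qed

text \<open>Up to its sign, the solution of \<open>d r = X (d (r + 1) - h (r + 1))\<close> when \<open>X\<^sup>n\<^sup>+\<^sup>1 = 0\<close>.\<close>

definition look_ahead :: "nat \<Rightarrow> complex mat \<Rightarrow> (nat \<Rightarrow> complex vec) \<Rightarrow> nat \<Rightarrow> nat \<Rightarrow> complex vec" where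
  "look_ahead k X h n r = vsum k (\<lambda>j. X ^\<^sub>m j *\<^sub>v h (j + r)) {1..n}"

lemma look_ahead_carrier [simp]:
  "X \<in> carrier_mat k k \<Longrightarrow> look_ahead k X h n r \<in> carrier_vec k"
  unfolding look_ahead_def by (intro vsum_carrier) simp

lemma look_ahead_Suc:
  assumes X: "X \<in> carrier_mat k k" and h: "\<And>i. h i \<in> carrier_vec k"
  shows "look_ahead k X h (Suc n) r = X ^\<^sub>m Suc n *\<^sub>v h (Suc n + r) + look_ahead k X h n r"
proof -
  have "{1..Suc n} = insert (Suc n) {1..n}" by auto
  then show ?thesis unfolding look_ahead_def using X h by (simp add: vsum_insert del: pow_mat.simps)
qed

lemma look_ahead_step:
  assumes X: "X \<in> carrier_mat k k" and h: "\<And>i. h i \<in> carrier_vec k"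
  shows "X *\<^sub>v (look_ahead k X h n (Suc r) + h (Suc r)) = look_ahead k X h (Suc n) r"
proof (induction n)
  case 0
  have "look_ahead k X h 0 (Suc r) = 0\<^sub>v k" "look_ahead k X h 0 r = 0\<^sub>v k"
    unfolding look_ahead_def by simp_all
  then show ?case using X h by (simp add: look_ahead_Suc[OF X h])
next
  case (Suc n)
  let ?x = "X ^\<^sub>m Suc n *\<^sub>v h (Suc n + Suc r)" and ?l = "look_ahead k X h n (Suc r)"
  have "X *\<^sub>v (look_ahead k X h (Suc n) (Suc r) + h (Suc r)) = X *\<^sub>v (?x + (?l + h (Suc r)))"
    unfolding look_ahead_Suc[OF X h] using X h by (simp add: assoc_add_vec[of _ k] del: pow_mat.simps)
  also have "\<dots> = X *\<^sub>v ?x + X *\<^sub>v (?l + h (Suc r))"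
    using X h by (intro mult_add_distrib_mat_vec[of _ k k]) auto
  also have "X *\<^sub>v ?x = X ^\<^sub>m Suc (Suc n) *\<^sub>v h (Suc (Suc n) + r)"
    using X h by (simp add: pow_mat_Suc_left[OF X, of "Suc n"] assoc_mult_mat_vec[of _ k k _ k] del: pow_mat.simps)
  finally show ?case 
    using look_ahead_Suc[where n = "Suc n" and r = r and h = h, OF X h] Suc by simp
qed

text \<open>Iterating the recurrence expresses \<open>d r\<close> through \<open>X\<^sup>j d (r + j)\<close>, which is \<open>0\<close> for large \<open>j\<close>, so no
  freedom remains.\<close>

lemma nilpotent_recurrence_iff:
  assumes X: "X \<in> carrier_mat k k" and h: "\<And>i. h i \<in> carrier_vec k" and d: "\<And>r. d r \<in> carrier_vec k"
    and nil: "X ^\<^sub>m Suc n = 0\<^sub>m k k"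
  shows "(\<forall>r. d r = X *\<^sub>v (d (Suc r) - h (Suc r))) \<longleftrightarrow> (\<forall>r. d r = - look_ahead k X h n r)"
proof -
  have [simp]: "dim_vec (h i) = k" "dim_vec (d i) = k" "dim_vec (look_ahead k X h j r) = k" for i j r
    using h[of i] d[of i] look_ahead_carrier[OF X, of h j r] by auto
  have last: "look_ahead k X h (Suc n) r = look_ahead k X h n r" for r
  proof -
    have "0\<^sub>m k k *\<^sub>v h (Suc n + r) = 0\<^sub>v k" using h by simp
    then show ?thesis unfolding look_ahead_Suc[OF X h] nil using X by simp
  qed
  have neg: "X *\<^sub>v (- v) = - (X *\<^sub>v v)" if "v \<in> carrier_vec k" for v
    using that X by (intro eq_vec_entriesI[of _ k])
      (auto simp: mult_mat_vec_entry[of _ k k] sum_negf simp del: index_mult_mat_vec)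
  have step: "- look_ahead k X h n r = X *\<^sub>v (- look_ahead k X h n (Suc r) - h (Suc r))" for r
  proof -
    have "- look_ahead k X h n (Suc r) - h (Suc r) = - (look_ahead k X h n (Suc r) + h (Suc r))"
      using look_ahead_carrier[OF X] h by (intro eq_vec_entriesI[of _ k]) auto
    then show ?thesis
      using X h by (simp add: neg look_ahead_step last)
  qed
  show ?thesis
  proof
    assume rec: "\<forall>r. d r = X *\<^sub>v (d (Suc r) - h (Suc r))"
    have iter: "d r = X ^\<^sub>m j *\<^sub>v d (j + r) - look_ahead k X h j r" for j r
    proof (induction j arbitrary: r)
      case 0
      have "look_ahead k X h 0 r = 0\<^sub>v k" unfolding look_ahead_def by simp
      then show ?case using X d by simp
    next
      case (Suc j)
      let ?x = "X ^\<^sub>m j *\<^sub>v d (Suc j + r)"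
      have "d r = X *\<^sub>v (d (Suc r) - h (Suc r))" using rec by blast
      also have "d (Suc r) - h (Suc r) = ?x - (look_ahead k X h j (Suc r) + h (Suc r))"
        unfolding Suc[of "Suc r"] using X h d look_ahead_carrier[OF X, of h j "Suc r"]
        by (intro eq_vec_entriesI[of _ k]) auto
      also have "X *\<^sub>v \<dots> = X *\<^sub>v ?x - X *\<^sub>v (look_ahead k X h j (Suc r) + h (Suc r))"
        using X h d by (intro mult_minus_distrib_mat_vec[of _ k k]) auto
      finally show ?case
        using X d by (simp add: look_ahead_step[where h = h, OF X h] pow_mat_Suc_left[OF X]
            assoc_mult_mat_vec[of _ k k _ k] del: pow_mat.simps)
    qed
    have "d r = - look_ahead k X h n r" for r
    proof -
      have "0\<^sub>m k k *\<^sub>v d (Suc n + r) = 0\<^sub>v k" using d by simp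
      then have "d r = 0\<^sub>v k - look_ahead k X h n r" using iter[of r "Suc n"] unfolding nil last by simp
      then show ?thesis using look_ahead_carrier[OF X, of h n r] by auto
    qed
    then show "\<forall>r. d r = - look_ahead k X h n r" ..
  next
    assume all: "\<forall>r. d r = - look_ahead k X h n r"
    show "\<forall>r. d r = X *\<^sub>v (d (Suc r) - h (Suc r))"
    proof
      fix r
      show "d r = X *\<^sub>v (d (Suc r) - h (Suc r))"
        unfolding spec[OF all, of r] spec[OF all, of "Suc r"] by (rule step)
    qed
  qed
qed

text \<open>All blocks of the Jordan normal form have the eigenvalue \<open>0\<close>.\<close>

lemma spectral_radius_zero_nilpotent:
  fixes A :: "complex mat"
  assumes A: "A \<in> carrier_mat k k" and sr: "0 < k \<Longrightarrow> spectral_radius A = 0"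
  shows "\<exists>n>0. A ^\<^sub>m n = 0\<^sub>m k k"
proof -
  obtain as where as: "char_poly A = (\<Prod>a\<leftarrow>as. [:- a, 1:])" using char_poly_factorized[OF A] by blast
  obtain n_as where jnf: "jordan_nf A n_as" using jordan_nf_exists[OF A as] by blast
  from jnf have sim: "similar_mat A (jordan_matrix n_as)" and n0: "0 \<notin> fst ` set n_as"
    unfolding jordan_nf_def by auto
  obtain Q Q' where wit: "similar_mat_wit A (jordan_matrix n_as) Q Q'"
    using sim unfolding similar_mat_def by blast
  have dimJ: "jordan_matrix n_as \<in> carrier_mat k k" and QQ: "Q \<in> carrier_mat k k" "Q' \<in> carrier_mat k k"
    using similar_mat_witD2[OF A wit] by auto
  have a0: "a = 0" if na: "(n, a) \<in> set n_as" for n a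
  proof -
    have "0 < n" using n0 na by (force intro: Nat.gr0I)
    have "poly (char_poly A) a = 0"
    proof -
      have "char_poly A = (\<Prod>(n, a)\<leftarrow>n_as. [:- a, 1:] ^ n)" by (rule jordan_nf_char_poly[OF jnf])
      then have "[:- a, 1:] ^ n dvd char_poly A"
        using split_list[OF na] by auto
      then have "[:- a, 1:] dvd char_poly A" using \<open>0 < n\<close> by (meson dvd_power dvd_trans)
      then show ?thesis by (simp add: poly_eq_0_iff_dvd)
    qed
    then have ev: "eigenvalue A a" using eigenvalue_root_char_poly[OF A] by simp
    have "0 < k"
    proof (rule Nat.gr0I)
      assume "k = 0"
      then show False using ev A unfolding eigenvalue_def eigenvector_def by auto
    qed
    then have "norm a \<le> 0"
      using spectral_radius_mem_max(2)[OF A, of "norm a"] sr ev unfolding spectrum_def by auto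
    then show "a = 0" by simp
  qed
  define N where "N = Suc (sum_list (map fst n_as))"
  have block: "jordan_block n a ^\<^sub>m N = 0\<^sub>m n n" if na: "(n, a) \<in> set n_as" for n a
  proof -
    have "n \<le> sum_list (map fst n_as)" using na by (intro member_le_sum_list) (auto intro: rev_image_eqI)
    then have "n < N" unfolding N_def by simp
    then show ?thesis unfolding jordan_block_pow a0[OF na]
      by (intro eq_matI) auto
  qed
  have "jordan_matrix n_as ^\<^sub>m N = diag_block_mat (map (\<lambda>(n, a). jordan_block n a ^\<^sub>m N) n_as)"
    by (rule jordan_matrix_pow)
  also have "map (\<lambda>(n, a). jordan_block n a ^\<^sub>m N) n_as = map (\<lambda>(n, a). 0\<^sub>m n n) n_as"
    using block by (intro map_cong) auto
  also have "diag_block_mat \<dots> = 0\<^sub>m (sum_list (map fst n_as)) (sum_list (map fst n_as))"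
    by (induction n_as) (auto simp: Let_def)
  finally have J: "jordan_matrix n_as ^\<^sub>m N = 0\<^sub>m k k"
    using dimJ by auto
  have "A ^\<^sub>m N = Q * jordan_matrix n_as ^\<^sub>m N * Q'"
    by (rule similar_mat_wit_pow_id[OF wit])
  then have "A ^\<^sub>m N = 0\<^sub>m k k" unfolding J using QQ by simp
  moreover have "0 < N" unfolding N_def by simp
  ultimately show ?thesis by blast
qed

section \<open>The equation above level \<open>0\<close>\<close>

lemma mat_mult_vec_eqI:
  assumes "A * B = C" "A \<in> carrier_mat k l" "B \<in> carrier_mat l q" "v \<in> carrier_vec q"
  shows "A *\<^sub>v (B *\<^sub>v v) = C *\<^sub>v v"
  using assoc_mult_mat_vec[OF assms(2-4)] assms(1) by simp

text \<open>The algebra of the difference equation, separated from its probabilistic origin. The matrices \<open>U\<close>, \<open>N\<close>,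
  \<open>R\<close> and \<open>G\<close> factor the symbol of the equation, and \<open>L\<close>, \<open>K\<close>, \<open>E\<close>, \<open>F\<close> split the space into the parts
  on which \<open>Gh\<close> is invertible and nilpotent. The exponent of nilpotency is written \<open>n + 1\<close>, because \<open>n\<close>
  is the number of levels that the solution looks ahead.\<close>

locale poisson_factorization =
  fixes m p q n :: nat
    and D Z T G Gh W Wi N U R L K E F V1 V1i V0 :: "complex mat" and g :: "nat \<Rightarrow> complex vec"
  assumes square_carriers [simp]: "D \<in> carrier_mat m m" "Z \<in> carrier_mat m m" "T \<in> carrier_mat m m"
      "G \<in> carrier_mat m m" "Gh \<in> carrier_mat m m" "W \<in> carrier_mat m m" "Wi \<in> carrier_mat m m"
      "N \<in> carrier_mat m m" "U \<in> carrier_mat m m" "R \<in> carrier_mat m m"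
    and block_carriers [simp]: "L \<in> carrier_mat m p" "K \<in> carrier_mat m q" "E \<in> carrier_mat p m"
      "F \<in> carrier_mat q m" "V1 \<in> carrier_mat p p" "V1i \<in> carrier_mat p p" "V0 \<in> carrier_mat q q"
    and g [simp]: "\<And>r. g r \<in> carrier_vec m"
    and U: "U = Z + T * G" and UG: "(1\<^sub>m m - U) * G = D"
    and UN: "(1\<^sub>m m - U) * N = 1\<^sub>m m" and NU: "N * (1\<^sub>m m - U) = 1\<^sub>m m"
    and RU: "R * (1\<^sub>m m - U) = T"
    and W_eq: "W + N = G * W * R"
    and GhW: "Gh * W = W * R" and WiW: "Wi * W = 1\<^sub>m m" and WWi: "W * Wi = 1\<^sub>m m"
    and LE: "L * E + K * F = 1\<^sub>m m" and GhL: "Gh * L = L * V1" and GhK: "Gh * K = K * V0"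
    and EGh: "E * Gh = V1 * E" and FGh: "F * Gh = V0 * F"
    and V1: "V1 * V1i = 1\<^sub>m p" "V1i * V1 = 1\<^sub>m p"
    and nil: "V0 ^\<^sub>m Suc n = 0\<^sub>m q q"
begin

lemma all_dims [simp]:
  "dim_row D = m" "dim_row Z = m" "dim_row T = m" "dim_row G = m" "dim_row Gh = m" "dim_row W = m"
  "dim_row Wi = m" "dim_row N = m" "dim_row U = m" "dim_row R = m" "dim_col D = m" "dim_col Z = m"
  "dim_col T = m" "dim_col G = m" "dim_col Gh = m" "dim_col W = m" "dim_col Wi = m" "dim_col N = m"
  "dim_col U = m" "dim_col R = m" "dim_row L = m" "dim_col L = p" "dim_row K = m" "dim_col K = q"
  "dim_row E = p" "dim_col E = m" "dim_row F = q" "dim_col F = m" "dim_row V1 = p" "dim_col V1 = p"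
  "dim_row V1i = p" "dim_col V1i = p" "dim_row V0 = q" "dim_col V0 = q" "dim_vec (g r) = m"
  using square_carriers block_carriers g[of r] by (auto simp del: square_carriers block_carriers g)

lemmas vec_simps =
  add_mult_distrib_mat_vec[of _ m m] mult_add_distrib_mat_vec[of _ m m]
  minus_mult_distrib_mat_vec[of _ m m] mult_minus_distrib_mat_vec[of _ m m]
  assoc_mult_mat_vec[of _ m m _ m]
  mult_add_distrib_mat_vec[of _ m p] mult_minus_distrib_mat_vec[of _ m p]
  mult_add_distrib_mat_vec[of _ m q] mult_minus_distrib_mat_vec[of _ m q]
  mult_add_distrib_mat_vec[of _ p m] mult_minus_distrib_mat_vec[of _ p m]
  mult_add_distrib_mat_vec[of _ q m] mult_minus_distrib_mat_vec[of _ q m]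

lemma identities_on_vec:
  assumes v: "v \<in> carrier_vec m"
  shows "G *\<^sub>v v - U *\<^sub>v (G *\<^sub>v v) = D *\<^sub>v v" "N *\<^sub>v v - U *\<^sub>v (N *\<^sub>v v) = v"
    "N *\<^sub>v (v - U *\<^sub>v v) = v" "R *\<^sub>v (v - U *\<^sub>v v) = T *\<^sub>v v"
    "W *\<^sub>v v + N *\<^sub>v v = G *\<^sub>v (W *\<^sub>v (R *\<^sub>v v))" "Gh *\<^sub>v (W *\<^sub>v v) = W *\<^sub>v (R *\<^sub>v v)"
    "Wi *\<^sub>v (W *\<^sub>v v) = v" "W *\<^sub>v (Wi *\<^sub>v v) = v"
    "L *\<^sub>v (E *\<^sub>v v) + K *\<^sub>v (F *\<^sub>v v) = v"
    "E *\<^sub>v (Gh *\<^sub>v v) = V1 *\<^sub>v (E *\<^sub>v v)" "F *\<^sub>v (Gh *\<^sub>v v) = V0 *\<^sub>v (F *\<^sub>v v)"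
    "U *\<^sub>v v = Z *\<^sub>v v + T *\<^sub>v (G *\<^sub>v v)"
proof -
  have IU: "v' - U *\<^sub>v v' = (1\<^sub>m m - U) *\<^sub>v v'" if "v' \<in> carrier_vec m" for v'
    using that by (simp add: vec_simps)
  have c: "1\<^sub>m m - U \<in> carrier_mat m m" by simp
  show "G *\<^sub>v v - U *\<^sub>v (G *\<^sub>v v) = D *\<^sub>v v"
    using v mat_mult_vec_eqI[OF UG c _ v] by (simp add: IU)
  show "N *\<^sub>v v - U *\<^sub>v (N *\<^sub>v v) = v"
    using v mat_mult_vec_eqI[OF UN c _ v] by (simp add: IU)
  show "N *\<^sub>v (v - U *\<^sub>v v) = v"
    using v mat_mult_vec_eqI[OF NU _ c v, of m] by (simp add: IU)
  show "R *\<^sub>v (v - U *\<^sub>v v) = T *\<^sub>v v"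
    using v mat_mult_vec_eqI[OF RU _ c v, of m] by (simp add: IU)
  show "W *\<^sub>v v + N *\<^sub>v v = G *\<^sub>v (W *\<^sub>v (R *\<^sub>v v))"
    using v arg_cong[OF W_eq, of "\<lambda>X. X *\<^sub>v v"] by (simp add: vec_simps)
  show "Gh *\<^sub>v (W *\<^sub>v v) = W *\<^sub>v (R *\<^sub>v v)"
    using v arg_cong[OF GhW, of "\<lambda>X. X *\<^sub>v v"] by (simp add: vec_simps)
  show "Wi *\<^sub>v (W *\<^sub>v v) = v" "W *\<^sub>v (Wi *\<^sub>v v) = v"
    using v mat_mult_vec_eqI[OF WiW _ _ v, of m m] mat_mult_vec_eqI[OF WWi _ _ v, of m m] by simp_all
  show "L *\<^sub>v (E *\<^sub>v v) + K *\<^sub>v (F *\<^sub>v v) = v"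
  proof -
    have "(L * E + K * F) *\<^sub>v v = (L * E) *\<^sub>v v + (K * F) *\<^sub>v v"
      using v by (intro add_mult_distrib_mat_vec[of _ m m]) auto
    then show ?thesis
      using v unfolding LE by (simp add: assoc_mult_mat_vec[of L m p E m] assoc_mult_mat_vec[of K m q F m])
  qed
  show "E *\<^sub>v (Gh *\<^sub>v v) = V1 *\<^sub>v (E *\<^sub>v v)"
    using v mat_mult_vec_eqI[OF EGh _ _ v, of p m] assoc_mult_mat_vec[of V1 p p E m v] by simp
  show "F *\<^sub>v (Gh *\<^sub>v v) = V0 *\<^sub>v (F *\<^sub>v v)"
    using v mat_mult_vec_eqI[OF FGh _ _ v, of q m] assoc_mult_mat_vec[of V0 q q F m v] by simp
  show "U *\<^sub>v v = Z *\<^sub>v v + T *\<^sub>v (G *\<^sub>v v)"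
    using v unfolding U by (simp add: vec_simps)
qed

lemma GhL_vec: "v \<in> carrier_vec p \<Longrightarrow> Gh *\<^sub>v (L *\<^sub>v v) = L *\<^sub>v (V1 *\<^sub>v v)"
  using mat_mult_vec_eqI[OF GhL, of m m p v] assoc_mult_mat_vec[of L m p V1 p v] by simp

lemma GhK_vec: "v \<in> carrier_vec q \<Longrightarrow> Gh *\<^sub>v (K *\<^sub>v v) = K *\<^sub>v (V0 *\<^sub>v v)"
  using mat_mult_vec_eqI[OF GhK, of m m q v] assoc_mult_mat_vec[of K m q V0 q v] by simp

lemma V1_vec: "v \<in> carrier_vec p \<Longrightarrow> V1 *\<^sub>v (V1i *\<^sub>v v) = v"
  "v \<in> carrier_vec p \<Longrightarrow> V1i *\<^sub>v (V1 *\<^sub>v v) = v"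
  using mat_mult_vec_eqI[OF V1(1), of p p p v] mat_mult_vec_eqI[OF V1(2), of p p p v] by simp_all

lemma residual_eq:
  assumes x: "x \<in> carrier_vec m" "y \<in> carrier_vec m" "z \<in> carrier_vec m"
  defines "q0 \<equiv> y - G *\<^sub>v x" and "q1 \<equiv> z - G *\<^sub>v y"
  shows "y - (D *\<^sub>v x + Z *\<^sub>v y + T *\<^sub>v z) = q0 - U *\<^sub>v q0 - T *\<^sub>v q1"
proof (rule eq_vec_entriesI[of _ m])
  fix a assume a: "a < m"
  show "(y - (D *\<^sub>v x + Z *\<^sub>v y + T *\<^sub>v z)) $ a = (q0 - U *\<^sub>v q0 - T *\<^sub>v q1) $ a"
    using x a arg_cong[OF identities_on_vec(1)[OF x(1), symmetric], of "\<lambda>v. v $ a"] arg_cong[OF identities_on_vec(12)[OF x(2)], of "\<lambda>v. v $ a"]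
    unfolding q0_def q1_def by (simp add: vec_simps del: index_mult_mat_vec)
qed (use x in \<open>auto simp: q0_def q1_def\<close>)

text \<open>The residual sequence \<open>s\<close> satisfies a first-order backward recurrence driven by \<open>R\<close>, and \<open>W\<close>
  conjugates \<open>R\<close> into \<open>Gh\<close>. Subtracting \<open>e\<close> turns the remaining recurrence for \<open>u\<close> into one that
  \<open>G\<close> drives forward.\<close>

lemma interior_iff_decoupled:
  assumes u: "\<And>r. u r \<in> carrier_vec m"
  shows "(\<forall>r. u (Suc r) - (D *\<^sub>v u r + Z *\<^sub>v u (Suc r) + T *\<^sub>v u (Suc (Suc r))) = g (Suc r)) \<longleftrightarrow>
    (\<exists>e. (\<forall>r. e r \<in> carrier_vec m) \<and>
      (\<forall>r. e r = Gh *\<^sub>v (e (Suc r) - W *\<^sub>v g (Suc r))) \<and>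
      (\<forall>r. u (Suc r) - e (Suc r) = G *\<^sub>v (u r - e r) - W *\<^sub>v g (Suc r)))" (is "?l \<longleftrightarrow> ?r")
proof
  define d where "d r = u (Suc r) - G *\<^sub>v u r" for r
  have d: "d r \<in> carrier_vec m" for r unfolding d_def using u by simp
  have ud [simp]: "dim_vec (u r) = m" "dim_vec (d r) = m" for r using u[of r] d[of r] by auto
  have res: "u (Suc r) - (D *\<^sub>v u r + Z *\<^sub>v u (Suc r) + T *\<^sub>v u (Suc (Suc r)))
      = d r - U *\<^sub>v d r - T *\<^sub>v d (Suc r)" for r
    unfolding d_def by (rule residual_eq[OF u u u])
  show ?r if l: ?l
  proof -
    define s where "s r = U *\<^sub>v d r - d r" for r
    have s: "s r \<in> carrier_vec m" for r unfolding s_def using d by simp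
    have sd [simp]: "dim_vec (s r) = m" for r using s[of r] by auto
    have Rs: "R *\<^sub>v s (Suc r) = s r + g (Suc r)" for r
    proof (rule eq_vec_entriesI[of _ m])
      fix a assume a: "a < m"
      have 1: "d r - U *\<^sub>v d r - T *\<^sub>v d (Suc r) = g (Suc r)" using l unfolding res by blast
      have 2: "R *\<^sub>v d (Suc r) - R *\<^sub>v (U *\<^sub>v d (Suc r)) = T *\<^sub>v d (Suc r)"
        using identities_on_vec(4)[OF d[of "Suc r"]] d by (simp add: vec_simps)
      show "(R *\<^sub>v s (Suc r)) $ a = (s r + g (Suc r)) $ a"
        using a d arg_cong[OF 1[symmetric], of "\<lambda>v. v $ a"] arg_cong[OF 2[symmetric], of "\<lambda>v. v $ a"]
        unfolding s_def by (simp add: vec_simps algebra_simps del: index_mult_mat_vec)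
    qed (use s in auto)
    define e where "e r = W *\<^sub>v (R *\<^sub>v s r)" for r
    have e: "e r \<in> carrier_vec m" for r unfolding e_def by simp
    have ed [simp]: "dim_vec (e r) = m" for r using e[of r] by auto
    have Ws: "e (Suc r) - W *\<^sub>v g (Suc r) = W *\<^sub>v s r" for r
      unfolding e_def Rs using s by (intro eq_vec_entriesI[of _ m]) (auto simp: vec_simps simp del: index_mult_mat_vec)
    have E2: "e r = Gh *\<^sub>v (e (Suc r) - W *\<^sub>v g (Suc r))" for r
      unfolding Ws identities_on_vec(6)[OF s] by (rule e_def)
    have E3: "u (Suc r) - e (Suc r) = G *\<^sub>v (u r - e r) - W *\<^sub>v g (Suc r)" for r
    proof (rule eq_vec_entriesI[of _ m])
      fix a assume a: "a < m"
      have "N *\<^sub>v d r - N *\<^sub>v (U *\<^sub>v d r) = d r"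
        using identities_on_vec(3)[OF d[of r]] d by (simp add: vec_simps)
      from arg_cong[OF this, of "\<lambda>v. v $ a"]
      have 1: "(N *\<^sub>v s r) $ a = - (u (Suc r) $ a - (G *\<^sub>v u r) $ a)"
        using a d[of r] u arg_cong[OF d_def[of r], of "\<lambda>v. v $ a"]
        by (simp add: vec_simps s_def del: index_mult_mat_vec) (simp add: algebra_simps)
      have 2: "(W *\<^sub>v s r) $ a + (N *\<^sub>v s r) $ a = (G *\<^sub>v e r) $ a"
        using a arg_cong[OF identities_on_vec(5)[OF s[of r]], of "\<lambda>v. v $ a"]
        unfolding e_def by (simp del: index_mult_mat_vec)
      have 3: "e (Suc r) $ a - (W *\<^sub>v g (Suc r)) $ a = (W *\<^sub>v s r) $ a"
        using a arg_cong[OF Ws[of r], of "\<lambda>v. v $ a"] by (simp del: index_mult_mat_vec)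
      have "u (Suc r) $ a - e (Suc r) $ a = (G *\<^sub>v u r) $ a - (G *\<^sub>v e r) $ a - (W *\<^sub>v g (Suc r)) $ a"
      proof -
        have "e (Suc r) $ a = (W *\<^sub>v s r) $ a + (W *\<^sub>v g (Suc r)) $ a" using 3 by (simp add: diff_eq_eq)
        moreover have "(W *\<^sub>v s r) $ a = (G *\<^sub>v e r) $ a - (N *\<^sub>v s r) $ a" using 2 by (simp add: eq_diff_eq)
        ultimately show ?thesis using 1 by simp
      qed
      then show "(u (Suc r) - e (Suc r)) $ a = (G *\<^sub>v (u r - e r) - W *\<^sub>v g (Suc r)) $ a"
        using a u e by (simp add: vec_simps del: index_mult_mat_vec)
    qed (use u e in auto)
    show ?r using e E2 E3 by blast
  qed
  show ?l if r: ?r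
  proof -
    obtain e where e: "\<And>r. e r \<in> carrier_vec m"
      and E2: "\<And>r. e r = Gh *\<^sub>v (e (Suc r) - W *\<^sub>v g (Suc r))"
      and E3: "\<And>r. u (Suc r) - e (Suc r) = G *\<^sub>v (u r - e r) - W *\<^sub>v g (Suc r)"
      using r by blast
    have ed [simp]: "dim_vec (e r) = m" for r using e[of r] by auto
    define s where "s r = Wi *\<^sub>v (e (Suc r) - W *\<^sub>v g (Suc r))" for r
    have s: "s r \<in> carrier_vec m" for r unfolding s_def by simp
    have sd [simp]: "dim_vec (s r) = m" for r using s[of r] by auto
    have Ws: "W *\<^sub>v s r = e (Suc r) - W *\<^sub>v g (Suc r)" for r
      unfolding s_def using e by (intro identities_on_vec(8)) simp
    have WRs: "W *\<^sub>v (R *\<^sub>v s r) = e r" for r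
      using identities_on_vec(6)[OF s[of r]] E2[of r] unfolding Ws by simp
    have dN: "d r = - (N *\<^sub>v s r)" for r
    proof (rule eq_vec_entriesI[of _ m])
      fix a assume a: "a < m"
      show "d r $ a = (- (N *\<^sub>v s r)) $ a"
      proof -
        have 1: "(W *\<^sub>v s r) $ a = e (Suc r) $ a - (W *\<^sub>v g (Suc r)) $ a"
          using a arg_cong[OF Ws[of r], of "\<lambda>v. v $ a"] by (simp del: index_mult_mat_vec)
        have "u (Suc r) $ a - e (Suc r) $ a = (G *\<^sub>v u r) $ a - (G *\<^sub>v e r) $ a - (W *\<^sub>v g (Suc r)) $ a"
          using a u e arg_cong[OF E3[of r], of "\<lambda>v. v $ a"] by (simp add: vec_simps del: index_mult_mat_vec)
        then have 2: "u (Suc r) $ a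
            = e (Suc r) $ a + ((G *\<^sub>v u r) $ a - (G *\<^sub>v e r) $ a - (W *\<^sub>v g (Suc r)) $ a)"
          by (simp add: diff_eq_eq)
        have "(W *\<^sub>v s r) $ a + (N *\<^sub>v s r) $ a = (G *\<^sub>v e r) $ a"
          using a arg_cong[OF identities_on_vec(5)[OF s[of r]], of "\<lambda>v. v $ a"]
          unfolding WRs by (simp del: index_mult_mat_vec)
        then have 3: "(N *\<^sub>v s r) $ a = (G *\<^sub>v e r) $ a - (W *\<^sub>v s r) $ a"
          by (simp add: eq_diff_eq add.commute)
        have "d r $ a = u (Suc r) $ a - (G *\<^sub>v u r) $ a"
          unfolding d_def using a by (simp del: index_mult_mat_vec)
        then show ?thesis using a by (simp add: 1 2 3 del: index_mult_mat_vec)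
      qed
    qed (use d in auto)
    note neg = mult_mat_uminus_vec[of _ m m]
    have Ud: "U *\<^sub>v d r - d r = s r" for r
    proof (rule eq_vec_entriesI[of _ m])
      fix a assume a: "a < m"
      have "(N *\<^sub>v s r) $ a - (U *\<^sub>v (N *\<^sub>v s r)) $ a = s r $ a"
        using a arg_cong[OF identities_on_vec(2)[OF s[of r]], of "\<lambda>v. v $ a"] by (simp del: index_mult_mat_vec)
      then show "(U *\<^sub>v d r - d r) $ a = s r $ a"
        unfolding dN using a by (simp add: neg del: index_mult_mat_vec)
    qed (use s d in auto)
    have Td: "T *\<^sub>v d r = - (Wi *\<^sub>v e r)" for r
    proof -
      have "T *\<^sub>v d r = R *\<^sub>v (d r - U *\<^sub>v d r)" using identities_on_vec(4)[OF d] by simp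
      also have "d r - U *\<^sub>v d r = - s r"
        unfolding Ud[symmetric] by (intro eq_vec_entriesI[of _ m]) (auto simp: d simp del: index_mult_mat_vec)
      also have "R *\<^sub>v (- s r) = - (R *\<^sub>v s r)" by (rule neg) (use s in simp_all)
      also have "R *\<^sub>v s r = Wi *\<^sub>v (W *\<^sub>v (R *\<^sub>v s r))" by (rule identities_on_vec(7)[symmetric]) simp
      finally show ?thesis unfolding WRs .
    qed
    show ?l
    proof
      fix r
      show "u (Suc r) - (D *\<^sub>v u r + Z *\<^sub>v u (Suc r) + T *\<^sub>v u (Suc (Suc r))) = g (Suc r)"
        unfolding res
      proof (rule eq_vec_entriesI[of _ m])
        fix a assume a: "a < m"
        have 1: "s r = Wi *\<^sub>v e (Suc r) - g (Suc r)"
          unfolding s_def using e identities_on_vec(7)[OF g[of "Suc r"]] by (simp add: vec_simps)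
        show "(d r - U *\<^sub>v d r - T *\<^sub>v d (Suc r)) $ a = g (Suc r) $ a"
          using a arg_cong[OF Ud[of r], of "\<lambda>v. v $ a"] arg_cong[OF 1, of "\<lambda>v. v $ a"]
          unfolding Td by (simp add: algebra_simps del: index_mult_mat_vec)
      qed (use d in auto)
    qed
  qed
qed

text \<open>The sequence \<open>e\<close> that corresponds to \<open>y\<close>. On the invertible part of \<open>Gh\<close> it is driven forward by
  \<open>V\<^sub>1\<^sup>-\<^sup>1\<close>.\<close>

definition expanding :: "complex vec \<Rightarrow> nat \<Rightarrow> complex vec" where
  "expanding y r = L *\<^sub>v (V1i ^\<^sub>m r *\<^sub>v y + convolution p V1i (\<lambda>i. E *\<^sub>v (W *\<^sub>v g i)) r)
    - K *\<^sub>v look_ahead q V0 (\<lambda>i. F *\<^sub>v (W *\<^sub>v g i)) n r"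

lemma expanding_carrier [simp]: "expanding y r \<in> carrier_vec m"
  unfolding expanding_def by simp

lemma expanding_dim [simp]: "dim_vec (expanding y r) = m"
  unfolding expanding_def by simp

text \<open>In the coordinates that split \<open>Gh\<close>, the backward recurrence can be run forward on the
  invertible part, where it leaves one free vector, and has a unique solution on the nilpotent
  part.\<close>

lemma backward_recurrence_iff:
  assumes e: "\<And>r. e r \<in> carrier_vec m"
  shows "(\<forall>r. e r = Gh *\<^sub>v (e (Suc r) - W *\<^sub>v g (Suc r))) \<longleftrightarrow>
    (\<exists>y\<in>carrier_vec p. \<forall>r. e r = expanding y r)" (is "?l \<longleftrightarrow> ?r")
proof
  define a where "a i = E *\<^sub>v (W *\<^sub>v g i)" for i
  define b where "b i = F *\<^sub>v (W *\<^sub>v g i)" for i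
  have a [simp]: "a i \<in> carrier_vec p" and b [simp]: "b i \<in> carrier_vec q" for i
    unfolding a_def b_def by simp_all
  show ?r if l: ?l
  proof -
    define c where "c r = E *\<^sub>v e r" for r
    define d where "d r = F *\<^sub>v e r" for r
    have c: "c r \<in> carrier_vec p" and d: "d r \<in> carrier_vec q" for r unfolding c_def d_def by simp_all
    have [simp]: "dim_vec (c r) = p" "dim_vec (a r) = p" for r using c[of r] a[of r] by auto
    have "d r = V0 *\<^sub>v (d (Suc r) - b (Suc r))" for r
    proof -
      have "d r = F *\<^sub>v (Gh *\<^sub>v (e (Suc r) - W *\<^sub>v g (Suc r)))" unfolding d_def using l by metis
      also have "\<dots> = V0 *\<^sub>v (F *\<^sub>v (e (Suc r) - W *\<^sub>v g (Suc r)))" using e by (intro identities_on_vec(11)) simp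
      finally show ?thesis unfolding b_def d_def using e by (simp add: vec_simps)
    qed
    then have "\<forall>r. d r = V0 *\<^sub>v (d (Suc r) - b (Suc r))" ..
    then have "\<forall>r. d r = - look_ahead q V0 b n r"
      by (rule iffD1[OF nilpotent_recurrence_iff[of V0 q b d n, OF _ b d nil], rotated]) simp
    then have dr: "d r = - look_ahead q V0 b n r" for r ..
    have "c (Suc r) = V1i *\<^sub>v c r + a (Suc r)" for r
    proof -
      have "c r = E *\<^sub>v (Gh *\<^sub>v (e (Suc r) - W *\<^sub>v g (Suc r)))" unfolding c_def using l by metis
      also have "\<dots> = V1 *\<^sub>v (E *\<^sub>v (e (Suc r) - W *\<^sub>v g (Suc r)))" using e by (intro identities_on_vec(10)) simp
      also have "E *\<^sub>v (e (Suc r) - W *\<^sub>v g (Suc r)) = c (Suc r) - a (Suc r)"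
        unfolding a_def c_def using e by (simp add: vec_simps)
      finally have "V1i *\<^sub>v c r = c (Suc r) - a (Suc r)" using c a by (simp add: V1_vec)
      then show ?thesis using c[of "Suc r"] a[of "Suc r"] by (intro eq_vec_entriesI[of _ p]) auto
    qed
    then have "\<forall>r. c (Suc r) = V1i *\<^sub>v c r + a (Suc r)" ..
    then have "\<forall>r. c r = V1i ^\<^sub>m r *\<^sub>v c 0 + convolution p V1i a r"
      by (rule iffD1[OF affine_recurrence_iff[of V1i p a c, OF _ a c], rotated]) simp
    then have cr: "c r = V1i ^\<^sub>m r *\<^sub>v c 0 + convolution p V1i a r" for r ..
    have "e r = expanding (c 0) r" for r
    proof -
      have "e r = L *\<^sub>v c r + K *\<^sub>v d r" unfolding c_def d_def using identities_on_vec(9)[OF e] by simp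
      also have "K *\<^sub>v d r = - (K *\<^sub>v look_ahead q V0 b n r)"
        unfolding dr by (rule mult_mat_uminus_vec[of _ m q]) simp_all
      also have "L *\<^sub>v c r + - (K *\<^sub>v look_ahead q V0 b n r) = L *\<^sub>v c r - K *\<^sub>v look_ahead q V0 b n r"
        by (intro eq_vec_entriesI[of _ m]) auto
      finally show ?thesis unfolding expanding_def using cr[of r] unfolding a_def b_def by simp
    qed
    then show ?r using c by blast
  qed
  show ?l if r: ?r
  proof
    fix r
    obtain y where y: "y \<in> carrier_vec p" and ey: "\<And>r. e r = expanding y r" using r by blast
    define c where "c r = V1i ^\<^sub>m r *\<^sub>v y + convolution p V1i a r" for r
    define l where "l r = look_ahead q V0 b n r" for r
    have c: "c r \<in> carrier_vec p" and l: "l r \<in> carrier_vec q" for r unfolding c_def l_def using y by simp_all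
    have er: "e r = L *\<^sub>v c r - K *\<^sub>v l r" for r unfolding ey expanding_def c_def l_def a_def b_def ..
    have c0: "c 0 = y" unfolding c_def using y by simp
    have "\<forall>r. c r = V1i ^\<^sub>m r *\<^sub>v c 0 + convolution p V1i a r" unfolding c0 by (simp add: c_def)
    then have "\<forall>r. c (Suc r) = V1i *\<^sub>v c r + a (Suc r)"
      by (rule iffD2[OF affine_recurrence_iff[of V1i p a c, OF _ a c], rotated]) simp
    then have cS: "c (Suc r) = V1i *\<^sub>v c r + a (Suc r)" ..
    have lr: "V0 *\<^sub>v (l (Suc r) + b (Suc r)) = l r"
    proof -
      have "V0 *\<^sub>v (l (Suc r) + b (Suc r)) = look_ahead q V0 b (Suc n) r"
        unfolding l_def by (rule look_ahead_step) simp_all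
      also have "\<dots> = l r" unfolding l_def
        using look_ahead_Suc[of V0 q b n r] by (simp add: nil del: pow_mat.simps)
      finally show ?thesis .
    qed
    have Wg: "W *\<^sub>v g (Suc r) = L *\<^sub>v a (Suc r) + K *\<^sub>v b (Suc r)"
      unfolding a_def b_def by (rule identities_on_vec(9)[symmetric]) simp
    have "e (Suc r) - W *\<^sub>v g (Suc r) = L *\<^sub>v (V1i *\<^sub>v c r) - K *\<^sub>v (l (Suc r) + b (Suc r))"
      unfolding er Wg cS using c l
      by (intro eq_vec_entriesI[of _ m]) (auto simp: vec_simps simp del: index_mult_mat_vec)
    then have "Gh *\<^sub>v (e (Suc r) - W *\<^sub>v g (Suc r))
        = Gh *\<^sub>v (L *\<^sub>v (V1i *\<^sub>v c r)) - Gh *\<^sub>v (K *\<^sub>v (l (Suc r) + b (Suc r)))"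
      using c l by (simp add: mult_minus_distrib_mat_vec[of Gh m m])
    also have "\<dots> = L *\<^sub>v c r - K *\<^sub>v l r"
      using c l by (simp add: GhL_vec GhK_vec V1_vec lr)
    finally show "e r = Gh *\<^sub>v (e (Suc r) - W *\<^sub>v g (Suc r))" unfolding er[of r] by simp
  qed
qed

definition particular :: "nat \<Rightarrow> complex vec" where
  "particular r = - vsum m (\<lambda>k. ((G ^\<^sub>m (r - k) - L * V1i ^\<^sub>m (r - k) * E) * W) *\<^sub>v g k) {1..r}
    - vsum m (\<lambda>j. (K * V0 ^\<^sub>m j * F * W) *\<^sub>v g (j + r)) {1..n}"

definition forward :: "nat \<Rightarrow> complex vec" where
  "forward r = convolution m G (\<lambda>i. - (W *\<^sub>v g i)) r"

lemma forward_carrier [simp]: "forward r \<in> carrier_vec m"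
  unfolding forward_def by simp

lemma forward_dim [simp]: "dim_vec (forward r) = m"
  using forward_carrier[of r] by (simp del: forward_carrier)

lemma particular_carrier [simp]: "particular r \<in> carrier_vec m"
  unfolding particular_def by (intro minus_carrier_vec) (simp_all add: vsum_carrier)

lemma particular_dim [simp]: "dim_vec (particular r) = m"
  using particular_carrier[of r] by (simp del: particular_carrier)

lemma L_V1i_pow_carrier [simp]: "L * V1i ^\<^sub>m r \<in> carrier_mat m p"
  by (rule mult_carrier_mat[of _ _ p]) simp_all

lemma expanding_eq:
  assumes y: "y \<in> carrier_vec p"
  shows "(L * V1i ^\<^sub>m r) *\<^sub>v y + particular r = expanding y r + forward r"
proof -
  have Vr: "V1i ^\<^sub>m j \<in> carrier_mat p p" "V0 ^\<^sub>m j \<in> carrier_mat q q" for j by simp_all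
  have t1: "((G ^\<^sub>m j - L * V1i ^\<^sub>m j * E) * W) *\<^sub>v v
      = G ^\<^sub>m j *\<^sub>v (W *\<^sub>v v) - L *\<^sub>v (V1i ^\<^sub>m j *\<^sub>v (E *\<^sub>v (W *\<^sub>v v)))" if "v \<in> carrier_vec m" for j v
  proof -
    have c: "L * V1i ^\<^sub>m j * E \<in> carrier_mat m m" by (rule mult_carrier_mat[of _ _ p]) simp_all
    have "((G ^\<^sub>m j - L * V1i ^\<^sub>m j * E) * W) *\<^sub>v v = (G ^\<^sub>m j - L * V1i ^\<^sub>m j * E) *\<^sub>v (W *\<^sub>v v)"
      using that c by (intro assoc_mult_mat_vec[of _ m m _ m]) auto
    also have "\<dots> = G ^\<^sub>m j *\<^sub>v (W *\<^sub>v v) - (L * V1i ^\<^sub>m j * E) *\<^sub>v (W *\<^sub>v v)"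
      using c that by (intro minus_mult_distrib_mat_vec[of _ m m]) auto
    also have "(L * V1i ^\<^sub>m j * E) *\<^sub>v (W *\<^sub>v v) = (L * V1i ^\<^sub>m j) *\<^sub>v (E *\<^sub>v (W *\<^sub>v v))"
      using that by (intro assoc_mult_mat_vec[of _ m p _ m]) auto
    also have "\<dots> = L *\<^sub>v (V1i ^\<^sub>m j *\<^sub>v (E *\<^sub>v (W *\<^sub>v v)))"
      using that by (intro assoc_mult_mat_vec[of _ m p _ p]) auto
    finally show ?thesis .
  qed
  have t2: "(K * V0 ^\<^sub>m j * F * W) *\<^sub>v v = K *\<^sub>v (V0 ^\<^sub>m j *\<^sub>v (F *\<^sub>v (W *\<^sub>v v)))" if "v \<in> carrier_vec m" for j v
  proof -
    have c: "K * V0 ^\<^sub>m j \<in> carrier_mat m q" by (rule mult_carrier_mat[of _ _ q]) simp_all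
    have c': "K * V0 ^\<^sub>m j * F \<in> carrier_mat m m" by (rule mult_carrier_mat[OF c]) simp
    have "(K * V0 ^\<^sub>m j * F * W) *\<^sub>v v = (K * V0 ^\<^sub>m j * F) *\<^sub>v (W *\<^sub>v v)"
      using that by (intro assoc_mult_mat_vec[OF c']) auto
    also have "\<dots> = (K * V0 ^\<^sub>m j) *\<^sub>v (F *\<^sub>v (W *\<^sub>v v))"
      using that by (intro assoc_mult_mat_vec[OF c]) auto
    also have "\<dots> = K *\<^sub>v (V0 ^\<^sub>m j *\<^sub>v (F *\<^sub>v (W *\<^sub>v v)))"
      using that by (intro assoc_mult_mat_vec[of _ m q _ q]) auto
    finally show ?thesis .
  qed
  note neg = mult_mat_uminus_vec[of _ m m]
  define S1 where "S1 = vsum m (\<lambda>k. G ^\<^sub>m (r - k) *\<^sub>v (W *\<^sub>v g k)) {1..r}"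
  have S1 [simp]: "S1 \<in> carrier_vec m" "dim_vec S1 = m" unfolding S1_def
    using vsum_carrier[of "{1..r}" "\<lambda>k. G ^\<^sub>m (r - k) *\<^sub>v (W *\<^sub>v g k)" m] by auto
  define c where "c = convolution p V1i (\<lambda>i. E *\<^sub>v (W *\<^sub>v g i)) r"
  have c [simp]: "c \<in> carrier_vec p" "dim_vec c = p" unfolding c_def by auto
  define l where "l = look_ahead q V0 (\<lambda>i. F *\<^sub>v (W *\<^sub>v g i)) n r"
  have l [simp]: "l \<in> carrier_vec q" "dim_vec l = q" unfolding l_def
    using look_ahead_carrier[of V0 q "\<lambda>i. F *\<^sub>v (W *\<^sub>v g i)" n r] by auto
  have p1: "vsum m (\<lambda>k. ((G ^\<^sub>m (r - k) - L * V1i ^\<^sub>m (r - k) * E) * W) *\<^sub>v g k) {1..r} = S1 - L *\<^sub>v c"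
  proof -
    have "L *\<^sub>v c = vsum m (\<lambda>k. L *\<^sub>v (V1i ^\<^sub>m (r - k) *\<^sub>v (E *\<^sub>v (W *\<^sub>v g k)))) {1..r}"
      unfolding c_def convolution_def by (intro mult_mat_vec_vsum) auto
    then show ?thesis unfolding S1_def t1[OF g] by (simp add: vsum_minus)
  qed
  have p2: "vsum m (\<lambda>j. (K * V0 ^\<^sub>m j * F * W) *\<^sub>v g (j + r)) {1..n} = K *\<^sub>v l"
    unfolding l_def look_ahead_def t2[OF g] by (intro mult_mat_vec_vsum[symmetric]) auto
  have f: "forward r = - S1"
  proof (rule eq_vec_entriesI[of _ m])
    fix a assume a: "a < m"
    show "forward r $ a = (- S1) $ a"
      unfolding forward_def convolution_def S1_def using a vsum_carrier[of "{1..r}" "\<lambda>k. G ^\<^sub>m (r - k) *\<^sub>v (W *\<^sub>v g k)" m]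
      by (simp add: neg vsum_entry sum_negf del: index_mult_mat_vec)
  qed auto
  have Ly: "(L * V1i ^\<^sub>m r) *\<^sub>v y = L *\<^sub>v (V1i ^\<^sub>m r *\<^sub>v y)"
    using y by (intro assoc_mult_mat_vec[of _ m p _ p]) auto
  have x: "expanding y r = L *\<^sub>v (V1i ^\<^sub>m r *\<^sub>v y) + L *\<^sub>v c - K *\<^sub>v l"
    unfolding expanding_def c_def[symmetric] l_def[symmetric] using y by (simp add: vec_simps)
  show ?thesis
    unfolding particular_def p1 p2 f Ly x
    by (intro eq_vec_entriesI[of _ m]) (auto simp del: index_mult_mat_vec)
qed

text \<open>The term \<open>k = 1\<close>, which contains \<open>G\<^sup>0 - L E = K F\<close>, supplies the missing index \<open>j = 0\<close>.\<close>

lemma particular_1: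
  "particular 1 = - vsum m (\<lambda>j. (K * V0 ^\<^sub>m j * F * W) *\<^sub>v g (j + 1)) {0..n}"
proof -
  define f where "f j = (K * V0 ^\<^sub>m j * F * W) *\<^sub>v g (j + 1)" for j
  have KV: "K * V0 ^\<^sub>m j * F * W \<in> carrier_mat m m" for j
  proof -
    have "K * V0 ^\<^sub>m j \<in> carrier_mat m q" by (rule mult_carrier_mat[of _ _ q]) simp_all
    then have "K * V0 ^\<^sub>m j * F \<in> carrier_mat m m" by (rule mult_carrier_mat) simp
    then show ?thesis by simp
  qed
  have f: "f j \<in> carrier_vec m" for j unfolding f_def using KV[of j] by simp
  have f0: "f 0 = K *\<^sub>v (F *\<^sub>v (W *\<^sub>v g 1))"
  proof -
    have "K * V0 ^\<^sub>m 0 = K" using right_mult_one_mat[of K m q] by simp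
    then have "f 0 = (K * F * W) *\<^sub>v g 1" unfolding f_def by simp
    also have "\<dots> = (K * F) *\<^sub>v (W *\<^sub>v g 1)" by (rule assoc_mult_mat_vec[of _ m m _ m]) auto
    also have "\<dots> = K *\<^sub>v (F *\<^sub>v (W *\<^sub>v g 1))" by (rule assoc_mult_mat_vec[of _ m q _ m]) auto
    finally show ?thesis .
  qed
  have first: "((G ^\<^sub>m (1 - 1) - L * V1i ^\<^sub>m (1 - 1) * E) * W) *\<^sub>v g 1 = f 0"
  proof -
    have LEc: "L * E \<in> carrier_mat m m" by (rule mult_carrier_mat[of _ _ p]) simp_all
    have "L * V1i ^\<^sub>m 0 = L" using right_mult_one_mat[of L m p] by simp
    then have "((G ^\<^sub>m (1 - 1) - L * V1i ^\<^sub>m (1 - 1) * E) * W) *\<^sub>v g 1 = ((1\<^sub>m m - L * E) * W) *\<^sub>v g 1"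
      by simp
    also have "\<dots> = (1\<^sub>m m - L * E) *\<^sub>v (W *\<^sub>v g 1)"
      using LEc by (intro assoc_mult_mat_vec[of _ m m _ m]) auto
    also have "\<dots> = W *\<^sub>v g 1 - L *\<^sub>v (E *\<^sub>v (W *\<^sub>v g 1))"
      using LEc assoc_mult_mat_vec[of L m p E m "W *\<^sub>v g 1"]
      by (simp add: minus_mult_distrib_mat_vec[of _ m m])
    also have "\<dots> = f 0"
    proof (rule eq_vec_entriesI[of _ m])
      fix a assume a: "a < m"
      have "(L *\<^sub>v (E *\<^sub>v (W *\<^sub>v g 1))) $ a + (K *\<^sub>v (F *\<^sub>v (W *\<^sub>v g 1))) $ a = (W *\<^sub>v g 1) $ a"
        using a arg_cong[OF identities_on_vec(9)[of "W *\<^sub>v g 1"], of "\<lambda>v. v $ a"] by (simp del: index_mult_mat_vec)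
      then have "(K *\<^sub>v (F *\<^sub>v (W *\<^sub>v g 1))) $ a = (W *\<^sub>v g 1) $ a - (L *\<^sub>v (E *\<^sub>v (W *\<^sub>v g 1))) $ a"
        by (simp add: eq_diff_eq add.commute)
      then show "(W *\<^sub>v g 1 - L *\<^sub>v (E *\<^sub>v (W *\<^sub>v g 1))) $ a = f 0 $ a"
        unfolding f0 using a by (simp del: index_mult_mat_vec)
    qed (use f in auto)
    finally show ?thesis .
  qed
  have "vsum m (\<lambda>k. ((G ^\<^sub>m (1 - k) - L * V1i ^\<^sub>m (1 - k) * E) * W) *\<^sub>v g k) {1..1} = f 0"
  proof -
    have "{1..1} = insert (1 :: nat) {}" by auto
    moreover have "vsum m h (insert 1 {}) = h 1 + vsum m h {}" if "h (1 :: nat) \<in> carrier_vec m" for h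
      using that by (intro vsum_insert) auto
    ultimately show ?thesis using first f[of 0] by simp
  qed
  moreover have "vsum m f {0..n} = f 0 + vsum m f {1..n}"
  proof -
    have "{0..n} = insert 0 {1..n}" by auto
    then show ?thesis using f by (simp add: vsum_insert)
  qed
  moreover have "vsum m f {1..n} \<in> carrier_vec m" using f by (intro vsum_carrier)
  ultimately show ?thesis
    unfolding particular_def f_def[symmetric] using f[of 0]
    by (intro eq_vec_entriesI[of _ m]) auto
qed

definition solution :: "complex vec \<Rightarrow> complex vec \<Rightarrow> nat \<Rightarrow> complex vec" where
  "solution x y r = G ^\<^sub>m r *\<^sub>v x + (L * V1i ^\<^sub>m r) *\<^sub>v y + particular r"

lemma solution_carrier [simp]: "solution x y r \<in> carrier_vec m"
  unfolding solution_def using mult_mat_vec_in_carrier[of "L * V1i ^\<^sub>m r" m] by simp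

lemma solution_eq:
  assumes "x \<in> carrier_vec m" "y \<in> carrier_vec p"
  shows "solution x y r = (G ^\<^sub>m r *\<^sub>v x + forward r) + expanding y r"
proof -
  have "dim_row (L * V1i ^\<^sub>m r) = m" by simp
  then have "solution x y r = G ^\<^sub>m r *\<^sub>v x + ((L * V1i ^\<^sub>m r) *\<^sub>v y + particular r)"
    unfolding solution_def by (intro assoc_add_vec[of _ m]) auto
  then show ?thesis unfolding expanding_eq[OF assms(2)]
    by (simp add: eq_vec_entriesI[of _ m] del: index_mult_mat_vec)
qed

lemma interior_iff:
  assumes u: "\<And>r. u r \<in> carrier_vec m"
  shows "(\<forall>r. u (Suc r) - (D *\<^sub>v u r + Z *\<^sub>v u (Suc r) + T *\<^sub>v u (Suc (Suc r))) = g (Suc r)) \<longleftrightarrow>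
    (\<exists>x\<in>carrier_vec m. \<exists>y\<in>carrier_vec p. \<forall>r. u r = solution x y r)" (is "?l \<longleftrightarrow> ?r")
proof -
  have rec: "(\<forall>r. u (Suc r) - expanding y (Suc r) = G *\<^sub>v (u r - expanding y r) - W *\<^sub>v g (Suc r)) \<longleftrightarrow>
      (\<exists>x\<in>carrier_vec m. \<forall>r. u r = solution x y r)" if y: "y \<in> carrier_vec p" for y
  proof -
    define d where "d r = u r - expanding y r" for r
    have d: "d r \<in> carrier_vec m" for r unfolding d_def using u by simp
    have dd [simp]: "dim_vec (d r) = m" "dim_vec (u r) = m" for r using d[of r] u[of r] by auto
    have h: "- (W *\<^sub>v g i) \<in> carrier_vec m" for i by simp
    have "(\<forall>r. d (Suc r) = G *\<^sub>v d r - W *\<^sub>v g (Suc r)) \<longleftrightarrow> (\<forall>r. d (Suc r) = G *\<^sub>v d r + - (W *\<^sub>v g (Suc r)))"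
      by (simp add: minus_add_uminus_vec[of _ m])
    also have "\<dots> \<longleftrightarrow> (\<forall>r. d r = G ^\<^sub>m r *\<^sub>v d 0 + forward r)"
      unfolding forward_def by (rule affine_recurrence_iff[OF _ h d]) simp
    also have "\<dots> \<longleftrightarrow> (\<exists>x\<in>carrier_vec m. \<forall>r. d r = G ^\<^sub>m r *\<^sub>v x + forward r)"
    proof
      assume "\<exists>x\<in>carrier_vec m. \<forall>r. d r = G ^\<^sub>m r *\<^sub>v x + forward r"
      then obtain x where x: "x \<in> carrier_vec m" and dx: "\<And>r. d r = G ^\<^sub>m r *\<^sub>v x + forward r" by blast
      have "d 0 = x" using dx[of 0] x unfolding forward_def by simp
      then show "\<forall>r. d r = G ^\<^sub>m r *\<^sub>v d 0 + forward r" using dx by simp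
    qed (use d in blast)
    also have "\<dots> \<longleftrightarrow> (\<exists>x\<in>carrier_vec m. \<forall>r. u r = solution x y r)"
    proof -
      have "d r = G ^\<^sub>m r *\<^sub>v x + forward r \<longleftrightarrow> u r = solution x y r" if x: "x \<in> carrier_vec m" for x r
      proof
        assume eq: "d r = G ^\<^sub>m r *\<^sub>v x + forward r"
        have "u r = d r + expanding y r" unfolding d_def
          by (intro eq_vec_entriesI[of _ m]) (auto simp: u)
        then show "u r = solution x y r" unfolding eq solution_eq[OF x y] .
      next
        assume eq: "u r = solution x y r"
        show "d r = G ^\<^sub>m r *\<^sub>v x + forward r"
          unfolding d_def eq solution_eq[OF x y]
          by (intro eq_vec_entriesI[of _ m]) (auto simp del: index_mult_mat_vec)
      qed
      then show ?thesis by blast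
    qed
    finally show ?thesis unfolding d_def .
  qed
  have "?l \<longleftrightarrow> (\<exists>y\<in>carrier_vec p. \<forall>r. u (Suc r) - expanding y (Suc r) = G *\<^sub>v (u r - expanding y r) - W *\<^sub>v g (Suc r))"
    unfolding interior_iff_decoupled[of u, OF u]
  proof
    assume "\<exists>e. (\<forall>r. e r \<in> carrier_vec m) \<and> (\<forall>r. e r = Gh *\<^sub>v (e (Suc r) - W *\<^sub>v g (Suc r))) \<and>
        (\<forall>r. u (Suc r) - e (Suc r) = G *\<^sub>v (u r - e r) - W *\<^sub>v g (Suc r))"
    then obtain e where e: "\<And>r. e r \<in> carrier_vec m" "\<forall>r. e r = Gh *\<^sub>v (e (Suc r) - W *\<^sub>v g (Suc r))"
      "\<And>r. u (Suc r) - e (Suc r) = G *\<^sub>v (u r - e r) - W *\<^sub>v g (Suc r)" by blast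
    obtain y where y: "y \<in> carrier_vec p" and "\<forall>r. e r = expanding y r"
      using iffD1[OF backward_recurrence_iff[of e, OF e(1)] e(2)] by blast
    then have "e = expanding y" by blast
    then show "\<exists>y\<in>carrier_vec p. \<forall>r. u (Suc r) - expanding y (Suc r) = G *\<^sub>v (u r - expanding y r) - W *\<^sub>v g (Suc r)"
      using e(3) y by blast
  next
    assume "\<exists>y\<in>carrier_vec p. \<forall>r. u (Suc r) - expanding y (Suc r) = G *\<^sub>v (u r - expanding y r) - W *\<^sub>v g (Suc r)"
    then obtain y where y: "y \<in> carrier_vec p"
      "\<forall>r. u (Suc r) - expanding y (Suc r) = G *\<^sub>v (u r - expanding y r) - W *\<^sub>v g (Suc r)" by blast
    have E2: "\<forall>r. expanding y r = Gh *\<^sub>v (expanding y (Suc r) - W *\<^sub>v g (Suc r))"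
      by (rule iffD2[OF backward_recurrence_iff[of "expanding y", OF expanding_carrier]])
        (rule bexI[of _ y], simp, rule y(1))
    show "\<exists>e. (\<forall>r. e r \<in> carrier_vec m) \<and> (\<forall>r. e r = Gh *\<^sub>v (e (Suc r) - W *\<^sub>v g (Suc r))) \<and>
        (\<forall>r. u (Suc r) - e (Suc r) = G *\<^sub>v (u r - e r) - W *\<^sub>v g (Suc r))"
    proof (intro exI conjI)
      show "\<forall>r. expanding y r \<in> carrier_vec m" by simp
    qed (fact E2 y(2))+
  qed
  also have "\<dots> \<longleftrightarrow> (\<exists>y\<in>carrier_vec p. \<exists>x\<in>carrier_vec m. \<forall>r. u r = solution x y r)"
    using rec by (intro bex_cong) auto
  finally show ?thesis by blast
qed

text \<open>At level \<open>1\<close> the solution without its \<open>G\<close>-part is \<open>e\<^sub>1 - W g\<^sub>1\<close>, and the backward recurrence says that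
  \<open>Gh\<close> maps it to \<open>e\<^sub>0\<close>. This is what eliminates level \<open>0\<close> from the boundary condition.\<close>

lemma level_one_part:
  assumes y: "y \<in> carrier_vec p"
  shows "particular 1 + (L * V1i) *\<^sub>v y = expanding y 1 - W *\<^sub>v g 1" (is ?one)
    and "L *\<^sub>v y + particular 0 = expanding y 0" (is ?zero)
    and "Gh *\<^sub>v (particular 1 + (L * V1i) *\<^sub>v y) = L *\<^sub>v y + particular 0"
proof -
  have V: "V1i ^\<^sub>m 1 = V1i" "V1i ^\<^sub>m 0 = 1\<^sub>m p" by (simp_all add: left_mult_one_mat[of _ p p])
  have f1: "forward 1 = - (W *\<^sub>v g 1)"
    unfolding forward_def using convolution_Suc[of G m "\<lambda>i. - (W *\<^sub>v g i)" 0] mult_mat_zero_vec[of G m m] by simp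
  have f0: "forward 0 = 0\<^sub>v m" unfolding forward_def by simp
  have "(L * V1i) *\<^sub>v y + particular 1 = expanding y 1 + - (W *\<^sub>v g 1)"
    using expanding_eq[OF y, of 1] unfolding V f1 .
  moreover have "dim_row (L * V1i) = m" by simp
  ultimately show ?one
    using comm_add_vec[of "(L * V1i) *\<^sub>v y" m "particular 1"] by (simp add: minus_add_uminus_vec[of _ m])
  have "L * 1\<^sub>m p = L" using right_mult_one_mat[of L m p] by simp
  then show ?zero using expanding_eq[OF y, of 0] unfolding V f0 by simp
  have "\<forall>r. expanding y r = Gh *\<^sub>v (expanding y (Suc r) - W *\<^sub>v g (Suc r))"
    by (rule iffD2[OF backward_recurrence_iff[of "expanding y", OF expanding_carrier]])
      (rule bexI[of _ y], simp, rule y)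
  then show "Gh *\<^sub>v (particular 1 + (L * V1i) *\<^sub>v y) = L *\<^sub>v y + particular 0"
    unfolding \<open>?one\<close> \<open>?zero\<close> by (metis One_nat_def)
qed

end

section \<open>Passing to complex matrices\<close>

lemma cmat_mult:
  assumes "A \<in> carrier_mat k l" "B \<in> carrier_mat l q"
  shows "cmat (A * B) = cmat A * cmat B"
proof (rule eq_mat_entriesI[of _ k q])
  fix a b assume "a < k" "b < q"
  then show "cmat (A * B) $$ (a, b) = (cmat A * cmat B) $$ (a, b)"
    using assms by (simp add: mult_mat_entry[of _ k l _ q] del: index_mult_mat(1))
qed (use assms in auto)

lemma cmat_add: "A \<in> carrier_mat k l \<Longrightarrow> B \<in> carrier_mat k l \<Longrightarrow> cmat (A + B) = cmat A + cmat B"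
  by (intro eq_mat_entriesI[of _ k l]) auto

lemma cmat_minus: "A \<in> carrier_mat k l \<Longrightarrow> B \<in> carrier_mat k l \<Longrightarrow> cmat (A - B) = cmat A - cmat B"
  by (intro eq_mat_entriesI[of _ k l]) auto

lemma cmat_one: "cmat (1\<^sub>m k) = 1\<^sub>m k"
  by (intro eq_mat_entriesI[of _ k k]) auto

lemma cmat_pow: "A \<in> carrier_mat k k \<Longrightarrow> cmat (A ^\<^sub>m j) = cmat A ^\<^sub>m j"
  by (induction j) (simp_all add: cmat_one cmat_mult[of _ k k _ k])

lemma summable_mult_mat_vec:
  fixes A :: "complex mat"
  assumes A: "A \<in> carrier_mat k l" and f: "\<And>i. f i \<in> carrier_vec l"
    and sm: "\<And>b. b < l \<Longrightarrow> summable (\<lambda>i. f i $ b)" and a: "a < k"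
  shows "summable (\<lambda>i. (A *\<^sub>v f i) $ a)"
    and "(\<Sum>i. (A *\<^sub>v f i) $ a) = (A *\<^sub>v vec l (\<lambda>b. \<Sum>i. f i $ b)) $ a"
proof -
  have e: "(A *\<^sub>v f i) $ a = (\<Sum>b<l. A $$ (a, b) * f i $ b)" for i
    by (rule mult_mat_vec_entry[OF A f a])
  show "summable (\<lambda>i. (A *\<^sub>v f i) $ a)"
    unfolding e using sm by (intro summable_sum summable_mult) auto
  have "(\<Sum>i. (A *\<^sub>v f i) $ a) = (\<Sum>b<l. \<Sum>i. A $$ (a, b) * f i $ b)"
    unfolding e using sm by (intro suminf_sum summable_mult) auto
  also have "\<dots> = (\<Sum>b<l. A $$ (a, b) * (\<Sum>i. f i $ b))"
    using sm by (intro sum.cong refl suminf_mult) auto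
  also have "\<dots> = (A *\<^sub>v vec l (\<lambda>b. \<Sum>i. f i $ b)) $ a"
    using A a by (subst mult_mat_vec_entry[of _ k l]) auto
  finally show "(\<Sum>i. (A *\<^sub>v f i) $ a) = (A *\<^sub>v vec l (\<lambda>b. \<Sum>i. f i $ b)) $ a" .
qed

context poisson_factorization
begin

text \<open>With \<open>w\<close> for the part of \<open>u\<^sub>1\<close> outside \<open>G x\<close>, the solution has \<open>u\<^sub>0 = x + Gh w\<close> and \<open>u\<^sub>1 = G x + w\<close>.\<close>

lemma boundary_iff:
  assumes B: "B \<in> carrier_mat m m" and x: "x \<in> carrier_vec m" and y: "y \<in> carrier_vec p"
  shows "solution x y 0 - (B *\<^sub>v solution x y 0 + T *\<^sub>v solution x y 1) = g 0 \<longleftrightarrow>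
    (1\<^sub>m m - (B + T * G)) *\<^sub>v x =
      ((B - 1\<^sub>m m) * Gh + T) *\<^sub>v (particular 1 + (L * V1i) *\<^sub>v y) + g 0"
proof -
  define w where "w = particular 1 + (L * V1i) *\<^sub>v y"
  have w: "w \<in> carrier_vec m" unfolding w_def by simp
  have wd [simp]: "dim_vec w = m" "dim_vec x = m" using w x by auto
  have Bd [simp]: "dim_row B = m" "dim_col B = m" using B by auto
  have u0: "solution x y 0 = x + Gh *\<^sub>v w"
  proof -
    have "L * V1i ^\<^sub>m 0 = L" using right_mult_one_mat[of L m p] by simp
    then have "solution x y 0 = (x + L *\<^sub>v y) + particular 0"
      unfolding solution_def using x by simp
    also have "\<dots> = x + (L *\<^sub>v y + particular 0)" using x by (intro assoc_add_vec[of _ m]) auto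
    finally show ?thesis unfolding w_def level_one_part(3)[OF y] .
  qed
  have u1: "solution x y 1 = G *\<^sub>v x + w"
  proof -
    have V: "V1i ^\<^sub>m 1 = V1i" "G ^\<^sub>m 1 = G"
      by (simp_all add: left_mult_one_mat[of _ p p] left_mult_one_mat[of _ m m])
    have "solution x y 1 = (G *\<^sub>v x + (L * V1i) *\<^sub>v y) + particular 1"
      unfolding solution_def V ..
    also have "\<dots> = G *\<^sub>v x + ((L * V1i) *\<^sub>v y + particular 1)" by (intro assoc_add_vec[of _ m]) auto
    also have "(L * V1i) *\<^sub>v y + particular 1 = w" unfolding w_def by (intro comm_add_vec[of _ m]) auto
    finally show ?thesis .
  qed
  have l: "(solution x y 0 - (B *\<^sub>v solution x y 0 + T *\<^sub>v solution x y 1)) $ a = g 0 $ a \<longleftrightarrow>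
      ((1\<^sub>m m - (B + T * G)) *\<^sub>v x) $ a = (((B - 1\<^sub>m m) * Gh + T) *\<^sub>v w + g 0) $ a" if a: "a < m" for a
  proof -
    have 1: "(solution x y 0 - (B *\<^sub>v solution x y 0 + T *\<^sub>v solution x y 1)) $ a =
      x $ a + (Gh *\<^sub>v w) $ a - (B *\<^sub>v x) $ a - (B *\<^sub>v (Gh *\<^sub>v w)) $ a - (T *\<^sub>v (G *\<^sub>v x)) $ a - (T *\<^sub>v w) $ a"
      unfolding u0 u1 using a w x B by (simp add: vec_simps del: index_mult_mat_vec)
    have 2: "((1\<^sub>m m - (B + T * G)) *\<^sub>v x) $ a = x $ a - (B *\<^sub>v x) $ a - (T *\<^sub>v (G *\<^sub>v x)) $ a"
      using a x B by (simp add: vec_simps del: index_mult_mat_vec)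
    have 3: "(((B - 1\<^sub>m m) * Gh + T) *\<^sub>v w + g 0) $ a =
      (B *\<^sub>v (Gh *\<^sub>v w)) $ a - (Gh *\<^sub>v w) $ a + (T *\<^sub>v w) $ a + g 0 $ a"
      using a w B by (simp add: vec_simps del: index_mult_mat_vec)
    show ?thesis unfolding 1 2 3 by (auto simp: algebra_simps)
  qed
  show ?thesis
    unfolding w_def[symmetric]
  proof
    assume eq: "solution x y 0 - (B *\<^sub>v solution x y 0 + T *\<^sub>v solution x y 1) = g 0"
    show "(1\<^sub>m m - (B + T * G)) *\<^sub>v x = ((B - 1\<^sub>m m) * Gh + T) *\<^sub>v w + g 0"
    proof (rule eq_vec_entriesI[of _ m])
      show "((1\<^sub>m m - (B + T * G)) *\<^sub>v x) $ a = (((B - 1\<^sub>m m) * Gh + T) *\<^sub>v w + g 0) $ a" if "a < m" for a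
        using l[OF that] eq by simp
    qed auto
  next
    assume eq: "(1\<^sub>m m - (B + T * G)) *\<^sub>v x = ((B - 1\<^sub>m m) * Gh + T) *\<^sub>v w + g 0"
    show "solution x y 0 - (B *\<^sub>v solution x y 0 + T *\<^sub>v solution x y 1) = g 0"
    proof (rule eq_vec_entriesI[of _ m])
      show "(solution x y 0 - (B *\<^sub>v solution x y 0 + T *\<^sub>v solution x y 1)) $ a = g 0 $ a" if "a < m" for a
        using l[OF that] eq by simp
    qed auto
  qed
qed

end

context qbd_chain
begin

lemma poisson_solution_iff:
  assumes g: "\<And>r. g r \<in> carrier_vec m"
  shows "poisson_solution m P g u \<longleftrightarrow> (\<forall>r. u r \<in> carrier_vec m) \<and>
    u 0 - (cmat B *\<^sub>v u 0 + cmat A1 *\<^sub>v u 1) = g 0 \<and>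
    (\<forall>r. u (Suc r) - (cmat Am *\<^sub>v u r + cmat A0 *\<^sub>v u (Suc r) + cmat A1 *\<^sub>v u (Suc (Suc r))) = g (Suc r))"
    (is "_ \<longleftrightarrow> ?c \<and> ?b \<and> ?i")
proof (cases ?c)
  case True
  then have u [simp]: "u r \<in> carrier_vec m" "dim_vec (u r) = m" for r by (auto simp: carrier_vecD)
  have gd [simp]: "dim_vec (g r) = m" for r using g[of r] by auto
  have e0: "infsum (\<lambda>(j, b). complex_of_real (P (0, a) (j, b)) * u j $ b) (qbd_states m)
      = (cmat B *\<^sub>v u 0 + cmat A1 *\<^sub>v u 1) $ a" if a: "a < m" for a
  proof -
    have "infsum (\<lambda>t. of_real (P (0, a) t) * (\<lambda>(j, b). u j $ b) t) (qbd_states m) =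
        (\<Sum>b<m. of_real (B $$ (a, b)) * u 0 $ b) + (\<Sum>b<m. of_real (A1 $$ (a, b)) * u 1 $ b)"
      using infsumI[OF qbd_row_has_sum[of B Am A0 A1 "(0, a)" "\<lambda>(j, b). u j $ b" m]]
      unfolding qbd_row_sum_0 by simp
    moreover have "(cmat B *\<^sub>v u 0 + cmat A1 *\<^sub>v u 1) $ a =
        (\<Sum>b<m. of_real (B $$ (a, b)) * u 0 $ b) + (\<Sum>b<m. of_real (A1 $$ (a, b)) * u 1 $ b)"
      using a by (simp add: mult_mat_vec_entry[of _ m m] del: index_mult_mat_vec)
    ultimately show ?thesis by (simp add: case_prod_unfold)
  qed
  have eS: "infsum (\<lambda>(j, b). complex_of_real (P (Suc r, a) (j, b)) * u j $ b) (qbd_states m)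
      = (cmat Am *\<^sub>v u r + cmat A0 *\<^sub>v u (Suc r) + cmat A1 *\<^sub>v u (Suc (Suc r))) $ a" if a: "a < m" for r a
  proof -
    have "infsum (\<lambda>t. of_real (P (Suc r, a) t) * (\<lambda>(j, b). u j $ b) t) (qbd_states m) =
        (\<Sum>b<m. of_real (Am $$ (a, b)) * u r $ b) + (\<Sum>b<m. of_real (A0 $$ (a, b)) * u (Suc r) $ b)
        + (\<Sum>b<m. of_real (A1 $$ (a, b)) * u (Suc (Suc r)) $ b)"
      using infsumI[OF qbd_row_has_sum[of B Am A0 A1 "(Suc r, a)" "\<lambda>(j, b). u j $ b" m]]
      unfolding qbd_row_sum_Suc by simp
    moreover have "(cmat Am *\<^sub>v u r + cmat A0 *\<^sub>v u (Suc r) + cmat A1 *\<^sub>v u (Suc (Suc r))) $ a =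
        (\<Sum>b<m. of_real (Am $$ (a, b)) * u r $ b) + (\<Sum>b<m. of_real (A0 $$ (a, b)) * u (Suc r) $ b)
        + (\<Sum>b<m. of_real (A1 $$ (a, b)) * u (Suc (Suc r)) $ b)"
      using a by (simp add: mult_mat_vec_entry[of _ m m] del: index_mult_mat_vec)
    ultimately show ?thesis by (simp add: case_prod_unfold)
  qed
  have vec_iff: "(\<forall>a<m. v $ a - w $ a = z $ a) \<longleftrightarrow> v - w = z"
    if "dim_vec v = m" "dim_vec w = m" "dim_vec z = m" for v w z :: "complex vec"
  proof
    assume "\<forall>a<m. v $ a - w $ a = z $ a"
    then show "v - w = z" using that by (intro eq_vecI) auto
  qed (use that in auto)
  have all_nat: "(\<forall>r. Q r) \<longleftrightarrow> Q 0 \<and> (\<forall>r. Q (Suc r))" for Q :: "nat \<Rightarrow> bool"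
    by (metis not0_implies_Suc)
  have "poisson_solution m P g u \<longleftrightarrow> (\<forall>r. \<forall>a<m.
      u r $ a - infsum (\<lambda>(j, b). complex_of_real (P (r, a) (j, b)) * u j $ b) (qbd_states m) = g r $ a)"
    unfolding poisson_solution_def using True by simp
  also have "\<dots> \<longleftrightarrow> (\<forall>a<m. u 0 $ a - (cmat B *\<^sub>v u 0 + cmat A1 *\<^sub>v u 1) $ a = g 0 $ a) \<and>
      (\<forall>r. \<forall>a<m. u (Suc r) $ a - (cmat Am *\<^sub>v u r + cmat A0 *\<^sub>v u (Suc r) + cmat A1 *\<^sub>v u (Suc (Suc r))) $ a
        = g (Suc r) $ a)"
    by (subst all_nat) (simp add: e0 eS del: index_mult_mat_vec index_add_vec)
  also have "\<dots> \<longleftrightarrow> ?b \<and> ?i"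
    by (subst (1 2) vec_iff) (simp_all add: block_dims)
  finally show ?thesis using True by blast
next
  case False
  then show ?thesis unfolding poisson_solution_def by blast
qed

end

text \<open>The data of the Poisson equation of the chain. The matrix \<open>green\<close> is real, whereas the matrices of
  the Jordan form of \<open>Gh\<close> and the vectors \<open>g\<close> are complex.\<close>

locale qbd_poisson = qbd_process m B Am A0 A1 G Gh R + qbd_green m Am A0 A1 G Gh R
  for m :: nat and B Am A0 A1 G Gh R :: "real mat" +
  fixes p q n :: nat and L K E F V1 V1i V0 :: "complex mat" and g :: "nat \<Rightarrow> complex vec"
  assumes intertwining: "green * R = Gh * green"
    and blocks: "L \<in> carrier_mat m p" "K \<in> carrier_mat m q" "E \<in> carrier_mat p m"
      "F \<in> carrier_mat q m" "V1 \<in> carrier_mat p p" "V1i \<in> carrier_mat p p" "V0 \<in> carrier_mat q q"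
    and g: "\<And>r. g r \<in> carrier_vec m"
    and LE: "L * E + K * F = 1\<^sub>m m" and GhL: "cmat Gh * L = L * V1" and GhK: "cmat Gh * K = K * V0"
    and EGh: "E * cmat Gh = V1 * E" and FGh: "F * cmat Gh = V0 * F"
    and V1: "V1 * V1i = 1\<^sub>m p" "V1i * V1 = 1\<^sub>m p"
    and nil: "V0 ^\<^sub>m Suc n = 0\<^sub>m q q"
begin

definition W :: "real mat" where "W = - green"

definition Wi :: "real mat" where "Wi = U + Am * Gh - 1\<^sub>m m"

lemma W_carriers [simp]: "W \<in> carrier_mat m m" "Wi \<in> carrier_mat m m"
  unfolding W_def Wi_def by simp_all

lemma W_dims [simp]: "dim_row W = m" "dim_col W = m" "dim_row Wi = m" "dim_col Wi = m"
  unfolding W_def Wi_def by simp_all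

lemma Wi_W: "Wi * W = 1\<^sub>m m"
proof -
  have "Wi = - (1\<^sub>m m - U - Am * Gh)" unfolding Wi_def
    by (intro eq_mat_entriesI[of _ m m]) (auto simp del: index_mult_mat(1))
  moreover have "dim_col (1\<^sub>m m - U - Am * Gh) = dim_row green" by simp
  ultimately show ?thesis
    unfolding W_def using inverse_green_if_intertwining[OF intertwining] by simp
qed

lemma W_Wi: "W * Wi = 1\<^sub>m m"
  by (rule mat_mult_left_right_inverse[OF _ _ Wi_W]) simp_all

lemma W_inverse: "invertible_mat W" "minv W = Wi"
  using left_inverse_invertible[OF _ _ Wi_W] by simp_all

lemma W_plus_N: "W + N = G * W * R"
proof -
  have "G * W * R = - (G * green * R)" unfolding W_def by simp
  moreover have "(- green + N) $$ (a, b) = (- (G * green * R)) $$ (a, b)" if "a < m" "b < m" for a b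
    using arg_cong[OF green_eq, of "\<lambda>X. X $$ (a, b)"] that by (simp del: index_mult_mat(1))
  ultimately show ?thesis unfolding W_def
    by (intro eq_mat_entriesI[of _ m m]) (auto simp del: index_mult_mat(1))
qed

lemma Gh_W: "Gh * W = W * R"
  unfolding W_def using intertwining by simp

sublocale c: poisson_factorization m p q n "cmat Am" "cmat A0" "cmat A1" "cmat G" "cmat Gh" "cmat W"
  "cmat Wi" "cmat N" "cmat U" "cmat R" L K E F V1 V1i V0 g
proof
  have I: "1\<^sub>m m - cmat U = cmat (1\<^sub>m m - U)" by (simp add: cmat_minus[of _ m m] cmat_one)
  note cm = cmat_mult[of _ m m _ m, symmetric]
  show "cmat U = cmat A0 + cmat A1 * cmat G"
    unfolding U_def by (simp add: cmat_add[of _ m m] cmat_mult[of _ m m _ m])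
  show "(1\<^sub>m m - cmat U) * cmat G = cmat Am" unfolding I by (simp add: cm one_minus_U_G)
  show "(1\<^sub>m m - cmat U) * cmat N = 1\<^sub>m m" "cmat N * (1\<^sub>m m - cmat U) = 1\<^sub>m m"
    unfolding I by (simp_all add: cm N_inverse cmat_one)
  show "cmat R * (1\<^sub>m m - cmat U) = cmat A1" unfolding I by (simp add: cm R_one_minus_U)
  show "cmat W + cmat N = cmat G * cmat W * cmat R"
    by (simp add: cm cmat_add[of _ m m, symmetric] W_plus_N)
  show "cmat Gh * cmat W = cmat W * cmat R" by (simp add: cm Gh_W)
  show "cmat Wi * cmat W = 1\<^sub>m m" "cmat W * cmat Wi = 1\<^sub>m m"
    by (simp_all add: cm Wi_W W_Wi cmat_one)
qed (use blocks g LE GhL GhK EGh FGh V1 nil in simp_all)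

definition rhs :: "complex vec \<Rightarrow> complex vec" where
  "rhs y = cmat ((B - 1\<^sub>m m) * Gh + A1) *\<^sub>v (c.particular 1 + (L * V1i) *\<^sub>v y) + g 0"

lemma rhs_carrier [simp]: "rhs y \<in> carrier_vec m" "dim_vec (rhs y) = m"
  unfolding rhs_def using g[of 0] by auto

lemma poisson_solution_form:
  "poisson_solution m P g u \<longleftrightarrow>
    (\<exists>x\<in>carrier_vec m. \<exists>y\<in>carrier_vec p. cmat H *\<^sub>v x = rhs y \<and> (\<forall>r. u r = c.solution x y r))"
  (is "?l \<longleftrightarrow> ?r") if H: "H = 1\<^sub>m m - Pstar"
proof -
  have cH: "cmat H = 1\<^sub>m m - (cmat B + cmat A1 * cmat G)"
    unfolding H Pstar_def by (simp add: cmat_minus[of _ m m] cmat_add[of _ m m] cmat_mult[of _ m m _ m] cmat_one)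
  have cX: "cmat ((B - 1\<^sub>m m) * Gh + A1) = (cmat B - 1\<^sub>m m) * cmat Gh + cmat A1"
    by (simp add: cmat_minus[of _ m m] cmat_add[of _ m m] cmat_mult[of _ m m _ m] cmat_one)
  have bd: "c.solution x y 0 - (cmat B *\<^sub>v c.solution x y 0 + cmat A1 *\<^sub>v c.solution x y 1) = g 0
      \<longleftrightarrow> cmat H *\<^sub>v x = rhs y" if "x \<in> carrier_vec m" "y \<in> carrier_vec p" for x y
    unfolding rhs_def cX cH using that by (intro c.boundary_iff) simp_all
  show ?thesis
  proof
    assume ?l
    then have u: "\<And>r. u r \<in> carrier_vec m" and b: "u 0 - (cmat B *\<^sub>v u 0 + cmat A1 *\<^sub>v u 1) = g 0"
      and i: "\<forall>r. u (Suc r) - (cmat Am *\<^sub>v u r + cmat A0 *\<^sub>v u (Suc r) + cmat A1 *\<^sub>v u (Suc (Suc r))) = g (Suc r)"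
      unfolding poisson_solution_iff[OF g] by blast+
    obtain x y where xy: "x \<in> carrier_vec m" "y \<in> carrier_vec p" "\<forall>r. u r = c.solution x y r"
      using c.interior_iff[of u, OF u] i by blast
    then show ?r using bd[OF xy(1,2)] b by auto
  next
    assume ?r
    then obtain x y where xy: "x \<in> carrier_vec m" "y \<in> carrier_vec p" "cmat H *\<^sub>v x = rhs y"
      "\<forall>r. u r = c.solution x y r" by blast
    have u: "\<And>r. u r \<in> carrier_vec m" using xy(4) by simp
    show ?l unfolding poisson_solution_iff[OF g]
      using u c.interior_iff[of u, OF u] xy bd[OF xy(1,2)] by auto
  qed
qed

end

section \<open>The positive recurrent case\<close>

locale qbd_poisson_stationary = qbd_poisson m B Am A0 A1 G Gh R p q n L K E F V1 V1i V0 g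
    + qbd_stationary m B Am A0 A1 G Gh R \<pi>
  for m :: nat and B Am A0 A1 G Gh R :: "real mat" and p q n :: nat
    and L K E F V1 V1i V0 :: "complex mat" and g :: "nat \<Rightarrow> complex vec" and \<pi> :: "nat \<Rightarrow> real vec" +
  assumes summable_R: "\<And>a. a < m \<Longrightarrow> summable (\<lambda>k. (cmat (R ^\<^sub>m k) *\<^sub>v g k) $ a)"
begin

text \<open>With \<open>\<pi>\<^sub>1 = \<pi>\<^sub>0 R\<close>, the balance at level \<open>0\<close> gives \<open>\<pi>\<^sub>0 (B - I) = - \<pi>\<^sub>0 R A\<^sub>-\<^sub>1\<close>, and \<open>A\<^sub>1 = R (I - U)\<close>, so
  \<open>\<pi>\<^sub>0\<close> times the left hand side is \<open>- \<pi>\<^sub>0 R Wi = - \<pi>\<^sub>0 Wi Gh\<close>.\<close>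

lemma projection_boundary:
  "projection * ((B - 1\<^sub>m m) * Gh + A1) = - (projection * (Wi * Gh))"
proof (rule mat_eq_if_mult_vec_eq)
  fix v :: "real vec" assume v: "v \<in> carrier_vec m"
  define x where "x = Gh *\<^sub>v v"
  have x: "x \<in> carrier_vec m" unfolding x_def by simp
  note sp = scalar_prod_add_distrib[of _ m] scalar_prod_minus_distrib[of _ m]
  have 1: "\<pi> 0 \<bullet> (B *\<^sub>v x) = \<pi> 0 \<bullet> x - \<pi> 0 \<bullet> (R *\<^sub>v (Am *\<^sub>v x))"
    using balance_0[OF x] \<pi>_Suc[of "Am *\<^sub>v x" 0] by simp
  have 2: "R *\<^sub>v v - R *\<^sub>v (U *\<^sub>v v) = A1 *\<^sub>v v"
    using arg_cong[OF R_one_minus_U, of "\<lambda>X. X *\<^sub>v v"] v by (simp add: vec_simps)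
  have W_R: "Wi *\<^sub>v (Gh *\<^sub>v v) = R *\<^sub>v (Wi *\<^sub>v v)"
  proof -
    have "Wi * Gh = Wi * Gh * (W * Wi)" unfolding W_Wi by (simp add: right_mult_one_mat[of _ m m])
    also have "\<dots> = Wi * (Gh * W) * Wi" by (simp add: assoc_mult_mat[of _ m m _ m _ m])
    also have "\<dots> = (Wi * W) * R * Wi" unfolding Gh_W by (simp add: assoc_mult_mat[of _ m m _ m _ m])
    also have "\<dots> = R * Wi" unfolding Wi_W by (simp add: left_mult_one_mat[of _ m m])
    finally have "Wi *\<^sub>v (Gh *\<^sub>v v) = (R * Wi) *\<^sub>v v"
      using mat_mult_vec_eqI[of Wi Gh "R * Wi" m m m v] v by simp
    then show ?thesis using v by (simp add: vec_simps)
  qed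
  have 3: "Wi *\<^sub>v v = U *\<^sub>v v + Am *\<^sub>v x - v"
    unfolding Wi_def x_def using v by (simp add: vec_simps)
  have "\<pi> 0 \<bullet> (((B - 1\<^sub>m m) * Gh + A1) *\<^sub>v v) = \<pi> 0 \<bullet> (B *\<^sub>v x - x + A1 *\<^sub>v v)"
    unfolding x_def using v by (simp add: vec_simps)
  also have "\<dots> = - (\<pi> 0 \<bullet> (R *\<^sub>v (Wi *\<^sub>v v)))"
    unfolding 3 2[symmetric] using v x 1 by (simp add: vec_simps sp)
  finally have eq: "\<pi> 0 \<bullet> (((B - 1\<^sub>m m) * Gh + A1) *\<^sub>v v) = - (\<pi> 0 \<bullet> (Wi *\<^sub>v (Gh *\<^sub>v v)))"
    unfolding W_R .
  have l: "(projection * ((B - 1\<^sub>m m) * Gh + A1)) *\<^sub>v v = projection *\<^sub>v (((B - 1\<^sub>m m) * Gh + A1) *\<^sub>v v)"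
    using v by (intro assoc_mult_mat_vec[of _ m m _ m]) auto
  have r: "(- (projection * (Wi * Gh))) *\<^sub>v v = - (projection *\<^sub>v (Wi *\<^sub>v (Gh *\<^sub>v v)))"
    using v by (simp add: vec_simps)
  show "(projection * ((B - 1\<^sub>m m) * Gh + A1)) *\<^sub>v v = (- (projection * (Wi * Gh))) *\<^sub>v v"
    unfolding l r
    using v by (intro eq_vec_entriesI[of _ m]) (auto simp: projection_mult_vec eq simp del: index_mult_mat_vec)
qed auto

text \<open>Both \<open>y\<^sup>*\<close> and the value of the particular solution at level \<open>0\<close> are linear images of this sum.\<close>

definition tail_sum :: "complex vec" where
  "tail_sum = vec m (\<lambda>a. \<Sum>k. (cmat R ^\<^sub>m Suc k *\<^sub>v g (Suc k)) $ a)"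

lemma tail_sum_carrier [simp]: "tail_sum \<in> carrier_vec m" "dim_vec tail_sum = m"
  unfolding tail_sum_def by simp_all

lemma summable_R_pow: "a < m \<Longrightarrow> summable (\<lambda>k. (cmat R ^\<^sub>m k *\<^sub>v g k) $ a)"
  using summable_R by (simp add: cmat_pow[of R m] del: index_mult_mat_vec)

lemma summable_R_pow_Suc: "a < m \<Longrightarrow> summable (\<lambda>k. (cmat R ^\<^sub>m Suc k *\<^sub>v g (Suc k)) $ a)"
  using summable_R_pow[of a] by (subst (asm) summable_Suc_iff[symmetric])

lemma full_sum: "vec m (\<lambda>a. \<Sum>k. (cmat R ^\<^sub>m k *\<^sub>v g k) $ a) = g 0 + tail_sum"
proof (rule eq_vec_entriesI[of _ m])
  fix a assume a: "a < m"
  have "(\<Sum>k. (cmat R ^\<^sub>m k *\<^sub>v g k) $ a) = (cmat R ^\<^sub>m 0 *\<^sub>v g 0) $ a + (\<Sum>k. (cmat R ^\<^sub>m Suc k *\<^sub>v g (Suc k)) $ a)"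
    using suminf_split_head[OF summable_R_pow[OF a]] by simp
  then show "vec m (\<lambda>a. \<Sum>k. (cmat R ^\<^sub>m k *\<^sub>v g k) $ a) $ a = (g 0 + tail_sum) $ a"
    unfolding tail_sum_def using a g[of 0] by (simp del: index_mult_mat_vec)
qed (use g in auto)

lemma Gh_pow_W: "v \<in> carrier_vec m \<Longrightarrow> cmat Gh ^\<^sub>m k *\<^sub>v (cmat W *\<^sub>v v) = cmat W *\<^sub>v (cmat R ^\<^sub>m k *\<^sub>v v)"
proof (induction k arbitrary: v)
  case (Suc k)
  have "cmat Gh ^\<^sub>m Suc k *\<^sub>v (cmat W *\<^sub>v v) = cmat Gh ^\<^sub>m k *\<^sub>v (cmat Gh *\<^sub>v (cmat W *\<^sub>v v))"
    using Suc.prems by (simp add: c.vec_simps)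
  also have "\<dots> = cmat W *\<^sub>v (cmat R ^\<^sub>m k *\<^sub>v (cmat R *\<^sub>v v))"
    unfolding c.identities_on_vec(6)[OF Suc.prems] by (rule Suc.IH) simp
  finally show ?case using Suc.prems by (simp add: c.vec_simps)
qed simp

lemma Gh_pow_split:
  assumes v: "v \<in> carrier_vec m"
  shows "E *\<^sub>v (cmat Gh ^\<^sub>m k *\<^sub>v v) = V1 ^\<^sub>m k *\<^sub>v (E *\<^sub>v v)" "F *\<^sub>v (cmat Gh ^\<^sub>m k *\<^sub>v v) = V0 ^\<^sub>m k *\<^sub>v (F *\<^sub>v v)"
proof -
  have "E *\<^sub>v (cmat Gh ^\<^sub>m k *\<^sub>v v) = V1 ^\<^sub>m k *\<^sub>v (E *\<^sub>v v) \<and> F *\<^sub>v (cmat Gh ^\<^sub>m k *\<^sub>v v) = V0 ^\<^sub>m k *\<^sub>v (F *\<^sub>v v)"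
  proof (induction k)
    case (Suc k)
    have "cmat Gh ^\<^sub>m Suc k *\<^sub>v v = cmat Gh *\<^sub>v (cmat Gh ^\<^sub>m k *\<^sub>v v)"
      using v by (simp add: pow_mat_Suc_left[of _ m] c.vec_simps del: pow_mat.simps)
    moreover have "V1 ^\<^sub>m Suc k *\<^sub>v (E *\<^sub>v v) = V1 *\<^sub>v (V1 ^\<^sub>m k *\<^sub>v (E *\<^sub>v v))"
      using v by (simp add: pow_mat_Suc_left[of _ p] assoc_mult_mat_vec[of _ p p _ p] del: pow_mat.simps)
    moreover have "V0 ^\<^sub>m Suc k *\<^sub>v (F *\<^sub>v v) = V0 *\<^sub>v (V0 ^\<^sub>m k *\<^sub>v (F *\<^sub>v v))"
      using v by (simp add: pow_mat_Suc_left[of _ q] assoc_mult_mat_vec[of _ q q _ q] del: pow_mat.simps)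
    ultimately show ?case using Suc c.identities_on_vec(10,11)[of "cmat Gh ^\<^sub>m k *\<^sub>v v"] by simp
  qed (use v in simp)
  then show "E *\<^sub>v (cmat Gh ^\<^sub>m k *\<^sub>v v) = V1 ^\<^sub>m k *\<^sub>v (E *\<^sub>v v)" "F *\<^sub>v (cmat Gh ^\<^sub>m k *\<^sub>v v) = V0 ^\<^sub>m k *\<^sub>v (F *\<^sub>v v)"
    by auto
qed

text \<open>Since \<open>V\<^sub>1\<^sup>k E W = E Gh\<^sup>k W = E W R\<^sup>k\<close>, the convergence of the series of \<open>R\<^sup>k g\<^sub>k\<close> passes to that of \<open>y\<^sup>*\<close>.\<close>

lemma V1_pow_term:
  "(V1 ^\<^sub>m Suc k * E * cmat W) *\<^sub>v g (Suc k) = E *\<^sub>v (cmat W *\<^sub>v (cmat R ^\<^sub>m Suc k *\<^sub>v g (Suc k)))"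
proof -
  have c: "V1 ^\<^sub>m Suc k * E \<in> carrier_mat p m" by (rule mult_carrier_mat[of _ _ p]) simp_all
  have "(V1 ^\<^sub>m Suc k * E * cmat W) *\<^sub>v g (Suc k) = (V1 ^\<^sub>m Suc k * E) *\<^sub>v (cmat W *\<^sub>v g (Suc k))"
    by (rule assoc_mult_mat_vec[OF c, of _ m]) (simp_all del: pow_mat.simps)
  also have "\<dots> = V1 ^\<^sub>m Suc k *\<^sub>v (E *\<^sub>v (cmat W *\<^sub>v g (Suc k)))"
    by (rule assoc_mult_mat_vec[of _ p p _ m]) (simp_all del: pow_mat.simps)
  also have "\<dots> = E *\<^sub>v (cmat Gh ^\<^sub>m Suc k *\<^sub>v (cmat W *\<^sub>v g (Suc k)))"
    by (rule Gh_pow_split(1)[symmetric]) simp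
  finally show ?thesis by (simp only: Gh_pow_W[OF g])
qed

definition ystar :: "complex vec" where
  "ystar = - (E *\<^sub>v (cmat W *\<^sub>v tail_sum))"

lemma ystar_carrier [simp]: "ystar \<in> carrier_vec p" "dim_vec ystar = p"
  unfolding ystar_def by simp_all

lemma
  shows V1_series_summable: "a < p \<Longrightarrow> summable (\<lambda>k. ((V1 ^\<^sub>m Suc k * E * cmat W) *\<^sub>v g (Suc k)) $ a)"
    and ystar_eq: "ystar = - vec p (\<lambda>a. \<Sum>k. ((V1 ^\<^sub>m Suc k * E * cmat W) *\<^sub>v g (Suc k)) $ a)"
proof -
  have EW: "E * cmat W \<in> carrier_mat p m" by (rule mult_carrier_mat[of _ _ m]) simp_all
  have t: "(V1 ^\<^sub>m Suc k * E * cmat W) *\<^sub>v g (Suc k) = (E * cmat W) *\<^sub>v (cmat R ^\<^sub>m Suc k *\<^sub>v g (Suc k))" for k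
    unfolding V1_pow_term by (rule assoc_mult_mat_vec[symmetric, of _ p m _ m]) (simp_all del: pow_mat.simps)
  have cR: "cmat R ^\<^sub>m Suc k *\<^sub>v g (Suc k) \<in> carrier_vec m" for k by (simp del: pow_mat.simps)
  show "summable (\<lambda>k. ((V1 ^\<^sub>m Suc k * E * cmat W) *\<^sub>v g (Suc k)) $ a)" if "a < p"
    unfolding t by (rule summable_mult_mat_vec(1)[OF EW cR summable_R_pow_Suc that])
  have "(\<Sum>k. ((V1 ^\<^sub>m Suc k * E * cmat W) *\<^sub>v g (Suc k)) $ a) = ((E * cmat W) *\<^sub>v tail_sum) $ a" if "a < p" for a
    unfolding t tail_sum_def by (rule summable_mult_mat_vec(2)[OF EW cR summable_R_pow_Suc that])
  moreover have "(E * cmat W) *\<^sub>v tail_sum = E *\<^sub>v (cmat W *\<^sub>v tail_sum)"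
    by (rule assoc_mult_mat_vec[of _ p m _ m]) simp_all
  ultimately show "ystar = - vec p (\<lambda>a. \<Sum>k. ((V1 ^\<^sub>m Suc k * E * cmat W) *\<^sub>v g (Suc k)) $ a)"
    unfolding ystar_def by (intro eq_vec_entriesI[of _ p]) (auto simp del: index_mult_mat_vec)
qed

lemma V0_pow_zero: "n < k \<Longrightarrow> V0 ^\<^sub>m k = 0\<^sub>m q q"
proof (induction k)
  case (Suc k)
  then show ?case
  proof (cases "n = k")
    case False
    then have "V0 ^\<^sub>m k = 0\<^sub>m q q" using Suc by simp
    then show ?thesis by (simp add: left_mult_zero_mat[of _ q q])
  qed (use nil in simp)
qed simp

text \<open>On the nilpotent part the series of the tail is a finite sum, which is the part of the
  particular solution at level \<open>0\<close>.\<close>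

lemma F_W_tail_sum:
  "F *\<^sub>v (cmat W *\<^sub>v tail_sum) = look_ahead q V0 (\<lambda>i. F *\<^sub>v (cmat W *\<^sub>v g i)) n 0"
proof (rule eq_vec_entriesI[of _ q])
  fix a assume a: "a < q"
  have FW: "F * cmat W \<in> carrier_mat q m" by (rule mult_carrier_mat[of _ _ m]) simp_all
  have cR: "cmat R ^\<^sub>m Suc k *\<^sub>v g (Suc k) \<in> carrier_vec m" for k by (simp del: pow_mat.simps)
  have t: "(F * cmat W) *\<^sub>v (cmat R ^\<^sub>m Suc k *\<^sub>v g (Suc k)) = V0 ^\<^sub>m Suc k *\<^sub>v (F *\<^sub>v (cmat W *\<^sub>v g (Suc k)))" for k
  proof -
    have "(F * cmat W) *\<^sub>v (cmat R ^\<^sub>m Suc k *\<^sub>v g (Suc k)) = F *\<^sub>v (cmat W *\<^sub>v (cmat R ^\<^sub>m Suc k *\<^sub>v g (Suc k)))"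
      by (rule assoc_mult_mat_vec[of _ q m _ m]) (simp_all del: pow_mat.simps)
    also have "\<dots> = F *\<^sub>v (cmat Gh ^\<^sub>m Suc k *\<^sub>v (cmat W *\<^sub>v g (Suc k)))" by (simp only: Gh_pow_W[OF g])
    also have "\<dots> = V0 ^\<^sub>m Suc k *\<^sub>v (F *\<^sub>v (cmat W *\<^sub>v g (Suc k)))" by (rule Gh_pow_split(2)) simp
    finally show ?thesis .
  qed
  have "(F *\<^sub>v (cmat W *\<^sub>v tail_sum)) $ a = ((F * cmat W) *\<^sub>v tail_sum) $ a"
    using assoc_mult_mat_vec[of F q m "cmat W" m tail_sum] by simp
  also have "\<dots> = (\<Sum>k. ((F * cmat W) *\<^sub>v (cmat R ^\<^sub>m Suc k *\<^sub>v g (Suc k))) $ a)"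
    unfolding tail_sum_def by (rule summable_mult_mat_vec(2)[OF FW cR summable_R_pow_Suc a, symmetric])
  also have "\<dots> = (\<Sum>k. (V0 ^\<^sub>m Suc k *\<^sub>v (F *\<^sub>v (cmat W *\<^sub>v g (Suc k)))) $ a)" unfolding t ..
  also have "\<dots> = (\<Sum>k<n. (V0 ^\<^sub>m Suc k *\<^sub>v (F *\<^sub>v (cmat W *\<^sub>v g (Suc k)))) $ a)"
  proof (rule suminf_finite)
    fix k assume "k \<notin> {..<n}"
    then have "V0 ^\<^sub>m Suc k = 0\<^sub>m q q" by (intro V0_pow_zero) simp
    then show "(V0 ^\<^sub>m Suc k *\<^sub>v (F *\<^sub>v (cmat W *\<^sub>v g (Suc k)))) $ a = 0"
      using a by (simp del: pow_mat.simps index_mult_mat_vec)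
  qed simp
  also have "\<dots> = (\<Sum>j\<in>{1..n}. (V0 ^\<^sub>m j *\<^sub>v (F *\<^sub>v (cmat W *\<^sub>v g (j + 0)))) $ a)"
    by (rule sum.reindex_bij_witness[of _ "\<lambda>j. j - 1" Suc]) auto
  also have "\<dots> = look_ahead q V0 (\<lambda>i. F *\<^sub>v (cmat W *\<^sub>v g i)) n 0 $ a"
    unfolding look_ahead_def by (rule vsum_entry[symmetric]) (use a in auto)
  finally show "(F *\<^sub>v (cmat W *\<^sub>v tail_sum)) $ a = look_ahead q V0 (\<lambda>i. F *\<^sub>v (cmat W *\<^sub>v g i)) n 0 $ a" .
qed auto

text \<open>The splitting of \<open>W tail_sum\<close> by \<open>L E + K F = I\<close> has \<open>- L y\<^sup>*\<close> and \<open>- particular 0\<close> as its two parts.\<close>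

lemma ystar_level_zero: "L *\<^sub>v ystar + c.particular 0 = - (cmat W *\<^sub>v tail_sum)"
proof -
  have Ly: "L *\<^sub>v ystar = - (L *\<^sub>v (E *\<^sub>v (cmat W *\<^sub>v tail_sum)))"
    unfolding ystar_def by (rule mult_mat_uminus_vec[of _ m p]) simp_all
  have "L *\<^sub>v ystar + c.particular 0 = L *\<^sub>v ystar - K *\<^sub>v (F *\<^sub>v (cmat W *\<^sub>v tail_sum))"
    unfolding c.level_one_part(2)[OF ystar_carrier(1)] c.expanding_def F_W_tail_sum by simp
  also have "\<dots> = - (L *\<^sub>v (E *\<^sub>v (cmat W *\<^sub>v tail_sum))) - K *\<^sub>v (F *\<^sub>v (cmat W *\<^sub>v tail_sum))"
    unfolding Ly ..
  also have "- (L *\<^sub>v (E *\<^sub>v (cmat W *\<^sub>v tail_sum))) - K *\<^sub>v (F *\<^sub>v (cmat W *\<^sub>v tail_sum))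
      = - (L *\<^sub>v (E *\<^sub>v (cmat W *\<^sub>v tail_sum)) + K *\<^sub>v (F *\<^sub>v (cmat W *\<^sub>v tail_sum)))"
    by (intro eq_vec_entriesI[of _ m]) (auto simp del: index_mult_mat_vec)
  also have "L *\<^sub>v (E *\<^sub>v (cmat W *\<^sub>v tail_sum)) + K *\<^sub>v (F *\<^sub>v (cmat W *\<^sub>v tail_sum)) = cmat W *\<^sub>v tail_sum"
    by (rule c.identities_on_vec(9)) simp
  finally show ?thesis .
qed

lemma cproj_mult_vec:
  assumes v: "v \<in> carrier_vec m"
  shows "cmat projection *\<^sub>v v = ((cvec (\<pi> 0) \<bullet> v) / of_real level0_mass) \<cdot>\<^sub>v ones m"
proof (rule eq_vec_entriesI[of _ m])
  fix a assume a: "a < m"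
  then show "(cmat projection *\<^sub>v v) $ a = (((cvec (\<pi> 0) \<bullet> v) / of_real level0_mass) \<cdot>\<^sub>v ones m) $ a"
    using v by (simp add: mult_mat_vec_entry[of _ m m] projection_def scalar_prod_entries[of _ m]
        sum_divide_distrib del: index_mult_mat_vec)
qed auto

lemma cproj_zero_iff:
  assumes v: "v \<in> carrier_vec m"
  shows "cmat projection *\<^sub>v v = 0\<^sub>v m \<longleftrightarrow> cvec (\<pi> 0) \<bullet> v = 0"
proof
  assume "cmat projection *\<^sub>v v = 0\<^sub>v m"
  from arg_cong[OF this, of "\<lambda>x. x $ 0"] have "(cvec (\<pi> 0) \<bullet> v) / complex_of_real level0_mass = 0"
    using m unfolding cproj_mult_vec[OF v] by simp
  then show "cvec (\<pi> 0) \<bullet> v = 0" using level0_mass_pos by simp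
qed (simp add: cproj_mult_vec[OF v])

text \<open>The left null vector of \<open>I - P\<^sub>*\<close> turns the right hand side into the condition on \<open>y\<close>.\<close>

lemma cproj_rhs:
  assumes y: "y \<in> carrier_vec p"
  shows "cmat projection *\<^sub>v rhs (ystar + y) =
    cmat projection *\<^sub>v (g 0 + tail_sum - cmat Wi *\<^sub>v (L *\<^sub>v y))"
proof -
  let ?p = "cmat projection"
  have pc [simp]: "?p \<in> carrier_mat m m" by simp
  define w where "w = c.particular 1 + (L * V1i) *\<^sub>v (ystar + y)"
  have w: "w \<in> carrier_vec m" unfolding w_def by simp
  have yc: "ystar + y \<in> carrier_vec p" using y by simp
  have Ghw: "cmat Gh *\<^sub>v w = L *\<^sub>v y - cmat W *\<^sub>v tail_sum"
  proof -
    have "cmat Gh *\<^sub>v w = L *\<^sub>v (ystar + y) + c.particular 0"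
      unfolding w_def by (rule c.level_one_part(3)[OF yc])
    also have "\<dots> = L *\<^sub>v y + (L *\<^sub>v ystar + c.particular 0)"
      using y by (intro eq_vec_entriesI[of _ m])
        (auto simp: mult_add_distrib_mat_vec[of L m p] simp del: index_mult_mat_vec)
    finally show ?thesis unfolding ystar_level_zero
      by (simp add: minus_add_uminus_vec[of _ m])
  qed
  have b: "?p * cmat ((B - 1\<^sub>m m) * Gh + A1) = - (?p * (cmat Wi * cmat Gh))"
  proof -
    have "?p * cmat ((B - 1\<^sub>m m) * Gh + A1) = cmat (projection * ((B - 1\<^sub>m m) * Gh + A1))"
      by (rule cmat_mult[symmetric, of _ m m _ m]) simp_all
    also have "\<dots> = cmat (- (projection * (Wi * Gh)))" unfolding projection_boundary ..
    also have "\<dots> = - cmat (projection * (Wi * Gh))"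
      by (intro eq_mat_entriesI[of _ m m]) (auto simp del: index_mult_mat(1))
    finally show ?thesis by (simp add: cmat_mult[of _ m m _ m])
  qed
  have "?p *\<^sub>v (cmat ((B - 1\<^sub>m m) * Gh + A1) *\<^sub>v w) = (?p * cmat ((B - 1\<^sub>m m) * Gh + A1)) *\<^sub>v w"
    using w by (intro assoc_mult_mat_vec[symmetric, of _ m m _ m]) auto
  also have "\<dots> = - (?p *\<^sub>v (cmat Wi *\<^sub>v (cmat Gh *\<^sub>v w)))"
    unfolding b using w by (simp add: assoc_mult_mat_vec[of _ m m _ m])
  also have "cmat Wi *\<^sub>v (cmat Gh *\<^sub>v w) = cmat Wi *\<^sub>v (L *\<^sub>v y) - tail_sum"
    unfolding Ghw using y c.identities_on_vec(7)[of tail_sum] by (simp add: mult_minus_distrib_mat_vec[of _ m m])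
  also have "- (?p *\<^sub>v (cmat Wi *\<^sub>v (L *\<^sub>v y) - tail_sum)) = ?p *\<^sub>v (tail_sum - cmat Wi *\<^sub>v (L *\<^sub>v y))"
    by (intro eq_vec_entriesI[of _ m]) (auto simp: mult_minus_distrib_mat_vec[of _ m m] simp del: index_mult_mat_vec)
  finally have 1: "?p *\<^sub>v (cmat ((B - 1\<^sub>m m) * Gh + A1) *\<^sub>v w) = ?p *\<^sub>v (tail_sum - cmat Wi *\<^sub>v (L *\<^sub>v y))" .
  have "?p *\<^sub>v rhs (ystar + y) = ?p *\<^sub>v (tail_sum - cmat Wi *\<^sub>v (L *\<^sub>v y)) + ?p *\<^sub>v g 0"
    unfolding rhs_def w_def[symmetric] using w g by (subst mult_add_distrib_mat_vec[of _ m m]) (auto simp: 1 simp del: index_mult_mat_vec)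
  also have "\<dots> = ?p *\<^sub>v ((tail_sum - cmat Wi *\<^sub>v (L *\<^sub>v y)) + g 0)"
    using g by (intro mult_add_distrib_mat_vec[symmetric, of _ m m]) auto
  also have "(tail_sum - cmat Wi *\<^sub>v (L *\<^sub>v y)) + g 0 = g 0 + tail_sum - cmat Wi *\<^sub>v (L *\<^sub>v y)"
    using g by (intro eq_vec_entriesI[of _ m]) (auto simp del: index_mult_mat_vec)
  finally show ?thesis .
qed

lemma \<pi>_g_term: "cvec (\<pi> i) \<bullet> g i = cvec (\<pi> 0) \<bullet> (cmat R ^\<^sub>m i *\<^sub>v g i)"
proof -
  have "\<pi> i $ b = (\<Sum>a<m. \<pi> 0 $ a * (R ^\<^sub>m i) $$ (a, b))" if b: "b < m" for b
    unfolding \<pi>_entry[OF b]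
    using b by (simp add: scalar_prod_entries[of _ m] unit_vec_mult_entry[of _ m] del: index_mult_mat_vec)
  then have "cvec (\<pi> i) \<bullet> g i = (\<Sum>b<m. (\<Sum>a<m. cvec (\<pi> 0) $ a * cmat (R ^\<^sub>m i) $$ (a, b)) * g i $ b)"
    using g[of i] by (simp add: scalar_prod_entries[of _ m])
  also have "\<dots> = cvec (\<pi> 0) \<bullet> (cmat (R ^\<^sub>m i) *\<^sub>v g i)"
    using g by (intro scalar_prod_mult_mat_vec[symmetric]) auto
  finally show ?thesis by (simp add: cmat_pow[of _ m])
qed

lemma
  shows \<pi>_g_summable: "summable (\<lambda>i. cvec (\<pi> i) \<bullet> g i)"
    and \<pi>_g_sum: "(\<Sum>i. cvec (\<pi> i) \<bullet> g i) = cvec (\<pi> 0) \<bullet> (g 0 + tail_sum)"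
proof -
  have t: "cvec (\<pi> i) \<bullet> g i = (\<Sum>a<m. cvec (\<pi> 0) $ a * (cmat R ^\<^sub>m i *\<^sub>v g i) $ a)" for i
    unfolding \<pi>_g_term by (rule scalar_prod_entries) simp
  show "summable (\<lambda>i. cvec (\<pi> i) \<bullet> g i)"
    unfolding t using summable_R_pow by (intro summable_sum summable_mult) auto
  have "(\<Sum>i. cvec (\<pi> i) \<bullet> g i) = (\<Sum>a<m. \<Sum>i. cvec (\<pi> 0) $ a * (cmat R ^\<^sub>m i *\<^sub>v g i) $ a)"
    unfolding t using summable_R_pow by (intro suminf_sum summable_mult) auto
  also have "\<dots> = (\<Sum>a<m. cvec (\<pi> 0) $ a * (\<Sum>i. (cmat R ^\<^sub>m i *\<^sub>v g i) $ a))"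
    using summable_R_pow by (intro sum.cong refl suminf_mult) auto
  also have "\<dots> = cvec (\<pi> 0) \<bullet> (g 0 + tail_sum)"
    unfolding full_sum[symmetric] by (simp add: scalar_prod_entries[of _ m] del: index_mult_mat_vec)
  finally show "(\<Sum>i. cvec (\<pi> i) \<bullet> g i) = cvec (\<pi> 0) \<bullet> (g 0 + tail_sum)" .
qed

text \<open>Since \<open>H\<close> and its group inverse multiply to the complementary projection in both orders, the
  equation is solvable exactly on the kernel of the projection, and the group inverse gives a
  solution up to the kernel of \<open>H\<close>.\<close>

lemma H_solution_iff:
  assumes x: "x \<in> carrier_vec m" and z: "z \<in> carrier_vec m"
  shows "cmat H *\<^sub>v x = z \<longleftrightarrow>
    cmat projection *\<^sub>v z = 0\<^sub>v m \<and> (\<exists>\<alpha>. x = cmat (group_inverse H) *\<^sub>v z + \<alpha> \<cdot>\<^sub>v ones m)"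
proof -
  let ?p = "cmat projection" and ?X = "cmat (group_inverse H)" and ?H = "cmat H"
  note gi = group_inverse_H
  have Hc: "H \<in> carrier_mat m m" by simp
  have cH: "?H \<in> carrier_mat m m" "?X \<in> carrier_mat m m" "?p \<in> carrier_mat m m" using gi(4) by simp_all
  have I: "(1\<^sub>m m - ?p) *\<^sub>v v = v - ?p *\<^sub>v v" if "v \<in> carrier_vec m" for v
    using that by (simp add: minus_mult_distrib_mat_vec[of _ m m])
  have HX: "?H *\<^sub>v (?X *\<^sub>v v) = v - ?p *\<^sub>v v" if v: "v \<in> carrier_vec m" for v
  proof -
    have "?H * ?X = 1\<^sub>m m - ?p"
      unfolding cmat_mult[OF Hc gi(4), symmetric] gi(2) by (simp add: cmat_minus[of _ m m] cmat_one)
    then show ?thesis using mat_mult_vec_eqI[OF _ cH(1,2) v] I[OF v] by metis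
  qed
  have XH: "?X *\<^sub>v (?H *\<^sub>v v) = v - ?p *\<^sub>v v" if v: "v \<in> carrier_vec m" for v
  proof -
    have "?X * ?H = 1\<^sub>m m - ?p"
      unfolding cmat_mult[OF gi(4) Hc, symmetric] gi(3) by (simp add: cmat_minus[of _ m m] cmat_one)
    then show ?thesis using mat_mult_vec_eqI[OF _ cH(2,1) v] I[OF v] by metis
  qed
  have pH: "?p *\<^sub>v (?H *\<^sub>v v) = 0\<^sub>v m" if v: "v \<in> carrier_vec m" for v
  proof -
    have "?p * ?H = 0\<^sub>m m m"
      unfolding cmat_mult[OF projection_carrier Hc, symmetric] projection_H
      by (intro eq_mat_entriesI[of _ m m]) auto
    then show ?thesis using mat_mult_vec_eqI[OF _ cH(3,1) v] v by simp
  qed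
  have H1: "?H *\<^sub>v ones m = 0\<^sub>v m"
  proof (rule eq_vec_entriesI[of _ m])
    fix a assume a: "a < m"
    have "(\<Sum>b<m. H $$ (a, b)) = (H *\<^sub>v (1 \<cdot>\<^sub>v ones m)) $ a"
      using a by (subst mult_mat_vec_entry[of _ m m]) auto
    then have "(\<Sum>b<m. H $$ (a, b)) = 0" unfolding H_ones using a by simp
    then have "complex_of_real (\<Sum>b<m. H $$ (a, b)) = 0" by simp
    then show "(?H *\<^sub>v ones m) $ a = 0\<^sub>v m $ a"
      using a by (subst mult_mat_vec_entry[of _ m m]) auto
  qed simp_all
  show ?thesis
  proof
    assume eq: "?H *\<^sub>v x = z"
    have "?p *\<^sub>v z = 0\<^sub>v m" using pH[OF x] eq by simp
    moreover have "x = ?X *\<^sub>v z + ?p *\<^sub>v x"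
      unfolding eq[symmetric] XH[OF x] using x by (intro eq_vec_entriesI[of _ m]) auto
    ultimately show "?p *\<^sub>v z = 0\<^sub>v m \<and> (\<exists>\<alpha>. x = ?X *\<^sub>v z + \<alpha> \<cdot>\<^sub>v ones m)"
      unfolding cproj_mult_vec[OF x] by blast
  next
    assume "?p *\<^sub>v z = 0\<^sub>v m \<and> (\<exists>\<alpha>. x = ?X *\<^sub>v z + \<alpha> \<cdot>\<^sub>v ones m)"
    then obtain \<alpha> where pz: "?p *\<^sub>v z = 0\<^sub>v m" and x: "x = ?X *\<^sub>v z + \<alpha> \<cdot>\<^sub>v ones m" by blast
    have Xz: "?X *\<^sub>v z \<in> carrier_vec m" using cH by simp
    have "?H *\<^sub>v x = ?H *\<^sub>v (?X *\<^sub>v z) + ?H *\<^sub>v (\<alpha> \<cdot>\<^sub>v ones m)"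
      unfolding x by (rule mult_add_distrib_mat_vec[OF cH(1) Xz]) simp
    also have "?H *\<^sub>v (\<alpha> \<cdot>\<^sub>v ones m) = \<alpha> \<cdot>\<^sub>v (?H *\<^sub>v ones m)"
      by (rule mult_mat_vec[OF cH(1)]) simp
    finally show "?H *\<^sub>v x = z" unfolding H1 HX[OF z] pz using z by auto
  qed
qed

lemma poisson_solution_stationary:
  "poisson_solution m P g u \<longleftrightarrow>
    (\<exists>y\<in>carrier_vec p. cvec (\<pi> 0) \<bullet> ((cmat Wi * L) *\<^sub>v y) = (\<Sum>i. cvec (\<pi> i) \<bullet> g i) \<and>
      (\<exists>\<alpha>. \<forall>r. u r = c.solution (cmat (group_inverse H) *\<^sub>v rhs (ystar + y) + \<alpha> \<cdot>\<^sub>v ones m) (ystar + y) r))"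
  (is "_ \<longleftrightarrow> ?r")
proof -
  have cond: "cmat projection *\<^sub>v rhs (ystar + y) = 0\<^sub>v m \<longleftrightarrow>
      cvec (\<pi> 0) \<bullet> ((cmat Wi * L) *\<^sub>v y) = (\<Sum>i. cvec (\<pi> i) \<bullet> g i)" if y: "y \<in> carrier_vec p" for y
  proof -
    have WL: "(cmat Wi * L) *\<^sub>v y = cmat Wi *\<^sub>v (L *\<^sub>v y)"
      using y by (intro assoc_mult_mat_vec[of _ m m _ p]) auto
    have c: "g 0 + tail_sum - cmat Wi *\<^sub>v (L *\<^sub>v y) \<in> carrier_vec m" by simp
    show ?thesis
      unfolding cproj_rhs[OF y] cproj_zero_iff[OF c] \<pi>_g_sum WL
      using g by (subst scalar_prod_minus_distrib[of _ m]) auto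
  qed
  have gX: "group_inverse H \<in> carrier_mat m m" by (rule group_inverse_H(4))
  have "poisson_solution m P g u \<longleftrightarrow>
    (\<exists>x\<in>carrier_vec m. \<exists>y\<in>carrier_vec p. cmat H *\<^sub>v x = rhs y \<and> (\<forall>r. u r = c.solution x y r))"
    by (rule poisson_solution_form) simp
  also have "\<dots> \<longleftrightarrow> ?r"
  proof
    assume "\<exists>x\<in>carrier_vec m. \<exists>y\<in>carrier_vec p. cmat H *\<^sub>v x = rhs y \<and> (\<forall>r. u r = c.solution x y r)"
    then obtain x y where x: "x \<in> carrier_vec m" and y: "y \<in> carrier_vec p" and eq: "cmat H *\<^sub>v x = rhs y"
      and u: "\<forall>r. u r = c.solution x y r" by blast
    define y' where "y' = y - ystar"
    have y': "y' \<in> carrier_vec p" unfolding y'_def using y by simp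
    have yy: "ystar + y' = y" unfolding y'_def using y
      by (intro eq_vec_entriesI[of _ p]) auto
    obtain \<alpha> where "cmat projection *\<^sub>v rhs y = 0\<^sub>v m" "x = cmat (group_inverse H) *\<^sub>v rhs y + \<alpha> \<cdot>\<^sub>v ones m"
      using iffD1[OF H_solution_iff[OF x rhs_carrier(1)] eq] by blast
    then show ?r using u y' cond[OF y'] unfolding yy by (intro bexI[of _ y']) (auto simp: yy)
  next
    assume ?r
    then obtain y \<alpha> where y: "y \<in> carrier_vec p"
      and c: "cvec (\<pi> 0) \<bullet> ((cmat Wi * L) *\<^sub>v y) = (\<Sum>i. cvec (\<pi> i) \<bullet> g i)"
      and u: "\<forall>r. u r = c.solution (cmat (group_inverse H) *\<^sub>v rhs (ystar + y) + \<alpha> \<cdot>\<^sub>v ones m) (ystar + y) r"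
      by blast
    define x where "x = cmat (group_inverse H) *\<^sub>v rhs (ystar + y) + \<alpha> \<cdot>\<^sub>v ones m"
    have x: "x \<in> carrier_vec m" unfolding x_def using gX by simp
    have "cmat H *\<^sub>v x = rhs (ystar + y)"
      by (rule iffD2[OF H_solution_iff[OF x rhs_carrier(1)]]) (use cond[OF y] c x_def in blast)
    then show "\<exists>x\<in>carrier_vec m. \<exists>y\<in>carrier_vec p. cmat H *\<^sub>v x = rhs y \<and> (\<forall>r. u r = c.solution x y r)"
      using x y u unfolding x_def by (intro bexI[of _ "cmat (group_inverse H) *\<^sub>v rhs (ystar + y) + \<alpha> \<cdot>\<^sub>v ones m"]
          bexI[of _ "ystar + y"]) auto
  qed
  finally show ?thesis .
qed

end

section \<open>The general solution of the Poisson equation\<close>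

lemma qbd_process_intro:
  assumes m: "1 \<le> m"
    and nn: "nonneg_square m B" "nonneg_square m Am" "nonneg_square m A0" "nonneg_square m A1"
    and stochastic: "stochastic_on (qbd_states m) (qbd B Am A0 A1)"
    and irreducible: "irreducible_on (qbd_states m) (qbd B Am A0 A1)"
    and irreducible_A: "irreducible_on {..<m} (\<lambda>i j. (Am + A0 + A1) $$ (i, j))"
    and final_class: "unique_final_class m Am A0 A1"
    and G: "minimal_nonneg_solution m (\<lambda>X. Am + (A0 - 1\<^sub>m m) * X + A1 * (X * X)) G"
    and Gh: "minimal_nonneg_solution m (\<lambda>X. A1 + (A0 - 1\<^sub>m m) * X + Am * (X * X)) Gh"
    and R: "minimal_nonneg_solution m (\<lambda>X. A1 + X * (A0 - 1\<^sub>m m) + (X * X) * Am) R"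
  shows "qbd_process m B Am A0 A1 G Gh R"
proof -
  interpret chain: qbd_chain m B Am A0 A1
    using m nn stochastic irreducible by unfold_locales
  define A where "A = Am + A0 + A1"
  have A: "nonneg_square m A" unfolding A_def using nn by (intro nonneg_square_add)
  have Av: "(A *\<^sub>v v) $ a = (Am *\<^sub>v v) $ a + (A0 *\<^sub>v v) $ a + (A1 *\<^sub>v v) $ a"
    if "v \<in> carrier_vec m" "a < m" for v a
    using that unfolding A_def by (simp add: add_mult_distrib_mat_vec[of _ m m] del: index_mult_mat_vec)
  have A1: "(A *\<^sub>v ones m) $ a = 1" if "a < m" for a
    using chain.total_Suc[OF that] that by (simp add: Av del: index_mult_mat_vec)
  have irrA: "irreducible_on {..<m} (\<lambda>i j. A $$ (i, j))"
    using irreducible_A unfolding A_def .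
  have phase: "v $ b = c"
    if "v \<in> carrier_vec m" "\<And>a. a < m \<Longrightarrow> v $ a \<le> c"
      "\<And>a. a < m \<Longrightarrow> v $ a \<le> (Am *\<^sub>v v) $ a + (A0 *\<^sub>v v) $ a + (A1 *\<^sub>v v) $ a"
      "a < m" "v $ a = c" "b < m" for v c a b
    by (rule phase_maximum_if_irreducible[OF A A1 irrA that(1,2) _ that(4-6)])
      (use that(1,3) in \<open>auto simp: Av simp del: index_mult_mat_vec\<close>)
  note two = two_sided_maximum_if_final_class[OF nn(2-4) chain.total_Suc final_class]
  have "level_walk m Am A0 A1 G"
  proof
    show "\<exists>b<m. \<forall>k. F k $ b = c"
      if "\<And>i. F i \<in> carrier_vec m" "\<And>i a. a < m \<Longrightarrow> F i $ a \<le> c"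
        "\<And>i a. a < m \<Longrightarrow> F i $ a \<le> (Am *\<^sub>v F (i - 1)) $ a + (A0 *\<^sub>v F i) $ a + (A1 *\<^sub>v F (i + 1)) $ a"
        "a < m" "F (i :: int) $ a = c" for F c i a
      by (rule two[where F = F and c = c and i = i and a = a, OF _ that])
  qed (fact m nn chain.total_Suc phase G)+
  moreover have "level_walk m A1 A0 Am Gh"
  proof
    show "(A1 *\<^sub>v ones m) $ a + (A0 *\<^sub>v ones m) $ a + (Am *\<^sub>v ones m) $ a = 1" if "a < m" for a
      using chain.total_Suc[OF that] by simp
    show "v $ b = c"
      if v: "v \<in> carrier_vec m" "\<And>a. a < m \<Longrightarrow> v $ a \<le> c"
        "\<And>a. a < m \<Longrightarrow> v $ a \<le> (A1 *\<^sub>v v) $ a + (A0 *\<^sub>v v) $ a + (Am *\<^sub>v v) $ a"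
        "a < m" "v $ a = c" "b < m" for v c a b
    proof (rule phase[OF v(1,2) _ v(4-6)])
      show "v $ a \<le> (Am *\<^sub>v v) $ a + (A0 *\<^sub>v v) $ a + (A1 *\<^sub>v v) $ a" if "a < m" for a
        using v(3)[OF that] by simp
    qed
    show "\<exists>b<m. \<forall>k. F k $ b = c"
      if F: "\<And>i. F i \<in> carrier_vec m" "\<And>i a. a < m \<Longrightarrow> F i $ a \<le> c"
        "\<And>i a. a < m \<Longrightarrow> F i $ a \<le> (A1 *\<^sub>v F (i - 1)) $ a + (A0 *\<^sub>v F i) $ a + (Am *\<^sub>v F (i + 1)) $ a"
        "a < m" "F (i :: int) $ a = c" for F c i a
    proof -
      \<comment> \<open>Reversing the levels exchanges the roles of the upward and downward blocks.\<close>
      have "\<exists>b<m. \<forall>k. F (- k) $ b = c"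
      proof (rule two[where F = "\<lambda>k. F (- k)" and c = c and i = "- i" and a = a])
        show "F (- i) $ a \<le> (Am *\<^sub>v F (- (i - 1))) $ a + (A0 *\<^sub>v F (- i)) $ a + (A1 *\<^sub>v F (- (i + 1))) $ a"
          if "a < m" for i a
        proof -
          have "- (i - 1) = - i + 1" "- (i + 1) = - i - 1" by auto
          then show ?thesis using F(3)[OF that, of "- i"] by simp
        qed
      qed (use F in auto)
      then obtain b where "b < m" "\<And>k. F (- k) $ b = c" by blast
      then have "F k $ b = c" for k using minus_minus[of k] by metis
      then show ?thesis using \<open>b < m\<close> by blast
    qed
  qed (fact m nn Gh)+
  ultimately show ?thesis
    unfolding qbd_process_def qbd_core_def qbd_core_axioms_def
    using chain.qbd_chain_axioms R by blast
qed

theorem theorem3: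
  fixes m p \<nu> :: nat
    and B Am A0 A1 G Gh R U W Pstar :: "real mat"
    and P :: "nat \<times> nat \<Rightarrow> nat \<times> nat \<Rightarrow> real"
    and M L K E F V1 V0 :: "complex mat"
    and \<pi> :: "nat \<Rightarrow> real vec"
    and g \<sigma> :: "nat \<Rightarrow> complex vec"
  assumes m: "1 \<le> m"
    and blocks: "B \<in> carrier_mat m m" "Am \<in> carrier_mat m m"
      "A0 \<in> carrier_mat m m" "A1 \<in> carrier_mat m m"
    and nonneg: "0\<^sub>m m m \<le> B" "0\<^sub>m m m \<le> Am" "0\<^sub>m m m \<le> A0" "0\<^sub>m m m \<le> A1"
    and P: "P = qbd B Am A0 A1"
    and stochastic: "stochastic_on (qbd_states m) P"
    and irreducible: "irreducible_on (qbd_states m) P"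
    and irreducible_A: "irreducible_on {..<m} (\<lambda>i j. (Am + A0 + A1) $$ (i, j))"
    and final_class: "unique_final_class m Am A0 A1"
    and G: "minimal_nonneg_solution m (\<lambda>X. Am + (A0 - 1\<^sub>m m) * X + A1 * (X * X)) G"
    and Gh: "minimal_nonneg_solution m (\<lambda>X. A1 + (A0 - 1\<^sub>m m) * X + Am * (X * X)) Gh"
    and R: "minimal_nonneg_solution m (\<lambda>X. A1 + X * (A0 - 1\<^sub>m m) + (X * X) * Am) R"
    and U: "U = A0 + R * Am"
    and W: "W = mat m m (\<lambda>(a, b). \<Sum>j. W_term G U R j $$ (a, b))"
    and Pstar: "Pstar = B + A1 * G"
    and p: "p \<le> m"
    and M: "M \<in> carrier_mat m m" "invertible_mat M"
    and V1: "V1 \<in> carrier_mat p p" "invertible_mat V1"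
    and V0: "V0 \<in> carrier_mat (m - p) (m - p)" "p < m \<Longrightarrow> spectral_radius V0 = 0"
    and Jordan: "cmat Gh * M = M * four_block_mat V1 (0\<^sub>m p (m - p)) (0\<^sub>m (m - p) p) V0"
    and LK: "L \<in> carrier_mat m p" "K \<in> carrier_mat m (m - p)"
      "M = four_block_mat L K (0\<^sub>m 0 p) (0\<^sub>m 0 (m - p))"
    and EF: "E \<in> carrier_mat p m" "F \<in> carrier_mat (m - p) m" "minv M = E @\<^sub>r F"
    and \<nu>: "\<nu> = (LEAST n. 0 < n \<and> V0 ^\<^sub>m n = 0\<^sub>m (m - p) (m - p))"
    and \<pi>: "positive_recurrent_chain (qbd_states m) P \<Longrightarrow>
      (\<forall>i. \<pi> i \<in> carrier_vec m) \<and>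
      stationary_distribution_on (qbd_states m) P (\<lambda>(i, a). \<pi> i $ a)"
    and not_null: "\<not> null_recurrent_chain (qbd_states m) P"
    and g: "\<And>r. g r \<in> carrier_vec m"
    and \<sigma>: "\<And>r. \<sigma> r =
      - vsum m (\<lambda>k. ((cmat G ^\<^sub>m (r - k) - L * minv V1 ^\<^sub>m (r - k) * E) * cmat W) *\<^sub>v g k) {1..r}
      - vsum m (\<lambda>j. (K * V0 ^\<^sub>m j * F * cmat W) *\<^sub>v g (j + r)) {1..\<nu> - 1}"
  defines "solution_form \<equiv> \<lambda>x y r.
      (cmat G ^\<^sub>m r) *\<^sub>v x + (L * minv V1 ^\<^sub>m r) *\<^sub>v y + \<sigma> r"
    and "rhs \<equiv> \<lambda>y.
      (cmat ((B - 1\<^sub>m m) * Gh + A1)) *\<^sub>v (\<sigma> 1 + (L * minv V1) *\<^sub>v y) + g 0"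
  shows
    "invertible_mat (U - 1\<^sub>m m) \<and>
     (\<forall>a<m. \<forall>b<m. summable (\<lambda>j. W_term G U R j $$ (a, b))) \<and>
     invertible_mat W \<and>
     (\<forall>u. poisson_solution m P g u \<longrightarrow>
        (\<exists>x \<in> carrier_vec m. \<exists>y \<in> carrier_vec p. \<forall>r. u r = solution_form x y r)) \<and>
     \<sigma> 1 = - vsum m (\<lambda>j. (K * V0 ^\<^sub>m j * F * cmat W) *\<^sub>v g (j + 1)) {0..\<nu> - 1} \<and>
     (transient_chain (qbd_states m) P \<longrightarrow>
        invertible_mat (1\<^sub>m m - Pstar) \<and>
        (\<forall>u. poisson_solution m P g u \<longleftrightarrow>
           (\<exists>y \<in> carrier_vec p. \<exists>x.
              x = cmat (minv (1\<^sub>m m - Pstar)) *\<^sub>v rhs y \<and>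
              (\<forall>r. u r = solution_form x y r)))) \<and>
     (positive_recurrent_chain (qbd_states m) P \<and>
      (\<forall>a<m. summable (\<lambda>k. (cmat (R ^\<^sub>m k) *\<^sub>v g k) $ a)) \<longrightarrow>
        (\<exists>X. is_group_inverse (1\<^sub>m m - Pstar) X) \<and>
        (\<forall>a<p. summable (\<lambda>k. ((V1 ^\<^sub>m Suc k * E * cmat W) *\<^sub>v g (Suc k)) $ a)) \<and>
        summable (\<lambda>i. cvec (\<pi> i) \<bullet> g i) \<and>
        (\<forall>u. poisson_solution m P g u \<longleftrightarrow>
           (\<exists>y\<^sub>s \<in> carrier_vec p. \<exists>y\<^sub>p \<in> carrier_vec p. \<exists>y x. \<exists>\<alpha> :: complex.
              y\<^sub>s = - vec p (\<lambda>a. \<Sum>k. ((V1 ^\<^sub>m Suc k * E * cmat W) *\<^sub>v g (Suc k)) $ a) \<and>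
              cvec (\<pi> 0) \<bullet> ((cmat (minv W) * L) *\<^sub>v y\<^sub>p) = (\<Sum>i. cvec (\<pi> i) \<bullet> g i) \<and>
              y = y\<^sub>s + y\<^sub>p \<and>
              x = cmat (group_inverse (1\<^sub>m m - Pstar)) *\<^sub>v rhs y + \<alpha> \<cdot>\<^sub>v vec m (\<lambda>_. 1) \<and>
              (\<forall>r. u r = solution_form x y r))))"
proof -
  have nn: "nonneg_square m B" "nonneg_square m Am" "nonneg_square m A0" "nonneg_square m A1"
    using blocks nonneg by (simp_all add: nonneg_square_iff_le)
  interpret process: qbd_process m B Am A0 A1 G Gh R
    using m nn stochastic irreducible irreducible_A final_class G Gh R unfolding P by (rule qbd_process_intro)
  have P': "P = process.P" by (rule P)
  have U': "U = process.U" unfolding U process.U_eq ..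
  have Pstar': "Pstar = process.Pstar" unfolding Pstar process.Pstar_def ..

  have stationary: "qbd_stationary m B Am A0 A1 G Gh R \<pi>" if "positive_recurrent_chain (qbd_states m) P"
    using \<pi>[OF that] unfolding P' by unfold_locales auto
  have not_stochastic: "G *\<^sub>v ones m \<noteq> ones m" if "\<not> recurrent_chain (qbd_states m) P"
    using process.recurrent_if_stochastic that unfolding P' by blast
  have "qbd_green m Am A0 A1 G Gh R \<and> process.green * R = Gh * process.green"
  proof (cases "recurrent_chain (qbd_states m) P")
    case True
    then have "positive_recurrent_chain (qbd_states m) P"
      using not_null unfolding null_recurrent_chain_def by blast
    then interpret qbd_stationary m B Am A0 A1 G Gh R \<pi> by (rule stationary)
    show ?thesis using process.green_intertwines_if_R_vanishes[OF R_pow_limit] by blast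
  next
    case False
    then show ?thesis using process.green_intertwines_if_not_stochastic[OF not_stochastic] by blast
  qed
  then have green: "qbd_green m Am A0 A1 G Gh R" and inter: "process.green * R = Gh * process.green"
    by blast+

  define q where "q = m - p"
  define V1i where "V1i = minv V1"
  have V1i: "V1i \<in> carrier_mat p p" "V1 * V1i = 1\<^sub>m p" "V1i * V1 = 1\<^sub>m p"
    unfolding V1i_def using minv_inverse[OF V1] by blast+
  have V0c: "V0 \<in> carrier_mat q q" using V0 unfolding q_def by simp
  have "\<exists>n>0. V0 ^\<^sub>m n = 0\<^sub>m q q"
    using spectral_radius_zero_nilpotent[OF V0c] V0(2) unfolding q_def by auto
  then have \<nu>0: "0 < \<nu>" and \<nu>nil: "V0 ^\<^sub>m \<nu> = 0\<^sub>m q q"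
    unfolding \<nu> q_def[symmetric] by (metis (mono_tags, lifting) LeastI_ex)+
  define n where "n = \<nu> - 1"
  have n: "Suc n = \<nu>" unfolding n_def using \<nu>0 by simp
  have LKc: "L \<in> carrier_mat m p" "K \<in> carrier_mat m q" and EFc: "E \<in> carrier_mat p m" "F \<in> carrier_mat q m"
    using LK EF unfolding q_def by simp_all
  have pq: "p + q = m" unfolding q_def using p by simp
  note Mi = minv_inverse[OF M]
  \<comment> \<open>The off-diagonal blocks of \<open>J\<close> vanish, so comparing blocks of \<open>Gh M = M J\<close> and of its inverse form
    gives the relations for \<open>L\<close>, \<open>K\<close>, \<open>E\<close> and \<open>F\<close> separately.\<close>
  define J where "J = four_block_mat V1 (0\<^sub>m p q) (0\<^sub>m q p) V0"
  have Jc: "J \<in> carrier_mat m m"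
    using four_block_carrier_mat[OF V1(1) V0c, of "0\<^sub>m p q" "0\<^sub>m q p"] unfolding J_def pq .
  have J': "cmat Gh * M = M * J" using Jordan unfolding J_def q_def .
  have Ghc: "cmat Gh \<in> carrier_mat m m" by simp
  have M4: "M = four_block_mat L K (0\<^sub>m 0 p) (0\<^sub>m 0 q)" using LK(3) unfolding q_def .
  have Mi4: "minv M = four_block_mat E (0\<^sub>m p 0) F (0\<^sub>m q 0)"
    unfolding EF(3) append_rows_def using EFc by simp
  \<comment> \<open>Empty blocks are added, so that products of block matrices can be compared blockwise.\<close>
  have GhM: "cmat Gh = four_block_mat (cmat Gh) (0\<^sub>m m 0) (0\<^sub>m 0 m) (0\<^sub>m 0 0)"
    by (intro eq_mat_entriesI[of _ m m]) (auto simp: four_block_mat_def)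
  have LE: "L * E + K * F = 1\<^sub>m m"
  proof -
    have "1\<^sub>m m = M * minv M" using Mi(2) by simp
    also have "\<dots> = four_block_mat (L * E + K * F) (L * 0\<^sub>m p 0 + K * 0\<^sub>m q 0)
        (0\<^sub>m 0 p * E + 0\<^sub>m 0 q * F) (0\<^sub>m 0 p * 0\<^sub>m p 0 + 0\<^sub>m 0 q * 0\<^sub>m q 0)"
      unfolding Mi4 unfolding M4 using LKc EFc by (intro mult_four_block_mat) auto
    finally have eq: "1\<^sub>m m = \<dots>" .
    have "L * E \<in> carrier_mat m m" "K * F \<in> carrier_mat m m" using LKc EFc by auto
    then show ?thesis
      using LKc EFc arg_cong[OF eq, of "\<lambda>X. X $$ (a, b)" for a b]
      by (intro eq_mat_entriesI[of _ m m]) (auto simp del: index_mult_mat(1))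
  qed
  have GhLK: "cmat Gh * L = L * V1 \<and> cmat Gh * K = K * V0"
  proof -
    have 1: "cmat Gh * M = four_block_mat (cmat Gh * L + 0\<^sub>m m 0 * 0\<^sub>m 0 p) (cmat Gh * K + 0\<^sub>m m 0 * 0\<^sub>m 0 q)
        (0\<^sub>m 0 m * L + 0\<^sub>m 0 0 * 0\<^sub>m 0 p) (0\<^sub>m 0 m * K + 0\<^sub>m 0 0 * 0\<^sub>m 0 q)"
      by (subst GhM, unfold M4, rule mult_four_block_mat) (use LKc in auto)
    have 2: "M * J = four_block_mat (L * V1 + K * 0\<^sub>m q p) (L * 0\<^sub>m p q + K * V0)
        (0\<^sub>m 0 p * V1 + 0\<^sub>m 0 q * 0\<^sub>m q p) (0\<^sub>m 0 p * 0\<^sub>m p q + 0\<^sub>m 0 q * V0)"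
      unfolding M4 J_def by (rule mult_four_block_mat) (use LKc V1 V0c in auto)
    have c: "cmat Gh * L \<in> carrier_mat m p" "cmat Gh * K \<in> carrier_mat m q"
      "L * V1 \<in> carrier_mat m p" "K * V0 \<in> carrier_mat m q" using Ghc LKc V1 V0c by auto
    have e: "(cmat Gh * M) $$ (a, b) = (M * J) $$ (a, b)" for a b unfolding J' ..
    show ?thesis
    proof
      show "cmat Gh * L = L * V1"
      proof (rule eq_mat_entriesI[OF c(1,3)])
        fix a b assume "a < m" "b < p"
        then show "(cmat Gh * L) $$ (a, b) = (L * V1) $$ (a, b)"
          using e[of a b] c LKc V1 V0c unfolding 1 2 by (simp del: index_mult_mat(1))
      qed
      show "cmat Gh * K = K * V0"
      proof (rule eq_mat_entriesI[OF c(2,4)])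
        fix a b assume "a < m" "b < q"
        then show "(cmat Gh * K) $$ (a, b) = (K * V0) $$ (a, b)"
          using e[of a "p + b"] c LKc V1 V0c unfolding 1 2 by (simp del: index_mult_mat(1))
      qed
    qed
  qed
  have EFGh: "E * cmat Gh = V1 * E \<and> F * cmat Gh = V0 * F"
  proof -
    have MiGh: "minv M * cmat Gh = J * minv M"
    proof -
      have "minv M * cmat Gh = minv M * (cmat Gh * (M * minv M))"
        using Mi Ghc right_mult_one_mat[OF Ghc] by simp
      also have "\<dots> = minv M * ((cmat Gh * M) * minv M)"
        using Mi Ghc M by (simp add: assoc_mult_mat[of _ m m _ m _ m])
      also have "\<dots> = minv M * (M * (J * minv M))"
        unfolding J' using Mi(1) M(1) Jc by (simp add: assoc_mult_mat[of M m m J m "minv M" m])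
      also have "\<dots> = (minv M * M) * (J * minv M)"
        using Mi(1) M(1) Jc by (intro assoc_mult_mat[symmetric, of _ m m _ m _ m]) auto
      also have "\<dots> = J * minv M"
        unfolding Mi(3) using Mi(1) Jc by (intro left_mult_one_mat[of _ m m]) simp
      finally show ?thesis .
    qed
    have 1: "minv M * cmat Gh = four_block_mat (E * cmat Gh + 0\<^sub>m p 0 * 0\<^sub>m 0 m) (E * 0\<^sub>m m 0 + 0\<^sub>m p 0 * 0\<^sub>m 0 0)
        (F * cmat Gh + 0\<^sub>m q 0 * 0\<^sub>m 0 m) (F * 0\<^sub>m m 0 + 0\<^sub>m q 0 * 0\<^sub>m 0 0)"
      by (subst GhM, unfold Mi4, rule mult_four_block_mat) (use EFc in auto)
    have 2: "J * minv M = four_block_mat (V1 * E + 0\<^sub>m p q * F) (V1 * 0\<^sub>m p 0 + 0\<^sub>m p q * 0\<^sub>m q 0)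
        (0\<^sub>m q p * E + V0 * F) (0\<^sub>m q p * 0\<^sub>m p 0 + V0 * 0\<^sub>m q 0)"
      unfolding Mi4 J_def by (rule mult_four_block_mat) (use EFc V1 V0c in auto)
    have c: "E * cmat Gh \<in> carrier_mat p m" "F * cmat Gh \<in> carrier_mat q m"
      "V1 * E \<in> carrier_mat p m" "V0 * F \<in> carrier_mat q m" using Ghc EFc V1 V0c by auto
    have e: "(minv M * cmat Gh) $$ (a, b) = (J * minv M) $$ (a, b)" for a b unfolding MiGh ..
    show ?thesis
    proof
      show "E * cmat Gh = V1 * E"
      proof (rule eq_mat_entriesI[OF c(1,3)])
        fix a b assume "a < p" "b < m"
        then show "(E * cmat Gh) $$ (a, b) = (V1 * E) $$ (a, b)"
          using e[of a b] c EFc V1 V0c unfolding 1 2 by (simp del: index_mult_mat(1))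
      qed
      show "F * cmat Gh = V0 * F"
      proof (rule eq_mat_entriesI[OF c(2,4)])
        fix a b assume "a < q" "b < m"
        then show "(F * cmat Gh) $$ (a, b) = (V0 * F) $$ (a, b)"
          using e[of "p + a" b] c EFc V1 V0c unfolding 1 2 by (simp del: index_mult_mat(1))
      qed
    qed
  qed
  have "qbd_poisson m B Am A0 A1 G Gh R p q n L K E F V1 V1i V0 g"
    unfolding qbd_poisson_def qbd_poisson_axioms_def
    using process.qbd_process_axioms green inter LKc EFc V1(1) V1i V0c g LE GhLK EFGh \<nu>nil n by auto
  then interpret po: qbd_poisson m B Am A0 A1 G Gh R p q n L K E F V1 V1i V0 g .

  have U1: "U - 1\<^sub>m m \<in> carrier_mat m m" unfolding U' by simp
  have NU: "(- process.N) * (U - 1\<^sub>m m) = 1\<^sub>m m"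
  proof -
    have "U - 1\<^sub>m m = - (1\<^sub>m m - process.U)" unfolding U'
      by (intro eq_mat_entriesI[of _ m m]) auto
    then show ?thesis using process.N_inverse(1) by simp
  qed
  have invU: "invertible_mat (U - 1\<^sub>m m)" and minvU: "minv (U - 1\<^sub>m m) = - process.N"
    using left_inverse_invertible[OF U1 _ NU] by simp_all
  have Wt: "W_term G U R j $$ (a, b) = - (process.green_term j $$ (a, b))" if ab: "a < m" "b < m" for j a b
  proof -
    have "dim_row U = m" unfolding U' by simp
    then have "W_term G U R j = G ^\<^sub>m j * (- process.N) * R ^\<^sub>m j"
      unfolding W_term_def using minvU by simp
    also have "\<dots> = - process.green_term j" unfolding process.green_term_def by simp
    finally have "W_term G U R j = - process.green_term j" .
    moreover have "dim_row (process.green_term j) = m" "dim_col (process.green_term j) = m"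
      by (rule carrier_matD[OF process.green_term_carrier])+
    ultimately show ?thesis using ab by simp
  qed
  have Ws: "summable (\<lambda>j. W_term G U R j $$ (a, b))" if "a < m" "b < m" for a b
    using summable_minus[OF po.summable_green[OF that]] that by (simp add: Wt)
  have W': "W = po.W"
    unfolding W po.W_def process.green_def
    by (intro eq_mat_entriesI[of _ m m]) (auto simp: Wt suminf_minus[OF po.summable_green])

  have \<sigma>': "\<sigma> r = po.c.particular r" for r
    unfolding \<sigma> po.c.particular_def W' unfolding V1i_def n_def ..
  have form: "solution_form x y r = po.c.solution x y r" for x y r
    unfolding solution_form_def po.c.solution_def \<sigma>' unfolding V1i_def ..
  have rhs': "rhs y = po.rhs y" for y
    unfolding rhs_def po.rhs_def \<sigma>' unfolding V1i_def ..
  have Lv1: "L * V1i \<in> carrier_mat m p" using LKc V1i by auto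

  have general: "\<forall>u. poisson_solution m P g u \<longrightarrow>
      (\<exists>x \<in> carrier_vec m. \<exists>y \<in> carrier_vec p. \<forall>r. u r = solution_form x y r)"
    unfolding P' form po.poisson_solution_form[OF refl] by blast

  have \<sigma>1: "\<sigma> 1 = - vsum m (\<lambda>j. (K * V0 ^\<^sub>m j * F * cmat W) *\<^sub>v g (j + 1)) {0..\<nu> - 1}"
    unfolding \<sigma>' W' n_def[symmetric] by (rule po.c.particular_1)

  have transient: "invertible_mat (1\<^sub>m m - Pstar) \<and>
      (\<forall>u. poisson_solution m P g u \<longleftrightarrow>
        (\<exists>y \<in> carrier_vec p. \<exists>x. x = cmat (minv (1\<^sub>m m - Pstar)) *\<^sub>v rhs y \<and> (\<forall>r. u r = solution_form x y r)))"
    if tr: "transient_chain (qbd_states m) P"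
  proof -
    have s0: "(0, 0) \<in> qbd_states m" using m by simp
    have "\<not> recurrent_chain (qbd_states m) P"
      using tr s0 unfolding transient_chain_def recurrent_chain_def by force
    then have lim: "mat_limit m (\<lambda>j. G ^\<^sub>m j) (0\<^sub>m m m)"
      using process.green_intertwines_if_not_stochastic(3) not_stochastic by blast
    have inv: "invertible_mat (1\<^sub>m m - Pstar)"
      unfolding Pstar' by (rule process.one_minus_Pstar_invertible_if_not_stochastic[OF lim])
    have Hc: "1\<^sub>m m - Pstar \<in> carrier_mat m m" unfolding Pstar' by simp
    note Hi = minv_inverse[OF Hc inv]
    define H X where "H = cmat (1\<^sub>m m - Pstar)" and "X = cmat (minv (1\<^sub>m m - Pstar))"
    have HX: "H \<in> carrier_mat m m" "X \<in> carrier_mat m m" "H * X = 1\<^sub>m m" "X * H = 1\<^sub>m m"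
      unfolding H_def X_def using Hc Hi by (simp_all add: cmat_mult[of _ m m _ m, symmetric] cmat_one)
    have eq: "H *\<^sub>v x = z \<longleftrightarrow> x = X *\<^sub>v z" if "x \<in> carrier_vec m" "z \<in> carrier_vec m" for x z
      using mat_mult_vec_eqI[OF HX(3,1,2) that(2)] mat_mult_vec_eqI[OF HX(4,2,1) that(1)] that by auto
    have "poisson_solution m P g u \<longleftrightarrow>
        (\<exists>y \<in> carrier_vec p. \<exists>x. x = X *\<^sub>v rhs y \<and> (\<forall>r. u r = solution_form x y r))" for u
    proof -
      have "poisson_solution m P g u \<longleftrightarrow> (\<exists>x\<in>carrier_vec m. \<exists>y\<in>carrier_vec p.
          H *\<^sub>v x = po.rhs y \<and> (\<forall>r. u r = po.c.solution x y r))"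
        unfolding P' H_def Pstar' by (rule po.poisson_solution_form) simp
      also have "\<dots> \<longleftrightarrow> (\<exists>y\<in>carrier_vec p. \<exists>x\<in>carrier_vec m.
          x = X *\<^sub>v po.rhs y \<and> (\<forall>r. u r = po.c.solution x y r))"
        using eq po.rhs_carrier(1) by blast
      also have "\<dots> \<longleftrightarrow> (\<exists>y\<in>carrier_vec p. \<exists>x. x = X *\<^sub>v po.rhs y \<and> (\<forall>r. u r = po.c.solution x y r))"
        using HX(2) by (intro bex_cong) auto
      finally show ?thesis unfolding rhs' form .
    qed
    then show ?thesis using inv unfolding X_def by blast
  qed

  have positive: "(\<exists>X. is_group_inverse (1\<^sub>m m - Pstar) X) \<and>
        (\<forall>a<p. summable (\<lambda>k. ((V1 ^\<^sub>m Suc k * E * cmat W) *\<^sub>v g (Suc k)) $ a)) \<and>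
        summable (\<lambda>i. cvec (\<pi> i) \<bullet> g i) \<and>
        (\<forall>u. poisson_solution m P g u \<longleftrightarrow>
           (\<exists>y\<^sub>s \<in> carrier_vec p. \<exists>y\<^sub>p \<in> carrier_vec p. \<exists>y x. \<exists>\<alpha> :: complex.
              y\<^sub>s = - vec p (\<lambda>a. \<Sum>k. ((V1 ^\<^sub>m Suc k * E * cmat W) *\<^sub>v g (Suc k)) $ a) \<and>
              cvec (\<pi> 0) \<bullet> ((cmat (minv W) * L) *\<^sub>v y\<^sub>p) = (\<Sum>i. cvec (\<pi> i) \<bullet> g i) \<and>
              y = y\<^sub>s + y\<^sub>p \<and>
              x = cmat (group_inverse (1\<^sub>m m - Pstar)) *\<^sub>v rhs y + \<alpha> \<cdot>\<^sub>v vec m (\<lambda>_. 1) \<and>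
              (\<forall>r. u r = solution_form x y r)))"
    if pr: "positive_recurrent_chain (qbd_states m) P"
      and sm: "\<forall>a<m. summable (\<lambda>k. (cmat (R ^\<^sub>m k) *\<^sub>v g k) $ a)"
  proof -
    interpret st: qbd_stationary m B Am A0 A1 G Gh R \<pi> by (rule stationary[OF pr])
    interpret ps: qbd_poisson_stationary m B Am A0 A1 G Gh R p q n L K E F V1 V1i V0 g \<pi>
      using sm by unfold_locales blast
    have "poisson_solution m P g u \<longleftrightarrow>
           (\<exists>y\<^sub>s \<in> carrier_vec p. \<exists>y\<^sub>p \<in> carrier_vec p. \<exists>y x. \<exists>\<alpha> :: complex.
              y\<^sub>s = - vec p (\<lambda>a. \<Sum>k. ((V1 ^\<^sub>m Suc k * E * cmat W) *\<^sub>v g (Suc k)) $ a) \<and>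
              cvec (\<pi> 0) \<bullet> ((cmat (minv W) * L) *\<^sub>v y\<^sub>p) = (\<Sum>i. cvec (\<pi> i) \<bullet> g i) \<and>
              y = y\<^sub>s + y\<^sub>p \<and>
              x = cmat (group_inverse (1\<^sub>m m - Pstar)) *\<^sub>v rhs y + \<alpha> \<cdot>\<^sub>v vec m (\<lambda>_. 1) \<and>
              (\<forall>r. u r = solution_form x y r))" for u
      unfolding P' W' Pstar' rhs' form po.W_inverse(2) ps.ystar_eq[symmetric] ps.poisson_solution_stationary
      using ps.ystar_carrier by blast
    then show ?thesis
      using st.group_inverse_H(1) ps.V1_series_summable ps.\<pi>_g_summable unfolding W' Pstar' by blast
  qed

  show ?thesis
  proof (intro conjI, goal_cases)
    case 1 show ?case by (rule invU)
  next
    case 2 show ?case using Ws by blast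
  next
    case 3 show ?case unfolding W' by (rule po.W_inverse(1))
  next
    case 4 show ?case by (rule general)
  next
    case 5 show ?case by (rule \<sigma>1)
  next
    case 6 show ?case by (rule impI, rule transient)
  next
    case 7 show ?case by (rule impI, elim conjE, rule positive)
  qed
qed

end
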